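(* Let $M$ be a compact rotational constant mean curvature hypersurface of $\mathbb{S}^{n+1}$ generated by data $(n,H,c,r,\theta,l,m)$ as described in the context. Let $\alpha_1=0,\ \alpha_2=n-1,\ \dots,\ \alpha_k=(k-1)(n+k-3),\dots$ denote the spectrum of the Laplacian of the round unit sphere $\mathbb{S}^{n-1}$. (1) The spectrum of the Laplace operator $\Delta$ on $M$ is $\bigcup_{k=1}^\infty\Gamma_k$, where $\Gamma_k=\{\lambda(k,1),\lambda(k,2),\dots\}$ is the ordered spectrum, on $mT$-periodic functions of $t\in\mathbb{R}$, of the operator $$K_{\Delta,k}[z]=z''+(n-1)\frac{r'}{r}z'-\frac{\alpha_k}{r^2}\,z .$$ (2) The spectrum of the Jacobi operator $J$ on $M$ is $\bigcup_{k=1}^\infty\mathbb{F}_k$, where $\mathbb{F}_k=\{\tilde\lambda(k,1),\tilde\lambda(k,2),\dots\}$ is the ordered spectrum, on $mT$-periodic functions of $t\in\mathbb{R}$, of the operator $$K_{J,k}[z]=z''+(n-1)\frac{r'}{r}z'+\left(n+nH^2+n(n-1)c^{-n}r^{-2n}-\frac{\alpha_k}{r^2}\right)z .$$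
   Context: Rotational CMC hypersurfaces of the unit sphere $\mathbb{S}^{n+1}\subset\mathbb{R}^{n+2}$, $n\ge 2$. Fix $H\in\mathbb{R}$ and $c>0$. Let $r:\mathbb{R}\to(0,1)$ be a smooth non-constant periodic function with least period $T>0$ satisfying $$(r')^2+r^2(1+\lambda^2)=1,\qquad \lambda(t)=H+c^{-n/2}r(t)^{-n}.$$ Put $$\theta(t)=\int_0^t\frac{r(\tau)\lambda(\tau)}{1-r(\tau)^2}\,d\tau,$$ and assume that $c$ is such that $\theta(T)=2\pi\frac{l}{m}$ with $l,m$ relatively prime integers, $m\geq 1$. The immersion is $$\phi:\mathbb{S}^{n-1}\times\mathbb{R}\to\mathbb{S}^{n+1},\qquad \phi(y,t)=\left(r(t)\,y,\ \sqrt{1-r(t)^2}\cos\theta(t),\ \sqrt{1-r(t)^2}\sin\theta(t)\right).$$ It satisfies $\phi(y,t+mT)=\phi(y,t)$. The compact rotational hypersurface $M$ is the compact manifold $\mathbb{S}^{n-1}\times(\mathbb{R}/mT\mathbb{Z})$ immersed by $\phi$, with the induced metric; it has constant mean curvature $H$. Its principal curvatures are $\lambda$ with multiplicity $n-1$ and $\mu=H-(n-1)c^{-n/2}r^{-n}$ with multiplicity one. The Jacobi (stability) operator is $J(f)=-\Delta f-nf-|A|^2f$, where $\Delta=\mathrm{div}\,\nabla$ is the Laplacian of $M$ and $|A|^2$ is the square of the norm of the second fundamental form of $M$. Eigenvalue conventions: $\lambda$ is an eigenvalue of the Laplacian $\Delta$ (on $M$ or on $\mathbb{S}^{n-1}$)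 if $\Delta f+\lambda f=0$ for some smooth $f\not\equiv0$; $\lambda$ is an eigenvalue of $J$ if $J(f)=\lambda f$ for some smooth $f\not\equiv 0$; $\lambda$ is an eigenvalue of $K_{\Delta,k}$ or $K_{J,k}$ if $K[z]+\lambda z=0$ has a non-zero $mT$-periodic solution $z$. The spectrum is the set of eigenvalues. *)

theory Defs
  imports "HOL-Analysis.Analysis"
begin

section \<open>Smooth maps\<close>

primrec times_differentiable ::
  "nat \<Rightarrow> 'a::euclidean_space set \<Rightarrow> ('a \<Rightarrow> 'b::euclidean_space) \<Rightarrow> bool" where
  "times_differentiable 0 S f \<longleftrightarrow> continuous_on S f"
| "times_differentiable (Suc k) S f \<longleftrightarrow>
     (\<forall>x\<in>S. f differentiable (at x)) \<and>
     (\<forall>v. times_differentiable k S (\<lambda>x. frechet_derivative f (at x) v))"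

text \<open>For open \<open>S\<close> this is the usual \<open>C\<close>-infinity condition.\<close>

definition smooth_on_open ::
  "'a::euclidean_space set \<Rightarrow> ('a \<Rightarrow> 'b::euclidean_space) \<Rightarrow> bool" where
  "smooth_on_open S f \<longleftrightarrow> (\<forall>k. times_differentiable k S f)"

text \<open>Below, \<open>N\<close> is a submanifold of a Euclidean space, and only the values of maps on \<open>N\<close>
  matter. A map is smooth on \<open>N\<close> if it is locally the restriction of a smooth map.\<close>

definition smooth_along ::
  "'a::euclidean_space set \<Rightarrow> ('a \<Rightarrow> 'b::euclidean_space) \<Rightarrow> bool" where
  "smooth_along N f \<longleftrightarrow>
     (\<forall>p\<in>N. \<exists>U g. open U \<and> p \<in> U \<and> smooth_on_open U g \<and> (\<forall>q\<in>N \<inter> U. g q = f q))"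

definition tangent_space :: "'a::euclidean_space set \<Rightarrow> 'a \<Rightarrow> 'a set" where
  "tangent_space N p =
     {v. \<exists>\<gamma>::real \<Rightarrow> 'a. smooth_on_open UNIV \<gamma> \<and> range \<gamma> \<subseteq> N \<and> \<gamma> 0 = p \<and>
         (\<gamma> has_vector_derivative v) (at 0)}"

text \<open>A derivative of \<open>f\<close> at \<open>p\<close> within \<open>N\<close> is not unique as a linear map on the ambient space,
  but it is unique on \<open>tangent_space N p\<close>; \<open>differential\<close> is only ever applied to tangent
  vectors.\<close>

definition differential ::
  "'a::euclidean_space set \<Rightarrow> ('a \<Rightarrow> 'b::euclidean_space) \<Rightarrow> 'a \<Rightarrow> 'a \<Rightarrow> 'b" where
  "differential N f p v = frechet_derivative f (at p within N) v"

section \<open>Geometry of a submanifold \<open>N\<close> immersed by \<open>F\<close>\<close>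

definition induced_metric ::
  "'a::euclidean_space set \<Rightarrow> ('a \<Rightarrow> 'b::euclidean_space) \<Rightarrow> 'a \<Rightarrow> 'a \<Rightarrow> 'a \<Rightarrow> real" where
  "induced_metric N F p v w = differential N F p v \<bullet> differential N F p w"

definition orthonormal_frame ::
  "'a::euclidean_space set \<Rightarrow> ('a \<Rightarrow> 'b::euclidean_space) \<Rightarrow> 'a \<Rightarrow> 'a set \<Rightarrow> bool" where
  "orthonormal_frame N F p B \<longleftrightarrow>
     finite B \<and> span B = tangent_space N p \<and>
     (\<forall>u\<in>B. \<forall>v\<in>B. induced_metric N F p u v = (if u = v then 1 else 0))"

text \<open>Traces and norms of tensors do not depend on the frame, so one is chosen.\<close>

definition some_frame ::
  "'a::euclidean_space set \<Rightarrow> ('a \<Rightarrow> 'b::euclidean_space) \<Rightarrow> 'a \<Rightarrow> 'a set" where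
  "some_frame N F p = (SOME B. orthonormal_frame N F p B)"

definition gradient ::
  "'a::euclidean_space set \<Rightarrow> ('a \<Rightarrow> 'b::euclidean_space) \<Rightarrow> ('a \<Rightarrow> real) \<Rightarrow> 'a \<Rightarrow> 'a" where
  "gradient N F f p =
     (THE w. w \<in> tangent_space N p \<and>
        (\<forall>v\<in>tangent_space N p. induced_metric N F p w v = differential N f p v))"

text \<open>The Levi-Civita connection of the induced metric: \<open>covariant_derivative N F X p v\<close> is the
  tangent vector whose image under the differential of \<open>F\<close> is the tangential part of the
  derivative in direction \<open>v\<close> of the field \<open>dF(X)\<close>.\<close>

definition covariant_derivative ::
  "'a::euclidean_space set \<Rightarrow> ('a \<Rightarrow> 'b::euclidean_space) \<Rightarrow> ('a \<Rightarrow> 'a) \<Rightarrow> 'a \<Rightarrow> 'a \<Rightarrow> 'a" where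
  "covariant_derivative N F X p v =
     (THE w. w \<in> tangent_space N p \<and>
        (\<forall>u\<in>tangent_space N p. induced_metric N F p w u =
           differential N (\<lambda>q. differential N F q (X q)) p v \<bullet> differential N F p u))"

definition divergence ::
  "'a::euclidean_space set \<Rightarrow> ('a \<Rightarrow> 'b::euclidean_space) \<Rightarrow> ('a \<Rightarrow> 'a) \<Rightarrow> 'a \<Rightarrow> real" where
  "divergence N F X p =
     (\<Sum>e\<in>some_frame N F p. induced_metric N F p (covariant_derivative N F X p e) e)"

definition laplacian ::
  "'a::euclidean_space set \<Rightarrow> ('a \<Rightarrow> 'b::euclidean_space) \<Rightarrow> ('a \<Rightarrow> real) \<Rightarrow> 'a \<Rightarrow> real" where
  "laplacian N F f = divergence N F (gradient N F f)"

section \<open>Hypersurfaces of the unit sphere\<close>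

text \<open>Here \<open>F\<close> takes values in the unit sphere of \<open>'b\<close>, as a hypersurface: unit normal fields
  are tangent to the sphere, i.e. also orthogonal to \<open>F\<close> itself.\<close>

definition unit_normal_field ::
  "'a::euclidean_space set \<Rightarrow> ('a \<Rightarrow> 'b::euclidean_space) \<Rightarrow> ('a \<Rightarrow> 'b) \<Rightarrow> bool" where
  "unit_normal_field N F \<nu> \<longleftrightarrow>
     smooth_along N \<nu> \<and>
     (\<forall>p\<in>N. norm (\<nu> p) = 1 \<and> \<nu> p \<bullet> F p = 0 \<and>
        (\<forall>v\<in>tangent_space N p. \<nu> p \<bullet> differential N F p v = 0))"

definition second_fundamental_form ::
  "'a::euclidean_space set \<Rightarrow> ('a \<Rightarrow> 'b::euclidean_space) \<Rightarrow> ('a \<Rightarrow> 'b) \<Rightarrow> 'a \<Rightarrow> 'a \<Rightarrow> 'a \<Rightarrow> real" where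
  "second_fundamental_form N F \<nu> p v w = - (differential N \<nu> p v \<bullet> differential N F p w)"

text \<open>On a connected \<open>N\<close> the unit normal field is unique up to sign, which the square does not see.\<close>

definition norm_A_squared ::
  "'a::euclidean_space set \<Rightarrow> ('a \<Rightarrow> 'b::euclidean_space) \<Rightarrow> 'a \<Rightarrow> real" where
  "norm_A_squared N F p =
     (let \<nu> = (SOME \<nu>. unit_normal_field N F \<nu>); B = some_frame N F p
      in \<Sum>u\<in>B. \<Sum>v\<in>B. (second_fundamental_form N F \<nu> p u v)\<^sup>2)"

text \<open>\<open>n\<close> is the dimension of the hypersurface.\<close>

definition jacobi_operator ::
  "nat \<Rightarrow> 'a::euclidean_space set \<Rightarrow> ('a \<Rightarrow> 'b::euclidean_space) \<Rightarrow> ('a \<Rightarrow> real) \<Rightarrow> 'a \<Rightarrow> real" where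
  "jacobi_operator n N F f p =
     - laplacian N F f p - real n * f p - norm_A_squared N F p * f p"

text \<open>\<open>D\<close> is the space of smooth functions on which the operator acts. For a quotient of \<open>N\<close> by a
  group of deck transformations it consists of the invariant functions.\<close>

definition laplace_spectrum ::
  "'a::euclidean_space set \<Rightarrow> ('a \<Rightarrow> 'b::euclidean_space) \<Rightarrow> ('a \<Rightarrow> real) set \<Rightarrow> real set" where
  "laplace_spectrum N F D =
     {\<mu>. \<exists>f\<in>D. (\<exists>p\<in>N. f p \<noteq> 0) \<and> (\<forall>p\<in>N. laplacian N F f p + \<mu> * f p = 0)}"

definition jacobi_spectrum ::
  "nat \<Rightarrow> 'a::euclidean_space set \<Rightarrow> ('a \<Rightarrow> 'b::euclidean_space) \<Rightarrow> ('a \<Rightarrow> real) set \<Rightarrow> real set" where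
  "jacobi_spectrum n N F D =
     {\<mu>. \<exists>f\<in>D. (\<exists>p\<in>N. f p \<noteq> 0) \<and> (\<forall>p\<in>N. jacobi_operator n N F f p = \<mu> * f p)}"

definition unit_sphere :: "(real^'n) set" where
  "unit_sphere = sphere 0 1"

definition sphere_laplace_spectrum :: "'n::finite itself \<Rightarrow> real set" where
  "sphere_laplace_spectrum _ =
     laplace_spectrum (unit_sphere :: (real^'n) set) (\<lambda>y. y) {f. smooth_along unit_sphere f}"

section \<open>Rotational hypersurfaces\<close>

definition lam :: "nat \<Rightarrow> real \<Rightarrow> real \<Rightarrow> (real \<Rightarrow> real) \<Rightarrow> real \<Rightarrow> real" where
  "lam n H c r t = H + c powr (- real n / 2) * r t powr (- real n)"

definition theta :: "nat \<Rightarrow> real \<Rightarrow> real \<Rightarrow> (real \<Rightarrow> real) \<Rightarrow> real \<Rightarrow> real" where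
  "theta n H c r t =
     (LBINT s=ereal 0..ereal t. r s * lam n H c r s / (1 - (r s)\<^sup>2))"

definition rotational_data ::
  "nat \<Rightarrow> real \<Rightarrow> real \<Rightarrow> (real \<Rightarrow> real) \<Rightarrow> real \<Rightarrow> int \<Rightarrow> int \<Rightarrow> bool" where
  "rotational_data n H c r T l m \<longleftrightarrow>
     n \<ge> 2 \<and> c > 0 \<and>
     smooth_on_open UNIV r \<and> (\<forall>t. 0 < r t \<and> r t < 1) \<and> (\<exists>s t. r s \<noteq> r t) \<and>
     T > 0 \<and> (\<forall>t. r (t + T) = r t) \<and>
     (\<forall>S. 0 < S \<and> S < T \<longrightarrow> (\<exists>t. r (t + S) \<noteq> r t)) \<and>
     (\<forall>t. (deriv r t)\<^sup>2 + (r t)\<^sup>2 * (1 + (lam n H c r t)\<^sup>2) = 1) \<and>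
     coprime l m \<and> m \<ge> 1 \<and>
     theta n H c r T = 2 * pi * real_of_int l / real_of_int m"

text \<open>The covering space \<open>sphere \<times> \<real>\<close>; functions on \<open>M = sphere \<times> (\<real> / P\<int>)\<close> are functions on it
  that have period \<open>P\<close> in the second variable.\<close>

definition cylinder :: "((real^'n) \<times> real) set" where
  "cylinder = unit_sphere \<times> UNIV"

definition smooth_functions_M :: "real \<Rightarrow> ((real^'n) \<times> real \<Rightarrow> real) set" where
  "smooth_functions_M P =
     {f. smooth_along cylinder f \<and> (\<forall>y\<in>unit_sphere. \<forall>t. f (y, t + P) = f (y, t))}"

definition phi ::
  "real \<Rightarrow> real \<Rightarrow> (real \<Rightarrow> real) \<Rightarrow> (real^'n) \<times> real \<Rightarrow> (real^'n) \<times> real \<times> real" where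
  "phi H c r = (\<lambda>(y, t).
     (r t *\<^sub>R y,
      sqrt (1 - (r t)\<^sup>2) * cos (theta CARD('n) H c r t),
      sqrt (1 - (r t)\<^sup>2) * sin (theta CARD('n) H c r t)))"

definition M_laplace_spectrum ::
  "'n::finite itself \<Rightarrow> real \<Rightarrow> real \<Rightarrow> (real \<Rightarrow> real) \<Rightarrow> real \<Rightarrow> real set" where
  "M_laplace_spectrum _ H c r P =
     laplace_spectrum (cylinder :: ((real^'n) \<times> real) set) (phi H c r) (smooth_functions_M P)"

definition M_jacobi_spectrum ::
  "'n::finite itself \<Rightarrow> real \<Rightarrow> real \<Rightarrow> (real \<Rightarrow> real) \<Rightarrow> real \<Rightarrow> real set" where
  "M_jacobi_spectrum _ H c r P =
     jacobi_spectrum CARD('n) (cylinder :: ((real^'n) \<times> real) set) (phi H c r)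
       (smooth_functions_M P)"

section \<open>The ordinary differential operators\<close>

definition alpha :: "nat \<Rightarrow> nat \<Rightarrow> real" where
  "alpha n k = (real k - 1) * (real n + real k - 3)"

definition K_Delta ::
  "nat \<Rightarrow> (real \<Rightarrow> real) \<Rightarrow> nat \<Rightarrow> (real \<Rightarrow> real) \<Rightarrow> real \<Rightarrow> real" where
  "K_Delta n r k z t =
     deriv (deriv z) t + (real n - 1) * (deriv r t / r t) * deriv z t
       - alpha n k / (r t)\<^sup>2 * z t"

definition K_J ::
  "nat \<Rightarrow> real \<Rightarrow> real \<Rightarrow> (real \<Rightarrow> real) \<Rightarrow> nat \<Rightarrow> (real \<Rightarrow> real) \<Rightarrow> real \<Rightarrow> real" where
  "K_J n H c r k z t =
     deriv (deriv z) t + (real n - 1) * (deriv r t / r t) * deriv z t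
       + (real n + real n * H\<^sup>2
          + real n * (real n - 1) * c powr (- real n) * r t powr (- 2 * real n)
          - alpha n k / (r t)\<^sup>2) * z t"

definition periodic_spectrum :: "real \<Rightarrow> ((real \<Rightarrow> real) \<Rightarrow> real \<Rightarrow> real) \<Rightarrow> real set" where
  "periodic_spectrum P K =
     {\<mu>. \<exists>z. (\<forall>t. z differentiable (at t) \<and> deriv z differentiable (at t)) \<and>
         (\<forall>t. z (t + P) = z t) \<and> (\<exists>t. z t \<noteq> 0) \<and> (\<forall>t. K z t + \<mu> * z t = 0)}"

text \<open>Sequences are indexed from 1; the spectrum is a set, so its listing is strictly increasing.\<close>

definition ordered_listing :: "(nat \<Rightarrow> real) \<Rightarrow> real set \<Rightarrow> bool" where
  "ordered_listing a S \<longleftrightarrow> strict_mono_on {1..} a \<and> a ` {1..} = S"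

end

theory Submission
  imports Defs
begin

text \<open>The induced metric of the rotational hypersurface is the warped product \<open>dt\<^sup>2 + r\<^sup>2 g\<close>, where \<open>g\<close> is the
  round metric of the sphere, because the profile curve is parametrized by arc length. Its Laplacian
  is therefore \<open>f\<^sub>t\<^sub>t + (n - 1) (r' / r) f\<^sub>t + \<Delta>\<^sub>S f / r\<^sup>2\<close> (\<open>laplacian_rotational\<close>), and the principal
  curvatures make \<open>|A|\<^sup>2\<close> a function of \<open>t\<close> alone (\<open>norm_A_squared_eq\<close>). Both operators thus separate
  into a spherical part and an ordinary differential operator.

  The spherical part needs no theory of spherical harmonics. A function on the sphere is extended to
  be constant on rays; its spherical Laplacian is then the flat Laplacian of the extension
  (\<open>laplacian_sphere\<close>), and integration against a radial weight over an annulus gives Green's identity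
  (\<open>green_annulus\<close>). Applied to powers of a height function \<open>y \<bullet> e\<close>, this identity is triangular
  (\<open>height_moment_laplacian\<close>): the moment of order \<open>k\<close> of \<open>\<Delta>\<^sub>S f\<close> is \<open>- k (k + n - 2)\<close> times that of
  \<open>f\<close>, up to the moment of order \<open>k - 2\<close>. A nonzero function has a nonzero height moment by the
  Stone-Weierstrass theorem (\<open>zero_if_height_moments_zero\<close>), and the first nonzero moment of an
  eigenfunction satisfies the separated equation for exactly one number \<open>k (k + n - 2)\<close>
  (\<open>eigenfunction_moment\<close>). On the sphere this says that the eigenvalues have this form; on the
  hypersurface it turns an eigenfunction into a periodic solution of an ordinary differential
  equation. Conversely, the Gegenbauer polynomial of degree \<open>k\<close> in a height is an eigenfunction of the
  sphere, and its product with a periodic solution is an eigenfunction of the hypersurface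
  (\<open>moment_eigenfunction\<close>).

  It remains to list the spectrum of a periodic problem \<open>(p z')' + p (Q + \<mu>) z = 0\<close> with \<open>p = r ^ (n - 1)\<close>
  in increasing order. A number \<open>\<mu>\<close> is an eigenvalue if the trace of the monodromy matrix equals \<open>2\<close>.
  At a Dirichlet eigenvalue the trace is at least \<open>2\<close> or at most \<open>- 2\<close>, according to the parity of the
  number of half turns of the Pruefer angle, and the angle at the end of a period is unbounded in
  \<open>\<mu>\<close>; the intermediate value theorem then gives arbitrarily large eigenvalues
  (\<open>eigenvalues_unbounded\<close>). They are bounded below by an energy argument and do not accumulate, since
  eigenfunctions for different eigenvalues are orthogonal and depend continuously on the eigenvalue
  and the initial data (\<open>eigenvalues_finite_below\<close>).\<close>

section \<open>Calculus of smooth maps\<close>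

lemma frechet_derivative_eqI:
  "(f has_derivative f') (at x) \<Longrightarrow> frechet_derivative f (at x) = f'"
  by (metis frechet_derivative_at)

lemma frechet_derivative_cong_open:
  assumes "open S" "x \<in> S" "\<And>y. y \<in> S \<Longrightarrow> f y = g y" "f differentiable (at x)"
  shows "g differentiable (at x)" "frechet_derivative g (at x) = frechet_derivative f (at x)"
proof -
  have "(f has_derivative frechet_derivative f (at x)) (at x)"
    using assms(4) frechet_derivative_works by blast
  hence g: "(g has_derivative frechet_derivative f (at x)) (at x)"
    using has_derivative_transform_within_open assms by blast
  show "g differentiable (at x)" using g by (auto simp: differentiable_def)
  show "frechet_derivative g (at x) = frechet_derivative f (at x)" by (rule frechet_derivative_eqI[OF g])
qed

lemma times_differentiable_cong:
  "\<lbrakk>open S; \<And>x. x \<in> S \<Longrightarrow> f x = g x; times_differentiable k S f\<rbrakk> \<Longrightarrow> times_differentiable k S g"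
proof (induction k arbitrary: f g)
  case 0
  then show ?case by (simp add: continuous_on_cong[of S S f g])
next
  case (Suc k)
  show ?case
    using Suc frechet_derivative_cong_open[OF Suc.prems(1) _ Suc.prems(2)] by simp
qed

lemma times_differentiable_subset:
  "\<lbrakk>times_differentiable k S f; T \<subseteq> S\<rbrakk> \<Longrightarrow> times_differentiable k T f"
  by (induction k arbitrary: f) (auto intro: continuous_on_subset)

lemma times_differentiable_SucD:
  "times_differentiable (Suc k) S f \<Longrightarrow> times_differentiable k S f"
proof (induction k arbitrary: f)
  case 0
  then show ?case
    by (auto intro!: continuous_at_imp_continuous_on differentiable_imp_continuous_within)
next
  case (Suc k)
  then show ?case by (metis times_differentiable.simps(2))
qed

text \<open>Smoothness is a local property; this is what allows a function that is only locally the restriction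
  of smooth functions to be extended by composition with a retraction.\<close>

lemma times_differentiable_local:
  assumes "\<And>x. x \<in> S \<Longrightarrow> \<exists>U. open U \<and> x \<in> U \<and> times_differentiable k U f"
  shows "times_differentiable k S f"
  using assms
proof (induction k arbitrary: f)
  case 0
  then show ?case
    by (simp, metis continuous_at_imp_continuous_on continuous_on_eq_continuous_at)
next
  case (Suc k)
  have "times_differentiable k S (\<lambda>x. frechet_derivative f (at x) v)" for v
    by (rule Suc.IH) (use Suc.prems in fastforce)
  with Suc.prems show ?case by fastforce
qed

lemma times_differentiable_has_derivative:
  "times_differentiable (Suc k) S f \<Longrightarrow> x \<in> S \<Longrightarrow>
     (f has_derivative frechet_derivative f (at x)) (at x)"
  by (simp add: frechet_derivative_works[symmetric])

lemma times_differentiable_frechet: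
  "times_differentiable (Suc k) S f \<Longrightarrow> times_differentiable k S (\<lambda>x. frechet_derivative f (at x) v)"
  by simp

lemma times_differentiable_SucI:
  assumes "open S" "\<And>x. x \<in> S \<Longrightarrow> (f has_derivative f' x) (at x)"
    "\<And>v. times_differentiable k S (\<lambda>x. f' x v)"
  shows "times_differentiable (Suc k) S f"
proof -
  have "times_differentiable k S (\<lambda>x. frechet_derivative f (at x) v)" for v
    by (rule times_differentiable_cong[OF assms(1) _ assms(3)])
      (simp add: frechet_derivative_eqI[OF assms(2)])
  then show ?thesis using assms(2) by (auto simp: differentiable_def)
qed

lemma times_differentiable_const [simp]: "open S \<Longrightarrow> times_differentiable k S (\<lambda>x. c)"
proof (induction k arbitrary: c)
  case (Suc k)
  show ?case by (rule times_differentiable_SucI[where f' = "\<lambda>x v. 0"]) (use Suc in auto)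
qed simp

lemma times_differentiable_linear_compose:
  assumes L: "bounded_linear L" and S: "open S"
  shows "times_differentiable k S f \<Longrightarrow> times_differentiable k S (\<lambda>x. L (f x))"
proof (induction k arbitrary: f)
  case 0
  then show ?case by (auto intro: bounded_linear.continuous_on[OF L])
next
  case (Suc k)
  show ?case
    by (rule times_differentiable_SucI[OF S, where f' = "\<lambda>x v. L (frechet_derivative f (at x) v)"])
      (intro bounded_linear.has_derivative[OF L] times_differentiable_has_derivative[OF Suc.prems]
        Suc.IH times_differentiable_frechet Suc.prems | assumption)+
qed

lemma times_differentiable_id: "open S \<Longrightarrow> times_differentiable k S (\<lambda>x. x)"
proof (cases k)
  case (Suc j)
  assume "open S" then show ?thesis unfolding Suc
    by (intro times_differentiable_SucI[where f' = "\<lambda>x v. v"]) auto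
qed simp

lemma times_differentiable_add:
  assumes "open S"
  shows "\<lbrakk>times_differentiable k S f; times_differentiable k S g\<rbrakk> \<Longrightarrow> times_differentiable k S (\<lambda>x. f x + g x)"
proof (induction k arbitrary: f g)
  case 0
  then show ?case by (auto intro: continuous_on_add)
next
  case (Suc k)
  show ?case
    by (rule times_differentiable_SucI[OF assms,
        where f' = "\<lambda>x v. frechet_derivative f (at x) v + frechet_derivative g (at x) v"])
      (intro has_derivative_add times_differentiable_has_derivative[OF Suc.prems(1)]
        times_differentiable_has_derivative[OF Suc.prems(2)] Suc.IH times_differentiable_frechet Suc.prems | assumption)+
qed

lemma times_differentiable_sum:
  assumes "open S" "\<And>i. i \<in> I \<Longrightarrow> times_differentiable k S (f i)"
  shows "times_differentiable k S (\<lambda>x. \<Sum>i\<in>I. f i x)"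
proof (cases "finite I")
  case True
  then show ?thesis using assms(2)
    by (induction I rule: finite_induct) (auto intro: times_differentiable_add assms(1) simp: assms(1))
qed (simp add: assms)

lemma times_differentiable_bilinear:
  assumes B: "bounded_bilinear bop" and S: "open S"
  shows "\<lbrakk>times_differentiable k S f; times_differentiable k S g\<rbrakk> \<Longrightarrow> times_differentiable k S (\<lambda>x. bop (f x) (g x))"
proof (induction k arbitrary: f g)
  case 0
  then show ?case by (auto intro: bounded_bilinear.continuous_on[OF B])
next
  case (Suc k)
  show ?case
  proof (rule times_differentiable_SucI[OF S])
    fix x assume x: "x \<in> S"
    show "((\<lambda>x. bop (f x) (g x)) has_derivative (\<lambda>v. bop (f x) (frechet_derivative g (at x) v)
        + bop (frechet_derivative f (at x) v) (g x))) (at x)"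
      by (intro bounded_bilinear.FDERIV[OF B] times_differentiable_has_derivative[OF Suc.prems(1) x]
          times_differentiable_has_derivative[OF Suc.prems(2) x])
  next
    fix v
    show "times_differentiable k S (\<lambda>x. bop (f x) (frechet_derivative g (at x) v)
        + bop (frechet_derivative f (at x) v) (g x))"
    proof (rule times_differentiable_add[OF S])
      show "times_differentiable k S (\<lambda>x. bop (f x) (frechet_derivative g (at x) v))"
        by (rule Suc.IH[OF times_differentiable_SucD[OF Suc.prems(1)]]) (use Suc.prems(2) in simp)
      show "times_differentiable k S (\<lambda>x. bop (frechet_derivative f (at x) v) (g x))"
        by (rule Suc.IH[OF _ times_differentiable_SucD[OF Suc.prems(2)]]) (use Suc.prems(1) in simp)
    qed
  qed
qed

lemmas times_differentiable_mult = times_differentiable_bilinear[OF bounded_bilinear_mult]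
lemmas times_differentiable_scaleR = times_differentiable_bilinear[OF bounded_bilinear_scaleR]
lemmas times_differentiable_inner = times_differentiable_bilinear[OF bounded_bilinear_inner]

lemma linear_eq_sum_Basis:
  fixes L :: "'a::euclidean_space \<Rightarrow> 'b::real_vector"
  assumes "linear L"
  shows "L v = (\<Sum>b\<in>Basis. (v \<bullet> b) *\<^sub>R L b)"
proof -
  have "L v = L (\<Sum>b\<in>Basis. (v \<bullet> b) *\<^sub>R b)" by (simp add: euclidean_representation)
  also have "\<dots> = (\<Sum>b\<in>Basis. (v \<bullet> b) *\<^sub>R L b)"
    by (simp add: linear_sum[OF assms] linear_cmul[OF assms])
  finally show ?thesis .
qed

text \<open>The chain rule differentiates the outer derivative in a direction that varies with the
  point. Expanding this direction in the standard basis leaves derivatives in fixed directions,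
  to which the induction hypothesis applies.\<close>

lemma times_differentiable_compose:
  assumes S: "open S" and T: "open T" and fS: "f ` S \<subseteq> T"
  shows "\<lbrakk>times_differentiable k S f; times_differentiable k T g\<rbrakk> \<Longrightarrow> times_differentiable k S (\<lambda>x. g (f x))"
proof (induction k arbitrary: g)
  case 0
  then show ?case using fS by (auto intro: continuous_on_compose2)
next
  case (Suc k)
  let ?f' = "\<lambda>x. frechet_derivative f (at x)" and ?g' = "\<lambda>x. frechet_derivative g (at x)"
  have der: "((\<lambda>x. g (f x)) has_derivative (\<lambda>v. ?g' (f x) (?f' x v))) (at x)" if "x \<in> S" for x
    by (rule has_derivative_compose[OF times_differentiable_has_derivative[OF Suc.prems(1) that]
        times_differentiable_has_derivative[OF Suc.prems(2)]]) (use that fS in auto)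
  have expand: "?g' (f x) (?f' x v) = (\<Sum>b\<in>Basis. (?f' x v \<bullet> b) *\<^sub>R ?g' (f x) b)" if "x \<in> S" for x v
    by (rule linear_eq_sum_Basis[OF has_derivative_linear[OF times_differentiable_has_derivative[OF Suc.prems(2)]]])
      (use that fS in auto)
  have "times_differentiable k S (\<lambda>x. \<Sum>b\<in>Basis. (?f' x v \<bullet> b) *\<^sub>R ?g' (f x) b)" for v
  proof (intro times_differentiable_sum[OF S] times_differentiable_scaleR[OF S])
    fix b :: 'b
    show "times_differentiable k S (\<lambda>x. ?f' x v \<bullet> b)"
      by (intro times_differentiable_inner[OF S] times_differentiable_frechet[OF Suc.prems(1)]
          times_differentiable_const[OF S])
    show "times_differentiable k S (\<lambda>x. ?g' (f x) b)"
      by (intro Suc.IH times_differentiable_SucD[OF Suc.prems(1)] times_differentiable_frechet[OF Suc.prems(2)])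
  qed
  then have "times_differentiable k S (\<lambda>x. ?g' (f x) (?f' x v))" for v
    by (rule times_differentiable_cong[OF S _, rotated]) (simp add: expand)
  then show ?case
    by (intro times_differentiable_SucI[OF S, where f' = "\<lambda>x v. ?g' (f x) (?f' x v)"]) (auto simp: der)
qed

lemma times_differentiable_Pair:
  assumes S: "open S" and "times_differentiable k S f" "times_differentiable k S g"
  shows "times_differentiable k S (\<lambda>x. (f x, g x))"
proof -
  have "times_differentiable k S (\<lambda>x. (f x, 0) + (0, g x))"
    by (rule times_differentiable_add[OF S
        times_differentiable_linear_compose[OF _ S assms(2), of "\<lambda>y. (y, 0)"]
        times_differentiable_linear_compose[OF _ S assms(3), of "\<lambda>y. (0, y)"]])
      (intro bounded_linear_Pair bounded_linear_ident bounded_linear_zero)+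
  then show ?thesis by simp
qed

text \<open>For functions of one real variable, smoothness is a statement about the ordinary derivative.\<close>

lemma times_differentiable_Suc_vector_derivative:
  assumes S: "open S" and "\<And>x. x \<in> S \<Longrightarrow> (f has_vector_derivative f' x) (at x)"
    and "times_differentiable k S f'"
  shows "times_differentiable (Suc k) S f"
  by (rule times_differentiable_SucI[OF S, where f' = "\<lambda>x v. v *\<^sub>R f' x"])
    (use assms in \<open>auto simp: has_vector_derivative_def intro: times_differentiable_scaleR[OF S]\<close>)

lemma times_differentiable_Suc_deriv:
  fixes f :: "real \<Rightarrow> real"
  assumes S: "open S" and "\<And>x. x \<in> S \<Longrightarrow> (f has_real_derivative f' x) (at x)"
    and "times_differentiable k S f'"
  shows "times_differentiable (Suc k) S f"
  using assms by (intro times_differentiable_Suc_vector_derivative[OF S, of f f'])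
    (auto simp: has_real_derivative_iff_has_vector_derivative)

lemma times_differentiable_sin_cos:
  "times_differentiable k UNIV (sin :: real \<Rightarrow> real) \<and> times_differentiable k UNIV (cos :: real \<Rightarrow> real)"
proof (induction k)
  case (Suc k)
  have "times_differentiable k UNIV (\<lambda>x. - 1 * sin x :: real)"
    by (intro times_differentiable_mult) (auto simp: Suc)
  then have "times_differentiable (Suc k) UNIV (cos :: real \<Rightarrow> real)"
    by (intro times_differentiable_Suc_deriv[where f' = "\<lambda>x. - 1 * sin x"])
      (auto intro!: derivative_eq_intros)
  moreover have "times_differentiable (Suc k) UNIV (sin :: real \<Rightarrow> real)"
    using Suc by (intro times_differentiable_Suc_deriv[where f' = cos]) (auto intro: DERIV_sin)
  ultimately show ?case by blast
qed (auto intro: continuous_intros)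

lemma times_differentiable_powr:
  "times_differentiable k {0<..} (\<lambda>x::real. x powr a)"
proof (induction k arbitrary: a)
  case (Suc k)
  show ?case
    by (rule times_differentiable_Suc_deriv[where f' = "\<lambda>x. a * x powr (a - 1)"])
      (auto intro!: derivative_eq_intros times_differentiable_mult Suc)
qed (auto intro!: continuous_intros)

lemma smooth_imp_times_differentiable: "smooth_on_open S f \<Longrightarrow> times_differentiable k S f"
  by (simp add: smooth_on_open_def)

lemma smooth_cong: "\<lbrakk>open S; \<And>x. x \<in> S \<Longrightarrow> f x = g x; smooth_on_open S f\<rbrakk> \<Longrightarrow> smooth_on_open S g"
  unfolding smooth_on_open_def using times_differentiable_cong by blast

lemma smooth_subset: "\<lbrakk>smooth_on_open S f; T \<subseteq> S\<rbrakk> \<Longrightarrow> smooth_on_open T f"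
  unfolding smooth_on_open_def using times_differentiable_subset by blast

lemma smooth_local:
  assumes "\<And>x. x \<in> S \<Longrightarrow> \<exists>U. open U \<and> x \<in> U \<and> smooth_on_open U f"
  shows "smooth_on_open S f"
  unfolding smooth_on_open_def using times_differentiable_local assms by (metis smooth_on_open_def)

lemma smooth_has_derivative:
  "smooth_on_open S f \<Longrightarrow> x \<in> S \<Longrightarrow> (f has_derivative frechet_derivative f (at x)) (at x)"
  unfolding smooth_on_open_def frechet_derivative_works[symmetric]
  by (metis times_differentiable.simps(2))

lemma smooth_frechet_derivative:
  "smooth_on_open S f \<Longrightarrow> smooth_on_open S (\<lambda>x. frechet_derivative f (at x) v)"
  unfolding smooth_on_open_def by (metis times_differentiable.simps(2))

lemma smooth_continuous_on: "smooth_on_open S f \<Longrightarrow> continuous_on S f"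
  unfolding smooth_on_open_def by (metis times_differentiable.simps(1))

lemma smooth_deriv:
  assumes "smooth_on_open S (f :: real \<Rightarrow> real)" "x \<in> S"
  shows "(f has_real_derivative deriv f x) (at x)"
proof -
  have "f differentiable (at x)"
    using smooth_has_derivative[OF assms] by (auto simp: differentiable_def)
  then show ?thesis
    by (simp add: DERIV_deriv_iff_real_differentiable)
qed

lemma smooth_on_deriv:
  assumes "open S" "smooth_on_open S (f :: real \<Rightarrow> real)"
  shows "smooth_on_open S (deriv f)"
proof (rule smooth_cong[OF assms(1) _ smooth_frechet_derivative[OF assms(2), of 1]])
  fix x assume "x \<in> S"
  then have "frechet_derivative f (at x) = (*) (deriv f x)"
    using smooth_deriv[OF assms(2)] by (intro frechet_derivative_eqI) (simp add: has_field_derivative_def)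
  then show "frechet_derivative f (at x) 1 = deriv f x" by simp
qed

named_theorems smooth_intros

lemma smooth_const [smooth_intros]: "open S \<Longrightarrow> smooth_on_open S (\<lambda>x. c)"
  by (simp add: smooth_on_open_def)

lemma smooth_id [smooth_intros]: "open S \<Longrightarrow> smooth_on_open S (\<lambda>x. x)"
  by (simp add: smooth_on_open_def times_differentiable_id)

lemma smooth_linear_compose:
  "bounded_linear L \<Longrightarrow> open S \<Longrightarrow> smooth_on_open S f \<Longrightarrow> smooth_on_open S (\<lambda>x. L (f x))"
  by (simp add: smooth_on_open_def times_differentiable_linear_compose)

lemmas smooth_fst [smooth_intros] = smooth_linear_compose[OF bounded_linear_fst]
lemmas smooth_snd [smooth_intros] = smooth_linear_compose[OF bounded_linear_snd]
lemmas smooth_minus [smooth_intros] = smooth_linear_compose[OF bounded_linear_minus[OF bounded_linear_ident]]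

lemma smooth_add [smooth_intros]:
  "open S \<Longrightarrow> smooth_on_open S f \<Longrightarrow> smooth_on_open S g \<Longrightarrow> smooth_on_open S (\<lambda>x. f x + g x)"
  by (simp add: smooth_on_open_def times_differentiable_add)

lemma smooth_diff [smooth_intros]:
  "open S \<Longrightarrow> smooth_on_open S f \<Longrightarrow> smooth_on_open S g \<Longrightarrow> smooth_on_open S (\<lambda>x. f x - g x)"
  using smooth_add[OF _ _ smooth_minus, of S f g] by simp

lemma smooth_sum [smooth_intros]:
  "open S \<Longrightarrow> (\<And>i. i \<in> I \<Longrightarrow> smooth_on_open S (f i)) \<Longrightarrow> smooth_on_open S (\<lambda>x. \<Sum>i\<in>I. f i x)"
  by (simp add: smooth_on_open_def times_differentiable_sum)

lemma smooth_mult [smooth_intros]: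
  fixes f g :: "_ \<Rightarrow> real"
  shows "open S \<Longrightarrow> smooth_on_open S f \<Longrightarrow> smooth_on_open S g \<Longrightarrow> smooth_on_open S (\<lambda>x. f x * g x)"
  by (simp add: smooth_on_open_def times_differentiable_mult)

lemma smooth_scaleR [smooth_intros]:
  "open S \<Longrightarrow> smooth_on_open S f \<Longrightarrow> smooth_on_open S g \<Longrightarrow> smooth_on_open S (\<lambda>x. f x *\<^sub>R g x)"
  by (simp add: smooth_on_open_def times_differentiable_scaleR)

lemma smooth_inner [smooth_intros]:
  "open S \<Longrightarrow> smooth_on_open S f \<Longrightarrow> smooth_on_open S g \<Longrightarrow> smooth_on_open S (\<lambda>x. f x \<bullet> g x)"
  by (simp add: smooth_on_open_def times_differentiable_inner)

lemma smooth_power [smooth_intros]: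
  fixes f :: "_ \<Rightarrow> real"
  shows "open S \<Longrightarrow> smooth_on_open S f \<Longrightarrow> smooth_on_open S (\<lambda>x. f x ^ k)"
  by (induction k) (auto intro: smooth_intros)

lemma smooth_Pair [smooth_intros]:
  "open S \<Longrightarrow> smooth_on_open S f \<Longrightarrow> smooth_on_open S g \<Longrightarrow> smooth_on_open S (\<lambda>x. (f x, g x))"
  by (simp add: smooth_on_open_def times_differentiable_Pair)

lemma smooth_compose:
  "\<lbrakk>open S; open T; f ` S \<subseteq> T; smooth_on_open S f; smooth_on_open T g\<rbrakk> \<Longrightarrow> smooth_on_open S (\<lambda>x. g (f x))"
  by (simp add: smooth_on_open_def times_differentiable_compose)

lemma smooth_sin [smooth_intros]:
  fixes f :: "_ \<Rightarrow> real"
  shows "open S \<Longrightarrow> smooth_on_open S f \<Longrightarrow> smooth_on_open S (\<lambda>x. sin (f x))"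
  by (rule smooth_compose[of S UNIV]) (auto simp: smooth_on_open_def times_differentiable_sin_cos)

lemma smooth_cos [smooth_intros]:
  fixes f :: "_ \<Rightarrow> real"
  shows "open S \<Longrightarrow> smooth_on_open S f \<Longrightarrow> smooth_on_open S (\<lambda>x. cos (f x))"
  by (rule smooth_compose[of S UNIV]) (auto simp: smooth_on_open_def times_differentiable_sin_cos)

lemma smooth_powr [smooth_intros]:
  fixes f :: "_ \<Rightarrow> real"
  shows "\<lbrakk>open S; smooth_on_open S f; \<And>x. x \<in> S \<Longrightarrow> f x > 0\<rbrakk> \<Longrightarrow> smooth_on_open S (\<lambda>x. f x powr a)"
  by (rule smooth_compose[of S "{0<..}"]) (auto simp: smooth_on_open_def times_differentiable_powr)

lemma smooth_sqrt [smooth_intros]: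
  fixes f :: "_ \<Rightarrow> real"
  assumes "open S" "smooth_on_open S f" "\<And>x. x \<in> S \<Longrightarrow> f x > 0"
  shows "smooth_on_open S (\<lambda>x. sqrt (f x))"
  by (rule smooth_cong[OF assms(1) _ smooth_powr[OF assms, of "1/2"]])
    (use assms(3) in \<open>auto simp: powr_half_sqrt less_imp_le\<close>)

lemma smooth_inverse [smooth_intros]:
  fixes f :: "_ \<Rightarrow> real"
  assumes "open S" "smooth_on_open S f" "\<And>x. x \<in> S \<Longrightarrow> f x > 0"
  shows "smooth_on_open S (\<lambda>x. inverse (f x))"
  by (rule smooth_cong[OF assms(1) _ smooth_powr[OF assms, of "-1"]])
    (use assms(3) in \<open>auto simp: powr_minus less_imp_le\<close>)

lemma smooth_divide [smooth_intros]:
  fixes f g :: "_ \<Rightarrow> real"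
  assumes "open S" "smooth_on_open S f" "smooth_on_open S g" "\<And>x. x \<in> S \<Longrightarrow> g x > 0"
  shows "smooth_on_open S (\<lambda>x. f x / g x)"
  unfolding divide_inverse by (intro smooth_intros assms) 

lemma smooth_norm [smooth_intros]:
  fixes f :: "_ \<Rightarrow> _::euclidean_space"
  assumes "open S" "smooth_on_open S f" "\<And>x. x \<in> S \<Longrightarrow> f x \<noteq> 0"
  shows "smooth_on_open S (\<lambda>x. norm (f x))"
  unfolding norm_eq_sqrt_inner by (intro smooth_intros assms) (simp add: assms(3))

lemma smooth_antiderivative:
  fixes f f' :: "real \<Rightarrow> real"
  assumes "open S" "\<And>x. x \<in> S \<Longrightarrow> (f has_real_derivative f' x) (at x)" "smooth_on_open S f'"
  shows "smooth_on_open S f"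
  unfolding smooth_on_open_def
  by (metis times_differentiable_Suc_deriv[OF assms(1,2)] assms(3) smooth_on_open_def
      times_differentiable_SucD)

section \<open>Ordinary differential equations on the line\<close>

lemma antiderivative_exists:
  fixes g :: "real \<Rightarrow> 'a::euclidean_space"
  assumes "continuous_on UNIV g"
  shows "\<exists>G. G 0 = 0 \<and> (\<forall>t. (G has_vector_derivative g t) (at t))"
proof (rule exI[of _ "\<lambda>t. LBINT s=ereal 0..ereal t. g s"], intro conjI allI)
  let ?G = "\<lambda>t. LBINT s=ereal 0..ereal t. g s"
  show "?G 0 = 0" by simp
  fix t
  have "(?G has_vector_derivative g t) (at t within {-\<bar>t\<bar>-1..\<bar>t\<bar>+1})"
    by (rule interval_integral_FTC2) (use continuous_on_subset assms in auto)
  then show "(?G has_vector_derivative g t) (at t)"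
    by (subst (asm) at_within_Icc_at) auto
qed

text \<open>Integration gains the factor \<open>1 / (2 L)\<close> in the norm weighted by \<open>exp (2 L \<bar>t\<bar>)\<close>, which turns the
  Lipschitz constant \<open>L\<close> into the contraction factor \<open>1 / 2\<close>.\<close>

lemma norm_antiderivative_le_exp:
  fixes G :: "real \<Rightarrow> 'a::real_normed_vector"
  assumes "L > 0" and G0: "G 0 = 0" and G: "\<And>t. (G has_vector_derivative g t) (at t)"
    and g: "\<And>t. norm (g t) \<le> K * exp (2 * L * \<bar>t\<bar>)" and "K \<ge> 0"
  shows "norm (G t) \<le> K / (2 * L) * exp (2 * L * \<bar>t\<bar>)"
proof -
  have main: "norm (G t) \<le> K / (2 * L) * exp (2 * L * t)"
    if "t > 0" and G0: "G 0 = 0" and G: "\<And>t. (G has_vector_derivative g t) (at t)"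
      and g: "\<And>t. norm (g t) \<le> K * exp (2 * L * \<bar>t\<bar>)" for t and G g :: "real \<Rightarrow> 'a"
  proof -
    let ?\<phi> = "\<lambda>s. K / (2 * L) * exp (2 * L * s)"
    have "norm (G t - G 0) \<le> ?\<phi> t - ?\<phi> 0"
    proof (rule differentiable_bound_general[OF \<open>t > 0\<close>, where f' = g and \<phi>' = "\<lambda>s. K * exp (2 * L * s)"])
      show "continuous_on {0..t} G"
        using G by (meson continuous_at_imp_continuous_on has_vector_derivative_continuous)
      show "(?\<phi> has_vector_derivative K * exp (2 * L * x)) (at x)" for x
        using \<open>L > 0\<close> unfolding has_real_derivative_iff_has_vector_derivative[symmetric]
        by (auto intro!: derivative_eq_intros)
      show "norm (g x) \<le> K * exp (2 * L * x)" if "0 < x" for x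
        using g[of x] that by simp
    qed (use G \<open>L > 0\<close> in \<open>auto intro!: continuous_intros\<close>)
    also have "\<dots> \<le> ?\<phi> t" using \<open>K \<ge> 0\<close> \<open>L > 0\<close> by simp
    finally show ?thesis using G0 by simp
  qed
  consider "t > 0" | "t = 0" | "t < 0" by linarith
  then show ?thesis
  proof cases
    case 1 then show ?thesis using main[OF _ G0 G g] by simp
  next
    case 2 then show ?thesis using G0 \<open>K \<ge> 0\<close> \<open>L > 0\<close> by simp
  next
    case 3
    have "((\<lambda>s. G (- s)) has_vector_derivative - g (- s)) (at s)" for s
      using vector_diff_chain_at[of uminus "-1" s G "g (- s)"] G[of "- s"]
        has_vector_derivative_minus[OF has_vector_derivative_id, of "at s"]
      by (simp add: o_def)
    moreover have "norm (- g (- s)) \<le> K * exp (2 * L * \<bar>s\<bar>)" for s using g[of "- s"] by simp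
    ultimately show ?thesis using main[of "- t" "\<lambda>s. G (- s)" "\<lambda>s. - g (- s)"] 3 G0 by simp
  qed
qed

text \<open>Picard iteration contracts the space of functions of growth at most \<open>exp (2 L \<bar>t\<bar>)\<close>, with
  the weighted supremum norm. The weight makes the contraction work on the whole line at once.\<close>

theorem picard_global:
  fixes f :: "real \<Rightarrow> 'a::euclidean_space \<Rightarrow> 'a"
  assumes cont: "continuous_on UNIV (\<lambda>(t, x). f t x)"
    and L: "L > 0" and lip: "\<And>t x y. norm (f t x - f t y) \<le> L * norm (x - y)"
    and C: "\<And>t. norm (f t 0) \<le> C"
  shows "\<exists>x. x 0 = x0 \<and> (\<forall>t. (x has_vector_derivative f t (x t)) (at t))"
proof -
  define e where "e t = exp (2 * L * \<bar>t\<bar>)" for t :: real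
  have e_pos: "e t > 0" and e_ge1: "e t \<ge> 1" for t using L by (auto simp: e_def)
  define h where "h v s = f s (e s *\<^sub>R v s)" for v :: "real \<Rightarrow> 'a" and s
  define G where "G v = (SOME G. G 0 = 0 \<and> (\<forall>t. (G has_vector_derivative h v t) (at t)))" for v
  have h_cont: "continuous_on UNIV (h v)" if "continuous_on UNIV v" for v
  proof -
    have "continuous_on UNIV (\<lambda>s. (s, e s *\<^sub>R v s))"
      unfolding e_def by (intro continuous_intros that)
    from continuous_on_compose2[OF cont this] show ?thesis by (simp add: h_def)
  qed
  have G: "G v 0 = 0" "(G v has_vector_derivative h v t) (at t)" if "continuous_on UNIV v" for v t
    using someI_ex[OF antiderivative_exists[OF h_cont[OF that]]] unfolding G_def by blast+
  define T where "T v = (\<lambda>t. (1 / e t) *\<^sub>R (x0 + G v t))" for v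
  have C0: "C \<ge> 0" using C[of 0] norm_ge_zero order_trans by blast
  have T_bcontfun: "T (apply_bcontfun v) \<in> bcontfun" for v :: "real \<Rightarrow>\<^sub>C 'a"
  proof (rule bcontfun_normI)
    let ?v = "apply_bcontfun v"
    have cv: "continuous_on UNIV ?v" by (simp add: continuous_on_apply_bcontfun)
    have "continuous_on UNIV (G ?v)"
      using G(2)[OF cv] by (meson continuous_at_imp_continuous_on has_vector_derivative_continuous)
    then show "continuous_on UNIV (T ?v)"
      unfolding T_def e_def by (intro continuous_intros) auto
    have hb: "norm (h ?v t) \<le> (C + L * norm v) * exp (2 * L * \<bar>t\<bar>)" for t
    proof -
      have "norm (h ?v t) \<le> norm (f t 0) + norm (f t (e t *\<^sub>R ?v t) - f t 0)"
        unfolding h_def by (metis add.commute diff_add_cancel norm_triangle_ineq)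
      also have "\<dots> \<le> C + L * (e t * norm (?v t))"
        using lip[of t "e t *\<^sub>R ?v t" 0] C[of t] e_pos[of t] by simp
      also have "\<dots> \<le> C * e t + L * (e t * norm v)"
        using e_ge1[of t] C0 L norm_bounded[of v t] e_pos[of t]
        by (intro add_mono mult_left_mono) (auto intro: mult_le_cancel_left1[THEN iffD2])
      finally show ?thesis by (simp add: e_def algebra_simps)
    qed
    show "norm (T ?v t) \<le> norm x0 + (C + L * norm v) / (2 * L)" for t
    proof -
      have "norm (G ?v t) \<le> (C + L * norm v) / (2 * L) * e t"
        unfolding e_def by (rule norm_antiderivative_le_exp[OF L G[OF cv] hb]) (use C0 L in auto)
      then have "norm (x0 + G ?v t) \<le> norm x0 * e t + (C + L * norm v) / (2 * L) * e t"
        using norm_triangle_ineq[of x0 "G ?v t"] mult_left_mono[OF e_ge1[of t], of "norm x0"] by simp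
      then have "norm (x0 + G ?v t) \<le> (norm x0 + (C + L * norm v) / (2 * L)) * e t"
        by (simp only: distrib_right)
      then show ?thesis using e_pos[of t] by (simp add: T_def pos_divide_le_eq)
    qed
  qed
  have "\<exists>!v. Bcontfun (T (apply_bcontfun v)) = v"
  proof (rule banach_fix_type[of "1/2"])
    show "\<forall>v w. dist (Bcontfun (T (apply_bcontfun v))) (Bcontfun (T (apply_bcontfun w))) \<le> 1/2 * dist v w"
    proof (intro allI dist_bound)
      fix v w :: "real \<Rightarrow>\<^sub>C 'a" and t
      let ?v = "apply_bcontfun v" and ?w = "apply_bcontfun w"
      have cv: "continuous_on UNIV ?v" "continuous_on UNIV ?w"
        by (simp_all add: continuous_on_apply_bcontfun)
      have "norm (G ?v t - G ?w t) \<le> (L * dist v w) / (2 * L) * exp (2 * L * \<bar>t\<bar>)"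
      proof (rule norm_antiderivative_le_exp[OF L])
        show "((\<lambda>t. G ?v t - G ?w t) has_vector_derivative h ?v t - h ?w t) (at t)" for t
          by (intro has_vector_derivative_diff G cv)
        show "norm (h ?v t - h ?w t) \<le> L * dist v w * exp (2 * L * \<bar>t\<bar>)" for t
        proof -
          have "norm (h ?v t - h ?w t) \<le> L * norm (e t *\<^sub>R ?v t - e t *\<^sub>R ?w t)"
            unfolding h_def by (rule lip)
          also have "\<dots> = L * (e t * dist (?v t) (?w t))"
            using e_pos[of t] by (simp add: dist_norm flip: scaleR_diff_right)
          also have "\<dots> \<le> L * (e t * dist v w)"
            using L e_pos[of t] dist_bounded by (intro mult_left_mono) (auto simp: less_imp_le)
          finally show ?thesis by (simp add: e_def algebra_simps)
        qed
      qed (use L G(1) cv in auto)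
      then have "norm (G ?v t - G ?w t) \<le> 1/2 * dist v w * e t" using L by (simp add: e_def)
      moreover have "dist (T ?v t) (T ?w t) = norm (G ?v t - G ?w t) / e t"
        using e_pos[of t] by (simp add: T_def dist_norm flip: scaleR_diff_right)
      ultimately show "dist (Bcontfun (T ?v) t) (Bcontfun (T ?w) t) \<le> 1/2 * dist v w"
        using e_pos[of t] by (simp add: Bcontfun_inverse[OF T_bcontfun] pos_divide_le_eq)
    qed
  qed auto
  then obtain v where "Bcontfun (T (apply_bcontfun v)) = v" by blast
  then have v: "apply_bcontfun v t = (1 / e t) *\<^sub>R (x0 + G (apply_bcontfun v) t)" for t
    by (metis Bcontfun_inverse T_bcontfun T_def)
  have cv: "continuous_on UNIV (apply_bcontfun v)" by (simp add: continuous_on_apply_bcontfun)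
  have eq: "e t *\<^sub>R apply_bcontfun v t = x0 + G (apply_bcontfun v) t" for t
    using v[of t] e_pos[of t] by simp
  show ?thesis
  proof (intro exI[of _ "\<lambda>t. x0 + G (apply_bcontfun v) t"] conjI allI)
    show "((\<lambda>t. x0 + G (apply_bcontfun v) t) has_vector_derivative f t (x0 + G (apply_bcontfun v) t)) (at t)" for t
      using G(2)[OF cv, of t] by (auto simp: h_def eq intro!: derivative_eq_intros)
  qed (use G(1)[OF cv] in simp)
qed

lemma gronwall:
  fixes E :: "real \<Rightarrow> real"
  assumes "T \<ge> 0" "b \<ge> 0" "K \<ge> 0"
    and E: "\<And>t. \<lbrakk>0 \<le> t; t \<le> T\<rbrakk> \<Longrightarrow> (E has_real_derivative E' t) (at t)"
    and le: "\<And>t. \<lbrakk>0 \<le> t; t \<le> T\<rbrakk> \<Longrightarrow> E' t \<le> K * E t + b"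
  shows "E T \<le> (E 0 + b * T) * exp (K * T)"
proof -
  let ?G = "\<lambda>t. E t * exp (- K * t) - b * t"
  have "?G T \<le> ?G 0"
  proof (rule DERIV_nonpos_imp_nonincreasing[OF \<open>T \<ge> 0\<close>])
    fix t assume t: "0 \<le> t" "t \<le> T"
    have "(?G has_real_derivative (E' t - K * E t) * exp (- K * t) - b) (at t)"
      using E[OF t] by (auto intro!: derivative_eq_intros simp: algebra_simps)
    moreover have "(E' t - K * E t) * exp (- K * t) \<le> b * 1"
      using le[OF t] \<open>b \<ge> 0\<close> \<open>K \<ge> 0\<close> t by (intro order_trans[OF mult_right_mono mult_left_mono]) auto
    ultimately show "\<exists>y. (?G has_real_derivative y) (at t) \<and> y \<le> 0" by fastforce
  qed
  then have "E T * exp (- K * T) \<le> E 0 + b * T" by simp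
  then have "E T * exp (- K * T) * exp (K * T) \<le> (E 0 + b * T) * exp (K * T)"
    by (intro mult_right_mono) auto
  then show ?thesis by (simp add: mult.assoc flip: exp_add)
qed

text \<open>One estimate yields growth bounds (compare with the zero solution), uniqueness (equal fields), and
  continuity in the spectral parameter (fields that differ slightly along \<open>y\<close>).\<close>

lemma ode_perturbation:
  fixes x y :: "real \<Rightarrow> 'a::euclidean_space"
  assumes "T \<ge> 0" "L \<ge> 0"
    and x: "\<And>t. (x has_vector_derivative f t (x t)) (at t)"
    and y: "\<And>t. (y has_vector_derivative g t) (at t)"
    and lip: "\<And>t u v. norm (f t u - f t v) \<le> L * norm (u - v)"
    and \<delta>: "\<And>t. \<lbrakk>0 \<le> t; t \<le> T\<rbrakk> \<Longrightarrow> norm (f t (y t) - g t) \<le> \<delta>"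
  shows "(norm (x T - y T))\<^sup>2 \<le> ((norm (x 0 - y 0))\<^sup>2 + \<delta>\<^sup>2 * T) * exp ((2 * L + 1) * T)"
proof -
  let ?E = "\<lambda>t. (x t - y t) \<bullet> (x t - y t)"
  have "?E T \<le> (?E 0 + \<delta>\<^sup>2 * T) * exp ((2 * L + 1) * T)"
  proof (rule gronwall)
    fix t assume t: "0 \<le> t" "t \<le> T"
    let ?d = "x t - y t"
    show "(?E has_real_derivative 2 * (?d \<bullet> (f t (x t) - g t))) (at t)"
      using x[of t] y[of t] unfolding has_vector_derivative_def has_field_derivative_def
      by (auto intro!: derivative_eq_intros simp: inner_commute algebra_simps)
    have "?d \<bullet> (f t (x t) - g t) \<le> norm ?d * norm (f t (x t) - g t)" by (rule norm_cauchy_schwarz)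
    also have "norm (f t (x t) - g t) \<le> norm (f t (x t) - f t (y t)) + norm (f t (y t) - g t)"
      using norm_triangle_ineq[of "f t (x t) - f t (y t)" "f t (y t) - g t"] by simp
    also have "\<dots> \<le> L * norm ?d + \<delta>" using lip[of t "x t" "y t"] \<delta>[OF t] by simp
    finally have "2 * (?d \<bullet> (f t (x t) - g t)) \<le> 2 * (norm ?d * (L * norm ?d + \<delta>))"
      by (simp add: mult_left_mono)
    also have "\<dots> \<le> (2 * L + 1) * (norm ?d)\<^sup>2 + \<delta>\<^sup>2"
      using sum_squares_bound[of "norm ?d" \<delta>] by (simp add: algebra_simps power2_eq_square)
    finally show "2 * (?d \<bullet> (f t (x t) - g t)) \<le> (2 * L + 1) * ?E t + \<delta>\<^sup>2"
      by (simp add: power2_norm_eq_inner)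
  qed (use assms in auto)
  then show ?thesis by (simp add: power2_norm_eq_inner)
qed

lemma ode_unique:
  fixes x y :: "real \<Rightarrow> 'a::euclidean_space"
  assumes "L \<ge> 0" and x: "\<And>t. (x has_vector_derivative f t (x t)) (at t)"
    and y: "\<And>t. (y has_vector_derivative f t (y t)) (at t)"
    and lip: "\<And>t u v. norm (f t u - f t v) \<le> L * norm (u - v)"
    and "x 0 = y 0"
  shows "x t = y t"
proof -
  have main: "x t = y t" if "t \<ge> 0" and x: "\<And>t. (x has_vector_derivative f t (x t)) (at t)"
    and y: "\<And>t. (y has_vector_derivative f t (y t)) (at t)"
    and lip: "\<And>t u v. norm (f t u - f t v) \<le> L * norm (u - v)" and "x 0 = y 0"
    for t f and x y :: "real \<Rightarrow> 'a"
    using ode_perturbation[OF \<open>t \<ge> 0\<close> \<open>L \<ge> 0\<close> x y lip, of 0] \<open>x 0 = y 0\<close> by simp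
  show ?thesis
  proof (cases "t \<ge> 0")
    case True then show ?thesis by (rule main[OF _ x y lip \<open>x 0 = y 0\<close>])
  next
    case False
    have rev: "((\<lambda>s. z (- s)) has_vector_derivative - f (- s) (z (- s))) (at s)"
      if "\<And>t. (z has_vector_derivative f t (z t)) (at t)" for z s
      using vector_diff_chain_at[of uminus "-1" s z "f (- s) (z (- s))"] that[of "- s"]
        has_vector_derivative_minus[OF has_vector_derivative_id, of "at s"]
      by (simp add: o_def)
    have "x (- (- t)) = y (- (- t))"
    proof (rule main[where f = "\<lambda>s u. - f (- s) u" and x = "\<lambda>s. x (- s)" and y = "\<lambda>s. y (- s)"])
      show "norm (- f (- t) u - - f (- t) v) \<le> L * norm (u - v)" for t u v
        using lip[of "- t" v u] by (simp add: norm_minus_commute)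
    qed (use False \<open>x 0 = y 0\<close> rev[OF x] rev[OF y] in auto)
    then show ?thesis by simp
  qed
qed

section \<open>Periodic Sturm-Liouville problems\<close>

text \<open>A set of reals that is unbounded above and has finitely many elements below each bound is listed in
  increasing order by repeatedly passing to the next element.\<close>

lemma ex_strict_mono_listing:
  fixes S :: "real set"
  assumes unb: "\<And>M. \<exists>x\<in>S. M \<le> x" and fin: "\<And>M. finite {x \<in> S. x \<le> M}"
  shows "\<exists>a. strict_mono_on {1..} a \<and> a ` {1::nat..} = S"
proof -
  have ex_next: "\<exists>y. y \<in> S \<and> x < y \<and> (\<forall>z\<in>S. x < z \<longrightarrow> y \<le> z)" for x
  proof -
    obtain u where u: "u \<in> S" "x + 1 \<le> u" using unb by blast
    let ?A = "{z \<in> S. z \<le> u \<and> x < z}"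
    have A: "finite ?A" "u \<in> ?A" using finite_subset[OF _ fin[of u], of ?A] u by auto
    then have "Min ?A \<in> ?A" using Min_in[of ?A] by blast
    moreover have "Min ?A \<le> z" if "z \<in> S" "x < z" for z
    proof (cases "z \<le> u")
      case True then show ?thesis using that by (intro Min_le[OF A(1)]) simp
    next
      case False then show ?thesis using Min_le[OF A] by linarith
    qed
    ultimately show ?thesis by blast
  qed
  obtain s where s: "\<And>x. s x \<in> S" "\<And>x. x < s x" "\<And>x z. z \<in> S \<Longrightarrow> x < z \<Longrightarrow> s x \<le> z"
    using ex_next by metis
  obtain u where u: "u \<in> S" using unb by blast
  let ?A = "{z \<in> S. z \<le> u}"
  define m where "m = Min ?A"
  have "?A \<noteq> {}" using u by blast
  then have m: "m \<in> S" "\<And>z. z \<in> S \<Longrightarrow> m \<le> z"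
    using Min_in[OF fin[of u]] Min_le[OF fin[of u]] u unfolding m_def by auto (meson linear order_trans)
  define b where "b k = (s ^^ k) m" for k
  have b_Suc: "b (Suc k) = s (b k)" for k by (simp add: b_def)
  have b_S: "b k \<in> S" for k by (cases k) (auto simp: b_Suc s, simp add: b_def m)
  have mono: "strict_mono b" by (rule strict_monoI_Suc) (simp add: b_Suc s)
  have "z \<in> range b" if z: "z \<in> S" for z
  proof (rule ccontr)
    assume nz: "z \<notin> range b"
    have "b k < z" for k
    proof (induction k)
      case 0 then show ?case using m(2)[OF z] nz by (metis b_def funpow_0 order_le_less rangeI)
    next
      case (Suc k) then show ?case using s(3)[OF z Suc] nz by (metis b_Suc order_le_less rangeI)
    qed
    then have "range b \<subseteq> {x \<in> S. x \<le> z}" using b_S by (auto intro: less_imp_le)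
    then show False
      using fin finite_subset finite_imageD[of b UNIV] strict_mono_imp_inj_on[OF mono] by blast
  qed
  then have rb: "range b = S" using b_S by blast
  show ?thesis
  proof (intro exI conjI)
    show "strict_mono_on {1..} (\<lambda>k. b (k - 1))"
      by (intro strict_mono_onI strict_monoD[OF mono]) auto
    have "(\<lambda>k. k - 1) ` {1::nat..} = UNIV"
      by (auto intro!: image_eqI[of x _ "Suc x" for x])
    then show "(\<lambda>k. b (k - 1)) ` {1..} = S" by (metis image_image rb)
  qed
qed

lemma sin_nonzero_between:
  fixes x :: real
  assumes "of_int j * pi < x" "x < (of_int j + 1) * pi"
  shows "sin x \<noteq> 0"
proof
  assume "sin x = 0"
  then obtain i :: int where "x = of_int i * pi" using sin_zero_iff_int2 by blast
  then have "of_int j * pi < of_int i * pi" "of_int i * pi < of_int (j + 1) * pi" using assms by simp_all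
  then have "j < i" "i < j + 1"
    by (simp_all only: mult_less_cancel_right_pos[OF pi_gt_zero] of_int_less_iff)
  then show False by simp
qed

text \<open>While the angle stays strictly between two consecutive multiples of \<open>\<pi>\<close>, minus the cotangent
  of the angle satisfies a Riccati inequality, whose solutions live for a time less than
  \<open>\<pi> / sqrt (A B)\<close>.\<close>

lemma pruefer_angle_advances:
  fixes \<theta> :: "real \<Rightarrow> real"
  assumes \<theta>: "\<And>t. (\<theta> has_real_derivative u t * (cos (\<theta> t))\<^sup>2 + v t * (sin (\<theta> t))\<^sup>2) (at t)"
    and AB: "A > 0" "B > 0" "\<And>t. u t \<ge> A" "\<And>t. v t \<ge> B"
    and h: "h * sqrt (A * B) > pi" and start: "\<theta> t0 \<ge> of_int j * pi"
  shows "\<theta> (t0 + h) \<ge> (of_int j + 1) * pi"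
proof (rule ccontr)
  assume "\<not> ?thesis"
  then have fin: "\<theta> (t0 + h) < (of_int j + 1) * pi" by simp
  have lower: "u t * (cos x)\<^sup>2 + v t * (sin x)\<^sup>2 \<ge> A * (cos x)\<^sup>2 + B * (sin x)\<^sup>2" for t x
    using AB by (intro add_mono mult_right_mono) auto
  have pos: "A * (cos x)\<^sup>2 + B * (sin x)\<^sup>2 > 0" for x
  proof (cases "sin x = 0")
    case True then show ?thesis using AB sin_cos_squared_add[of x] by (simp add: add.commute)
  next
    case False then show ?thesis using AB by (intro add_nonneg_pos) auto
  qed
  have incr: "\<theta> a < \<theta> b" if "a < b" for a b
    using that by (rule DERIV_pos_imp_increasing) (metis \<theta> lower pos order_less_le_trans)
  have sqrt_pos: "sqrt (A * B) > 0" using AB by simp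
  have "h > 0" using h sqrt_pos by (metis mult_le_0_iff not_less order_le_less pi_gt_zero order_less_trans)
  \<comment> \<open>the cotangent is singular at the start, so the comparison begins after the time \<open>\<epsilon>\<close> that is to spare\<close>
  define \<epsilon> where "\<epsilon> = h - pi / sqrt (A * B)"
  have \<epsilon>: "\<epsilon> > 0" "(h - \<epsilon>) * sqrt (A * B) = pi" "\<epsilon> < h"
    using h sqrt_pos by (auto simp: \<epsilon>_def field_simps)
  \<comment> \<open>the scaling that turns the Riccati inequality into a lower bound for the derivative of an arctangent\<close>
  define k where "k = sqrt (A / B)"
  have k: "k > 0" "k\<^sup>2 = A / B" "k * B = sqrt (A * B)"
    using AB by (auto simp: k_def real_sqrt_divide real_sqrt_mult real_div_sqrt field_simps)
  define \<psi> where "\<psi> t = arctan (k * (- cot (\<theta> t)))" for t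
  have nz: "sin (\<theta> t) \<noteq> 0" if "t0 + \<epsilon> \<le> t" "t \<le> t0 + h" for t
  proof (rule sin_nonzero_between[of j])
    show "of_int j * pi < \<theta> t" using start incr[of t0 t] that \<epsilon> by linarith
    show "\<theta> t < (of_int j + 1) * pi" using fin incr[of t "t0 + h"] that by (cases "t = t0 + h") auto
  qed
  have "\<psi> (t0 + \<epsilon>) - sqrt (A * B) * (t0 + \<epsilon>) \<le> \<psi> (t0 + h) - sqrt (A * B) * (t0 + h)"
  proof (rule DERIV_nonneg_imp_nondecreasing[where f = "\<lambda>t. \<psi> t - sqrt (A * B) * t"])
    fix t assume t: "t0 + \<epsilon> \<le> t" "t \<le> t0 + h"
    let ?s = "sin (\<theta> t)" and ?c = "cos (\<theta> t)"
    define \<theta>' where "\<theta>' = u t * ?c\<^sup>2 + v t * ?s\<^sup>2"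
    have s: "?s \<noteq> 0" using nz t by blast
    have d: "((\<lambda>t. \<psi> t - sqrt (A * B) * t) has_real_derivative
        k * (\<theta>' / ?s\<^sup>2) / (1 + (k * cot (\<theta> t))\<^sup>2) - sqrt (A * B)) (at t)"
      unfolding \<psi>_def \<theta>'_def using s
      by (auto intro!: derivative_eq_intros \<theta> DERIV_chain2[OF DERIV_cot, where g = \<theta>] simp: field_simps)
    have "sqrt (A * B) * (1 + (k * cot (\<theta> t))\<^sup>2) = k * ((A * ?c\<^sup>2 + B * ?s\<^sup>2) / ?s\<^sup>2)"
      using s AB k(2) by (simp add: k(3)[symmetric] cot_def power_mult_distrib field_simps)
    also have "\<dots> \<le> k * (\<theta>' / ?s\<^sup>2)"
      using lower k(1) unfolding \<theta>'_def by (intro mult_left_mono divide_right_mono) auto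
    finally have "sqrt (A * B) \<le> k * (\<theta>' / ?s\<^sup>2) / (1 + (k * cot (\<theta> t))\<^sup>2)"
      by (subst pos_le_divide_eq) (auto intro: add_pos_nonneg)
    with d show "\<exists>y. ((\<lambda>t. \<psi> t - sqrt (A * B) * t) has_real_derivative y) (at t) \<and> 0 \<le> y"
      by fastforce
  qed (use \<epsilon> in simp)
  then have "\<psi> (t0 + h) - \<psi> (t0 + \<epsilon>) \<ge> (h - \<epsilon>) * sqrt (A * B)" by (simp add: algebra_simps)
  moreover have "\<psi> (t0 + h) < pi / 2" "\<psi> (t0 + \<epsilon>) > - (pi / 2)"
    unfolding \<psi>_def using arctan_ubound arctan_lbound by auto
  ultimately show False using \<epsilon>(2) by simp
qed

lemma periodic_int_mult:
  fixes f :: "real \<Rightarrow> 'a"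
  assumes "\<And>t. f (t + P) = f t"
  shows "f (t + of_int k * P) = f t"
proof -
  have nat: "f (t + real k * P) = f t" for t k
  proof (induction k)
    case (Suc k)
    have "f (t + real (Suc k) * P) = f ((t + real k * P) + P)" by (simp add: algebra_simps)
    then show ?case using assms Suc by simp
  qed simp
  show ?thesis
  proof (cases "k \<ge> 0")
    case True then show ?thesis using nat[of t "nat k"] by simp
  next
    case False then show ?thesis using nat[of "t + of_int k * P" "nat (- k)"] by simp
  qed
qed

lemma periodic_representative:
  fixes f :: "real \<Rightarrow> 'a"
  assumes "P > 0" "\<And>t. f (t + P) = f t"
  shows "\<exists>s. 0 \<le> s \<and> s \<le> P \<and> f s = f t"
proof (intro exI conjI)
  let ?s = "t + of_int (- \<lfloor>t / P\<rfloor>) * P"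
  show "f ?s = f t" by (rule periodic_int_mult) (rule assms)
  have "of_int \<lfloor>t / P\<rfloor> * P \<le> t / P * P" "t / P * P \<le> (of_int \<lfloor>t / P\<rfloor> + 1) * P"
    using \<open>P > 0\<close> by (intro mult_right_mono; linarith)+
  then show "0 \<le> ?s" "?s \<le> P" using \<open>P > 0\<close> by (auto simp: algebra_simps)
qed

lemma periodic_continuous_bounds:
  fixes f :: "real \<Rightarrow> real"
  assumes "P > 0" "\<And>t. f (t + P) = f t" "continuous_on UNIV f"
  shows "\<exists>a b. \<forall>t. f a \<le> f t \<and> f t \<le> f b"
proof -
  have c: "continuous_on {0..P} f" using assms(3) continuous_on_subset by blast
  obtain a where a: "\<forall>s\<in>{0..P}. f a \<le> f s" using continuous_attains_inf[of "{0..P}" f] c \<open>P > 0\<close> by auto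
  obtain b where b: "\<forall>s\<in>{0..P}. f s \<le> f b" using continuous_attains_sup[of "{0..P}" f] c \<open>P > 0\<close> by auto
  show ?thesis
  proof (intro exI allI)
    fix t obtain s where "0 \<le> s" "s \<le> P" "f s = f t"
      using periodic_representative[of P f, OF assms(1,2)] by blast
    then show "f a \<le> f t \<and> f t \<le> f b" using a b by (metis atLeastAtMost_iff)
  qed
qed

locale periodic_sturm_liouville =
  fixes p Q :: "real \<Rightarrow> real" and P :: real
  assumes P: "P > 0" and p_cont: "continuous_on UNIV p" and Q_cont: "continuous_on UNIV Q"
    and p_pos: "\<And>t. p t > 0" and p_per: "\<And>t. p (t + P) = p t" and Q_per: "\<And>t. Q (t + P) = Q t"
begin

text \<open>The equation \<open>(p y')' + p (Q + \<mu>) y = 0\<close> as a first-order system for \<open>(y, p y')\<close>.\<close>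

definition first_order_system :: "real \<Rightarrow> real \<Rightarrow> real \<times> real \<Rightarrow> real \<times> real" where
  "first_order_system \<mu> t = (\<lambda>(y, w). (w / p t, - (p t * (Q t + \<mu>) * y)))"

definition solves :: "real \<Rightarrow> (real \<Rightarrow> real \<times> real) \<Rightarrow> bool" where
  "solves \<mu> x \<longleftrightarrow> (\<forall>t. (x has_vector_derivative first_order_system \<mu> t (x t)) (at t))"

definition eigenvalues :: "real set" where
  "eigenvalues = {\<mu>. \<exists>x. solves \<mu> x \<and> (\<forall>t. x (t + P) = x t) \<and> (\<exists>t. x t \<noteq> 0)}"

lemma bounds:
  "\<exists>C. C > 0 \<and> (\<forall>t. p t \<le> C \<and> \<bar>Q t\<bar> \<le> C \<and> 1 / p t \<le> C)"
proof -
  obtain a b where ab: "\<forall>t. p a \<le> p t \<and> p t \<le> p b"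
    using periodic_continuous_bounds[OF P p_per p_cont] by blast
  obtain c d where cd: "\<forall>t. Q c \<le> Q t \<and> Q t \<le> Q d"
    using periodic_continuous_bounds[OF P Q_per Q_cont] by blast
  let ?C = "p b + \<bar>Q c\<bar> + \<bar>Q d\<bar> + 1 / p a"
  have ia: "1 / p a > 0" and ib: "1 / p b > 0" using p_pos by auto
  have "p t \<le> ?C \<and> \<bar>Q t\<bar> \<le> ?C \<and> 1 / p t \<le> ?C" for t
  proof -
    have "1 / p b \<le> 1 / p t" "1 / p t \<le> 1 / p a"
      using ab p_pos by (intro divide_left_mono mult_pos_pos; simp)+
    moreover have "p a \<le> p t" "p t \<le> p b" "Q c \<le> Q t" "Q t \<le> Q d" using ab cd by auto
    ultimately show ?thesis using ia p_pos[of b] by (intro conjI) linarith+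
  qed
  moreover have "?C > 0" using ia p_pos[of b] abs_ge_zero[of "Q c"] abs_ge_zero[of "Q d"] by linarith
  ultimately show ?thesis by blast
qed

text \<open>One constant bounds all coefficients, both from above and, through \<open>1 / p\<close>, away from zero.\<close>

definition coeff_bound :: real where
  "coeff_bound = (SOME C. C > 0 \<and> (\<forall>t. p t \<le> C \<and> \<bar>Q t\<bar> \<le> C \<and> 1 / p t \<le> C))"

lemma coeff_bound: "coeff_bound > 0" "1 / coeff_bound > 0" "p t \<le> coeff_bound" "\<bar>Q t\<bar> \<le> coeff_bound" "1 / p t \<le> coeff_bound" "1 / coeff_bound \<le> p t" "1 / coeff_bound \<le> 1 / p t"
proof -
  have coeff_bound: "coeff_bound > 0 \<and> (\<forall>t. p t \<le> coeff_bound \<and> \<bar>Q t\<bar> \<le> coeff_bound \<and> 1 / p t \<le> coeff_bound)"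
    unfolding coeff_bound_def by (rule someI_ex[OF bounds])
  then show "coeff_bound > 0" "1 / coeff_bound > 0" "p t \<le> coeff_bound" "\<bar>Q t\<bar> \<le> coeff_bound" "1 / p t \<le> coeff_bound" by auto
  have "1 / p t \<le> coeff_bound" "p t \<le> coeff_bound" using coeff_bound by auto
  moreover have "coeff_bound > 0" using coeff_bound by blast
  ultimately show "1 / coeff_bound \<le> p t" "1 / coeff_bound \<le> 1 / p t"
    using p_pos[of t] by (simp_all add: field_simps)
qed

text \<open>The constant is uniform for spectral parameters up to \<open>M\<close> in absolute value, so that solutions for
  different parameters can be compared.\<close>

definition lipschitz_const :: "real \<Rightarrow> real" where
  "lipschitz_const M = (SOME L. L > 0 \<and> (\<forall>\<mu> t u v. \<bar>\<mu>\<bar> \<le> M \<longrightarrow> norm (first_order_system \<mu> t u - first_order_system \<mu> t v) \<le> L * norm (u - v)))"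

lemma abs_fst_snd_le_norm: "\<bar>fst z\<bar> \<le> norm z" "\<bar>snd z\<bar> \<le> norm z" for z :: "real \<times> real"
  by (metis norm_fst_le real_norm_def prod.collapse) (metis norm_snd_le real_norm_def prod.collapse)

lemma lipschitz_const: "lipschitz_const M > 0" "\<bar>\<mu>\<bar> \<le> M \<Longrightarrow> norm (first_order_system \<mu> t u - first_order_system \<mu> t v) \<le> lipschitz_const M * norm (u - v)"
proof -
  define A where "A = 1 / coeff_bound"
  define C where "C = coeff_bound"
  have AC: "A > 0" "C > 0" "\<And>t. p t \<le> C" "\<And>t. \<bar>Q t\<bar> \<le> C" "\<And>t. 1 / p t \<le> C"
    unfolding A_def C_def by (rule coeff_bound)+
  have "norm (first_order_system \<mu> t u - first_order_system \<mu> t v) \<le> (C + C * (C + \<bar>M\<bar>)) * norm (u - v)" if "\<bar>\<mu>\<bar> \<le> M" for \<mu> t u v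
  proof -
    let ?d = "u - v"
    have eq: "first_order_system \<mu> t u - first_order_system \<mu> t v = (1 / p t * snd ?d, - (p t * (Q t + \<mu>) * fst ?d))"
      by (cases u; cases v) (simp add: first_order_system_def algebra_simps diff_divide_distrib)
    have "norm (first_order_system \<mu> t u - first_order_system \<mu> t v) \<le> \<bar>1 / p t * snd ?d\<bar> + \<bar>p t * (Q t + \<mu>) * fst ?d\<bar>"
      unfolding eq by (rule order_trans[OF norm_Pair_le]) simp
    also have "\<bar>1 / p t * snd ?d\<bar> \<le> C * norm ?d"
      using AC(2) AC(5)[of t] p_pos[of t] abs_fst_snd_le_norm(2)[of ?d] unfolding abs_mult
      by (intro mult_mono) (auto simp: less_imp_le)
    also have "\<bar>p t * (Q t + \<mu>) * fst ?d\<bar> \<le> (C * (C + \<bar>M\<bar>)) * norm ?d"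
      using AC(3,4)[of t] AC(2) p_pos[of t] abs_fst_snd_le_norm(1)[of ?d] that unfolding abs_mult
      by (intro mult_mono) auto
    finally show ?thesis by (simp add: algebra_simps)
  qed
  moreover have "C + C * (C + \<bar>M\<bar>) > 0" using AC by (auto intro: add_pos_nonneg)
  ultimately have "\<exists>L. L > 0 \<and> (\<forall>\<mu> t u v. \<bar>\<mu>\<bar> \<le> M \<longrightarrow> norm (first_order_system \<mu> t u - first_order_system \<mu> t v) \<le> L * norm (u - v))" by blast
  from someI_ex[OF this] show "lipschitz_const M > 0" "\<bar>\<mu>\<bar> \<le> M \<Longrightarrow> norm (first_order_system \<mu> t u - first_order_system \<mu> t v) \<le> lipschitz_const M * norm (u - v)"
    unfolding lipschitz_const_def by blast+
qed

lemma solves_exists: "\<exists>x. solves \<mu> x \<and> x 0 = v"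
proof -
  have cont: "continuous_on UNIV (\<lambda>(t, x). first_order_system \<mu> t x)"
    unfolding first_order_system_def case_prod_beta
    by (intro continuous_intros continuous_on_compose2[OF p_cont] continuous_on_compose2[OF Q_cont])
      (use p_pos less_imp_neq in \<open>auto simp: less_imp_neq[symmetric]\<close>)
  have "norm (first_order_system \<mu> t 0) \<le> 0" for t by (simp add: first_order_system_def zero_prod_def)
  from picard_global[OF cont lipschitz_const(1) lipschitz_const(2)[OF order_refl] this] show ?thesis unfolding solves_def by blast
qed

lemma solves_unique:
  assumes "solves \<mu> x" "solves \<mu> y" "x 0 = y 0"
  shows "x t = y t"
  using ode_unique[of "lipschitz_const \<bar>\<mu>\<bar>" x "first_order_system \<mu>" y, OF less_imp_le[OF lipschitz_const(1)] _ _ lipschitz_const(2)[OF order_refl]] assms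
  unfolding solves_def by blast

lemma first_order_system_zero: "first_order_system \<mu> t 0 = 0"
  by (simp add: first_order_system_def zero_prod_def)

lemma solves_zero: "solves \<mu> (\<lambda>t. 0)"
  by (simp add: solves_def first_order_system_zero)

lemma solves_nonzero: "solves \<mu> x \<Longrightarrow> x s \<noteq> 0 \<Longrightarrow> x 0 \<noteq> 0"
  using solves_unique[OF _ solves_zero] by blast

lemma solves_combine:
  assumes "solves \<mu> x" "solves \<mu> y"
  shows "solves \<mu> (\<lambda>t. a *\<^sub>R x t + b *\<^sub>R y t)"
proof -
  have "first_order_system \<mu> t (a *\<^sub>R u + b *\<^sub>R v) = a *\<^sub>R first_order_system \<mu> t u + b *\<^sub>R first_order_system \<mu> t v" for t u v
    by (cases u; cases v) (simp add: first_order_system_def algebra_simps add_divide_distrib)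
  then show ?thesis using assms unfolding solves_def
    by (auto intro!: derivative_eq_intros)
qed

lemma solves_shift: "solves \<mu> x \<Longrightarrow> solves \<mu> (\<lambda>t. x (t + P))"
proof -
  assume x: "solves \<mu> x"
  have "first_order_system \<mu> (t + P) = first_order_system \<mu> t" for t by (simp add: first_order_system_def p_per Q_per)
  moreover have "((\<lambda>t. x (t + P)) has_vector_derivative first_order_system \<mu> (t + P) (x (t + P))) (at t)" for t
    using vector_diff_chain_at[of "\<lambda>t. t + P" 1 t x "first_order_system \<mu> (t + P) (x (t + P))"] x
      has_vector_derivative_add[OF has_vector_derivative_id[of "at t"] has_vector_derivative_const[of P "at t"]]
    unfolding solves_def by (simp add: o_def)
  ultimately show ?thesis by (simp add: solves_def)
qed

lemma solves_derivs:
  assumes "solves \<mu> x"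
  shows "((\<lambda>t. fst (x t)) has_real_derivative snd (x t) / p t) (at t)"
    and "((\<lambda>t. snd (x t)) has_real_derivative - (p t * (Q t + \<mu>) * fst (x t))) (at t)"
proof -
  have x: "(x has_vector_derivative first_order_system \<mu> t (x t)) (at t)" using assms by (simp add: solves_def)
  show "((\<lambda>t. fst (x t)) has_real_derivative snd (x t) / p t) (at t)"
    "((\<lambda>t. snd (x t)) has_real_derivative - (p t * (Q t + \<mu>) * fst (x t))) (at t)"
    using bounded_linear.has_vector_derivative[OF bounded_linear_fst x]
      bounded_linear.has_vector_derivative[OF bounded_linear_snd x]
    by (simp_all add: has_real_derivative_iff_has_vector_derivative first_order_system_def case_prod_beta)
qed

lemma solves_norm_le:
  assumes "solves \<mu> x" "\<bar>\<mu>\<bar> \<le> M" "T \<ge> 0"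
  shows "(norm (x T))\<^sup>2 \<le> (norm (x 0))\<^sup>2 * exp ((2 * lipschitz_const M + 1) * T)"
proof -
  have "(norm (x T - 0))\<^sup>2 \<le> ((norm (x 0 - 0))\<^sup>2 + 0\<^sup>2 * T) * exp ((2 * lipschitz_const M + 1) * T)"
    by (rule ode_perturbation[where f = "first_order_system \<mu>" and g = "\<lambda>t. 0" and y = "\<lambda>t. 0"])
      (use assms(1,2) lipschitz_const first_order_system_zero in \<open>auto simp: solves_def less_imp_le assms(3)\<close>)
  then show ?thesis by simp
qed

lemma solves_perturb:
  assumes x: "solves \<mu> x" and y: "solves \<nu> y" and M: "\<bar>\<mu>\<bar> \<le> M" "\<bar>\<nu>\<bar> \<le> M" and T: "0 \<le> T" "T \<le> P"
    and C: "\<And>t. p t \<le> C"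
  shows "(norm (x T - y T))\<^sup>2 \<le> ((norm (x 0 - y 0))\<^sup>2
      + (\<mu> - \<nu>)\<^sup>2 * (C\<^sup>2 * (norm (y 0))\<^sup>2 * exp ((2 * lipschitz_const M + 1) * P)) * P) * exp ((2 * lipschitz_const M + 1) * P)"
proof -
  let ?e = "exp ((2 * lipschitz_const M + 1) * P)"
  let ?\<delta> = "\<bar>\<mu> - \<nu>\<bar> * (C * (norm (y 0) * sqrt ?e))"
  have C0: "C \<ge> 0" using C[of 0] p_pos[of 0] by linarith
  have mono_e: "exp ((2 * lipschitz_const M + 1) * t) \<le> ?e" if "0 \<le> t" "t \<le> P" for t
    using that lipschitz_const(1)[of M] by (simp add: mult_left_mono)
  have "(norm (x T - y T))\<^sup>2 \<le> ((norm (x 0 - y 0))\<^sup>2 + ?\<delta>\<^sup>2 * T) * exp ((2 * lipschitz_const M + 1) * T)"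
  proof (rule ode_perturbation[where f = "first_order_system \<mu>" and g = "\<lambda>t. first_order_system \<nu> t (y t)"])
    fix t assume t: "0 \<le> t" "t \<le> T"
    have "norm (y t) \<le> norm (y 0) * sqrt ?e"
    proof (rule power2_le_imp_le)
      have "(norm (y t))\<^sup>2 \<le> (norm (y 0))\<^sup>2 * exp ((2 * lipschitz_const M + 1) * t)"
        using solves_norm_le[OF y M(2)] t by simp
      also have "\<dots> \<le> (norm (y 0))\<^sup>2 * ?e" using mono_e t T by (intro mult_left_mono) auto
      finally show "(norm (y t))\<^sup>2 \<le> (norm (y 0) * sqrt ?e)\<^sup>2" by (simp add: power_mult_distrib)
    qed simp
    then have y1: "\<bar>fst (y t)\<bar> \<le> norm (y 0) * sqrt ?e" using abs_fst_snd_le_norm(1)[of "y t"] by linarith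
    have "first_order_system \<mu> t (y t) - first_order_system \<nu> t (y t) = (0, - ((\<mu> - \<nu>) * (p t * fst (y t))))"
      by (cases "y t") (simp add: first_order_system_def algebra_simps)
    then have "norm (first_order_system \<mu> t (y t) - first_order_system \<nu> t (y t)) = \<bar>\<mu> - \<nu>\<bar> * (p t * \<bar>fst (y t)\<bar>)"
      using p_pos[of t] by (simp add: norm_Pair abs_mult)
    also have "\<dots> \<le> ?\<delta>"
      using y1 C[of t] p_pos[of t] C0 by (intro mult_left_mono mult_mono) auto
    finally show "norm (first_order_system \<mu> t (y t) - first_order_system \<nu> t (y t)) \<le> ?\<delta>" .
  qed (use assms lipschitz_const in \<open>auto simp: solves_def less_imp_le\<close>)
  also have "\<dots> \<le> ((norm (x 0 - y 0))\<^sup>2 + ?\<delta>\<^sup>2 * P) * ?e"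
    using mono_e T P by (intro mult_mono add_mono mult_left_mono add_nonneg_nonneg) auto
  also have "?\<delta>\<^sup>2 = (\<mu> - \<nu>)\<^sup>2 * (C\<^sup>2 * (norm (y 0))\<^sup>2 * ?e)"
    by (simp add: power_mult_distrib algebra_simps)
  finally show ?thesis .
qed

definition sol :: "real \<Rightarrow> real \<times> real \<Rightarrow> real \<Rightarrow> real \<times> real" where
  "sol \<mu> v = (SOME x. solves \<mu> x \<and> x 0 = v)"

lemma sol: "solves \<mu> (sol \<mu> v)" "sol \<mu> v 0 = v"
  using someI_ex[OF solves_exists] unfolding sol_def by blast+

lemma sol_eqI: "solves \<mu> x \<Longrightarrow> x t = sol \<mu> (x 0) t"
  using solves_unique sol by metis

lemma sol_tendsto_uniform:
  assumes \<mu>: "m \<longlonglongrightarrow> \<mu>" and v: "w \<longlonglongrightarrow> v"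
  shows "uniform_limit {0..P} (\<lambda>i. sol (m i) (w i)) (sol \<mu> v) sequentially"
proof -
  define C where "C = coeff_bound"
  have C: "\<And>t. p t \<le> C"
    unfolding C_def by (rule coeff_bound)+
  obtain M0 where M0: "\<And>i. \<bar>m i\<bar> \<le> M0" 
    using convergent_imp_Bseq[OF convergentI[OF \<mu>]] unfolding Bseq_def by auto
  define M where "M = max M0 \<bar>\<mu>\<bar>"
  define e where "e = exp ((2 * lipschitz_const M + 1) * P)"
  define g where "g i = ((norm (w i - v))\<^sup>2 + (m i - \<mu>)\<^sup>2 * (C\<^sup>2 * (norm v)\<^sup>2 * e) * P) * e" for i
  have "(\<lambda>i. m i - \<mu>) \<longlonglongrightarrow> 0" "(\<lambda>i. norm (w i - v)) \<longlonglongrightarrow> 0"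
    using \<mu> v by (auto simp: LIM_zero intro: tendsto_norm_zero)
  then have "g \<longlonglongrightarrow> (0\<^sup>2 + 0\<^sup>2 * (C\<^sup>2 * (norm v)\<^sup>2 * e) * P) * e"
    unfolding g_def by (intro tendsto_intros)
  then have "(\<lambda>i. sqrt (g i)) \<longlonglongrightarrow> 0"
    using tendsto_real_sqrt[of g 0 sequentially] by simp
  moreover have "norm (sol (m i) (w i) t - sol \<mu> v t) \<le> sqrt (g i)" if "t \<in> {0..P}" for i t
    using solves_perturb[OF sol(1) sol(1), of "m i" M \<mu> t C "w i" v] that M0[of i] C
    by (intro real_le_rsqrt) (auto simp: g_def e_def M_def sol(2))
  ultimately show ?thesis
    unfolding uniform_limit_iff dist_norm
    by (smt (verit) eventually_mono order_tendstoD(2))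
qed

lemma continuous_on_sol_end: "continuous_on UNIV (\<lambda>\<mu>. sol \<mu> v P)"
  unfolding continuous_on_sequentially o_def
  using tendsto_uniform_limitI[OF sol_tendsto_uniform[OF _ tendsto_const]] P by auto

end

context periodic_sturm_liouville begin

lemma solves_zero_everywhere:
  assumes x: "solves \<mu> x" and s: "x s = 0"
  shows "x t = 0"
proof -
  obtain L where L: "L \<ge> 0" "\<And>t u v. norm (first_order_system \<mu> t u - first_order_system \<mu> t v) \<le> L * norm (u - v)"
    using lipschitz_const[of "\<bar>\<mu>\<bar>"] lipschitz_const(2)[OF order_refl] by (meson less_imp_le)
  have shift: "((\<lambda>t. x (t + s)) has_vector_derivative first_order_system \<mu> (t + s) (x (t + s))) (at t)" for t
    using vector_diff_chain_at[of "\<lambda>t. t + s" 1 t x "first_order_system \<mu> (t + s) (x (t + s))"] x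
      has_vector_derivative_add[OF has_vector_derivative_id[of "at t"] has_vector_derivative_const[of s "at t"]]
    unfolding solves_def by (simp add: o_def)
  have "x ((t - s) + s) = 0"
    by (rule ode_unique[where f = "\<lambda>t. first_order_system \<mu> (t + s)" and x = "\<lambda>t. x (t + s)" and y = "\<lambda>t. 0", OF L(1) shift _ L(2)])
      (auto simp: first_order_system_zero s)
  then show ?thesis by simp
qed

section \<open>Discriminant and Pruefer angle\<close>

lemma wronskian_deriv:
  assumes "solves \<mu> x" "solves \<nu> y"
  shows "((\<lambda>t. fst (x t) * snd (y t) - fst (y t) * snd (x t)) has_real_derivative
          (\<mu> - \<nu>) * (p t * (fst (x t) * fst (y t)))) (at t)"
proof -
  have "((\<lambda>t. fst (x t) * snd (y t) - fst (y t) * snd (x t)) has_real_derivative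
      (snd (x t) / p t * snd (y t) + - (p t * (Q t + \<nu>) * fst (y t)) * fst (x t))
       - (snd (y t) / p t * snd (x t) + - (p t * (Q t + \<mu>) * fst (x t)) * fst (y t))) (at t)"
    by (rule DERIV_diff[OF DERIV_mult[OF solves_derivs(1)[OF assms(1)] solves_derivs(2)[OF assms(2)]]
        DERIV_mult[OF solves_derivs(1)[OF assms(2)] solves_derivs(2)[OF assms(1)]]])
  then show ?thesis by (rule back_subst[of "\<lambda>d. (_ has_real_derivative d) (at t)"]) (simp add: algebra_simps)
qed

lemma wronskian_fundamental:
  "fst (sol \<mu> (1, 0) t) * snd (sol \<mu> (0, 1) t) - fst (sol \<mu> (0, 1) t) * snd (sol \<mu> (1, 0) t) = 1"
proof -
  let ?W = "\<lambda>t. fst (sol \<mu> (1, 0) t) * snd (sol \<mu> (0, 1) t) - fst (sol \<mu> (0, 1) t) * snd (sol \<mu> (1, 0) t)"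
  have "?W t = ?W 0"
    by (rule DERIV_isconst_all) (use wronskian_deriv[OF sol(1) sol(1), of \<mu> _ \<mu>] in simp)
  then show ?thesis by (simp add: sol(2))
qed

text \<open>The trace of the monodromy matrix, whose determinant is \<open>1\<close>.\<close>

definition discriminant :: "real \<Rightarrow> real" where
  "discriminant \<mu> = fst (sol \<mu> (1, 0) P) + snd (sol \<mu> (0, 1) P)"

lemma discriminant_continuous: "continuous_on UNIV discriminant"
  unfolding discriminant_def by (intro continuous_intros continuous_on_sol_end)

lemma sol_linear: "sol \<mu> (a, b) t = a *\<^sub>R sol \<mu> (1, 0) t + b *\<^sub>R sol \<mu> (0, 1) t"
proof -
  have "solves \<mu> (\<lambda>t. a *\<^sub>R sol \<mu> (1, 0) t + b *\<^sub>R sol \<mu> (0, 1) t)"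
    by (intro solves_combine sol(1))
  from sol_eqI[OF this, of t] show ?thesis by (simp add: sol(2))
qed

lemma periodic_if_end_eq:
  assumes "sol \<mu> v P = v"
  shows "sol \<mu> v (t + P) = sol \<mu> v t"
  using solves_unique[OF solves_shift[OF sol(1)] sol(1), of \<mu> v v t] assms by (simp add: sol(2))

text \<open>A matrix of determinant \<open>1\<close> and trace \<open>2\<close> has the eigenvalue \<open>1\<close>. A solution whose initial data form an
  eigenvector is periodic.\<close>

lemma eigenvalue_if_discriminant:
  assumes "discriminant \<mu> = 2"
  shows "\<mu> \<in> eigenvalues"
proof -
  define a b c d where "a = fst (sol \<mu> (1, 0) P)" "b = fst (sol \<mu> (0, 1) P)"
    "c = snd (sol \<mu> (1, 0) P)" "d = snd (sol \<mu> (0, 1) P)"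
  note abcd = this
  have det: "a * d - b * c = 1" using wronskian_fundamental[of \<mu> P] by (simp add: abcd)
  have tr: "a + d = 2" using assms by (simp add: discriminant_def abcd)
  have sol_P: "sol \<mu> (u, v) P = (u * a + v * b, u * c + v * d)" for u v
    by (subst sol_linear) (simp add: abcd prod_eq_iff)
  have "\<exists>v. v \<noteq> 0 \<and> sol \<mu> v P = v"
  proof (cases "b = 0 \<and> a = 1")
    case True
    then have "sol \<mu> (0, 1) P = (0, 1)" using tr by (simp add: sol_P)
    then show ?thesis by (intro exI[of _ "(0, 1)"]) (simp add: zero_prod_def)
  next
    case False
    have d: "d = 2 - a" using tr by simp
    have "b * c + (1 - a) * d = 1 - a" using det unfolding d by (simp add: algebra_simps)
    then have "sol \<mu> (b, 1 - a) P = (b, 1 - a)" by (simp add: sol_P algebra_simps)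
    \<comment> \<open>the first row of the monodromy matrix minus the identity annihilates \<open>(b, 1 - a)\<close>; the second does so because the determinant vanishes\<close>
    then show ?thesis using False by (intro exI[of _ "(b, 1 - a)"]) (auto simp: zero_prod_def)
  qed
  then obtain v where "v \<noteq> 0" "sol \<mu> v P = v" by blast
  then show ?thesis unfolding eigenvalues_def
    using periodic_if_end_eq[of \<mu> v] sol[of \<mu> v] by (auto intro!: exI[of _ "sol \<mu> v"] exI[of _ 0])
qed

text \<open>Writing \<open>(y, p y') = \<rho> (sin x, cos x)\<close> decouples the angle \<open>x\<close> from the radius \<open>\<rho>\<close>: this is the field
  that drives the angle.\<close>

definition angle_rhs :: "real \<Rightarrow> real \<Rightarrow> real \<Rightarrow> real" where
  "angle_rhs \<mu> t x = 1 / p t * (cos x)\<^sup>2 + p t * (Q t + \<mu>) * (sin x)\<^sup>2"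

lemma angle_rhs_lipschitz:
  "\<exists>L. L > 0 \<and> (\<forall>\<mu> t u v. \<bar>\<mu>\<bar> \<le> M \<longrightarrow> norm (angle_rhs \<mu> t u - angle_rhs \<mu> t v) \<le> L * norm (u - v))"
proof -
  define C where "C = coeff_bound"
  have C: "C > 0" "\<And>t. p t \<le> C" "\<And>t. \<bar>Q t\<bar> \<le> C" "\<And>t. 1 / p t \<le> C"
    unfolding C_def by (rule coeff_bound)+
  let ?L = "2 * (C * (C + \<bar>M\<bar>) + C)"
  have "norm (angle_rhs \<mu> t u - angle_rhs \<mu> t v) \<le> ?L * norm (u - v)" if "\<bar>\<mu>\<bar> \<le> M" for \<mu> t u v
  proof (rule field_differentiable_bound[where S = UNIV])
    show "(angle_rhs \<mu> t has_real_derivative 2 * (p t * (Q t + \<mu>) - 1 / p t) * (sin z * cos z)) (at z within UNIV)" for z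
      unfolding angle_rhs_def
      using p_pos[of t] by (auto intro!: derivative_eq_intros simp: field_simps)
    show "norm (2 * (p t * (Q t + \<mu>) - 1 / p t) * (sin z * cos z)) \<le> ?L" for z
    proof -
      have "\<bar>p t * (Q t + \<mu>) - 1 / p t\<bar> \<le> \<bar>p t * (Q t + \<mu>)\<bar> + \<bar>1 / p t\<bar>" by (rule abs_triangle_ineq4)
      also have "\<dots> \<le> C * (C + \<bar>M\<bar>) + C"
        using C(2-4)[of t] that p_pos[of t] C(1) unfolding abs_mult
        by (intro add_mono mult_mono) auto
      finally have 1: "\<bar>p t * (Q t + \<mu>) - 1 / p t\<bar> \<le> C * (C + \<bar>M\<bar>) + C" .
      have 2: "\<bar>sin z * cos z\<bar> \<le> 1" by (simp add: abs_mult mult_le_one)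
      have "norm (2 * (p t * (Q t + \<mu>) - 1 / p t) * (sin z * cos z))
        = 2 * \<bar>p t * (Q t + \<mu>) - 1 / p t\<bar> * \<bar>sin z * cos z\<bar>"
        unfolding real_norm_def abs_mult[of _ "sin z * cos z"] abs_mult[of 2] by simp
      also have "\<dots> \<le> ?L * 1" using 1 2 C(1) by (intro mult_mono) auto
      finally show ?thesis by simp
    qed
  qed auto
  moreover have "?L > 0" using C(1) by (auto intro: add_nonneg_pos)
  ultimately show ?thesis by blast
qed

definition is_angle :: "real \<Rightarrow> (real \<Rightarrow> real) \<Rightarrow> bool" where
  "is_angle \<mu> \<theta> \<longleftrightarrow> \<theta> 0 = 0 \<and> (\<forall>t. (\<theta> has_vector_derivative angle_rhs \<mu> t (\<theta> t)) (at t))"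

definition angle :: "real \<Rightarrow> real \<Rightarrow> real" where
  "angle \<mu> = (SOME \<theta>. is_angle \<mu> \<theta>)"

lemma is_angle: "is_angle \<mu> (angle \<mu>)"
proof -
  obtain L where L: "L > 0" "\<And>t u v. norm (angle_rhs \<mu> t u - angle_rhs \<mu> t v) \<le> L * norm (u - v)"
    using angle_rhs_lipschitz[of "\<bar>\<mu>\<bar>"] by blast
  define C where "C = coeff_bound"
  have C: "\<And>t. 1 / p t \<le> C"
    unfolding C_def by (rule coeff_bound)+
  have "continuous_on UNIV (\<lambda>(t, x). angle_rhs \<mu> t x)"
    unfolding angle_rhs_def case_prod_beta
    by (intro continuous_intros continuous_on_compose2[OF p_cont] continuous_on_compose2[OF Q_cont])
      (use p_pos in \<open>auto simp: order_less_imp_not_eq2\<close>)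
  moreover have "norm (angle_rhs \<mu> t 0) \<le> C" for t using C[of t] p_pos[of t] by (simp add: angle_rhs_def)
  ultimately have "\<exists>\<theta>. is_angle \<mu> \<theta>"
    using picard_global[of "angle_rhs \<mu>" L C 0] L unfolding is_angle_def by blast
  then show ?thesis unfolding angle_def by (rule someI_ex)
qed

lemma angle_0: "angle \<mu> 0 = 0"
  and angle_deriv: "(angle \<mu> has_real_derivative angle_rhs \<mu> t (angle \<mu> t)) (at t)"
  using is_angle unfolding is_angle_def has_real_derivative_iff_has_vector_derivative by blast+

lemma angle_end_continuous: "continuous_on UNIV (\<lambda>\<mu>. angle \<mu> P)"
  unfolding continuous_on_sequentially o_def
proof (intro ballI allI impI, elim conjE)
  fix \<mu> and m :: "nat \<Rightarrow> real" assume \<mu>: "m \<longlonglongrightarrow> \<mu>"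
  define C where "C = coeff_bound"
  have C: "\<And>t. p t \<le> C"
    unfolding C_def by (rule coeff_bound)+
  obtain M0 where M0: "\<And>i. \<bar>m i\<bar> \<le> M0" 
    using convergent_imp_Bseq[OF convergentI[OF \<mu>]] unfolding Bseq_def by auto
  obtain L where L: "L > 0" "\<And>\<mu> t u v. \<bar>\<mu>\<bar> \<le> M0 \<Longrightarrow> norm (angle_rhs \<mu> t u - angle_rhs \<mu> t v) \<le> L * norm (u - v)"
    using angle_rhs_lipschitz[of M0] by blast
  define g where "g i = (\<bar>m i - \<mu>\<bar> * C)\<^sup>2 * P * exp ((2 * L + 1) * P)" for i
  have le: "norm (angle (m i) P - angle \<mu> P) \<le> sqrt (g i)" for i
  proof (rule real_le_rsqrt)
    have "(norm (angle (m i) P - angle \<mu> P))\<^sup>2 \<le>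
        ((norm (angle (m i) 0 - angle \<mu> 0))\<^sup>2 + (\<bar>m i - \<mu>\<bar> * C)\<^sup>2 * P) * exp ((2 * L + 1) * P)"
    proof (rule ode_perturbation[where f = "angle_rhs (m i)" and g = "\<lambda>t. angle_rhs \<mu> t (angle \<mu> t)"])
      fix t
      have "angle_rhs (m i) t (angle \<mu> t) - angle_rhs \<mu> t (angle \<mu> t) = (m i - \<mu>) * (p t * (sin (angle \<mu> t))\<^sup>2)"
        by (simp add: angle_rhs_def algebra_simps)
      also have "norm \<dots> \<le> \<bar>m i - \<mu>\<bar> * (C * 1)"
        using C[of t] p_pos[of t] unfolding abs_mult real_norm_def
        by (intro mult_left_mono mult_mono) (auto simp: abs_square_le_1)
      finally show "norm (angle_rhs (m i) t (angle \<mu> t) - angle_rhs \<mu> t (angle \<mu> t)) \<le> \<bar>m i - \<mu>\<bar> * C" by simp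
    qed (use P L M0 is_angle in \<open>auto simp: is_angle_def less_imp_le\<close>)
    then show "(norm (angle (m i) P - angle \<mu> P))\<^sup>2 \<le> g i" by (simp add: angle_0 g_def)
  qed
  have "(\<lambda>i. \<bar>m i - \<mu>\<bar>) \<longlonglongrightarrow> 0" using \<mu> by (simp add: LIM_zero tendsto_rabs_zero)
  then have "g \<longlonglongrightarrow> (0 * C)\<^sup>2 * P * exp ((2 * L + 1) * P)"
    unfolding g_def by (intro tendsto_intros)
  then have "(\<lambda>i. sqrt (g i)) \<longlonglongrightarrow> 0" using tendsto_real_sqrt[of g 0 sequentially] by simp
  then have "(\<lambda>i. angle (m i) P - angle \<mu> P) \<longlonglongrightarrow> 0"
    by (rule Lim_null_comparison[OF always_eventually[OF allI[OF le]]])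
  then show "(\<lambda>i. angle (m i) P) \<longlonglongrightarrow> angle \<mu> P" by (rule LIM_zero_cancel)
qed

text \<open>The component of \<open>(y, p y')\<close> orthogonal to the direction given by the angle satisfies a homogeneous
  linear equation with zero initial value.\<close>

lemma angle_is_polar_angle:
  "fst (sol \<mu> (0, 1) t) * cos (angle \<mu> t) = snd (sol \<mu> (0, 1) t) * sin (angle \<mu> t)"
proof -
  let ?y = "\<lambda>t. fst (sol \<mu> (0, 1) t)" and ?w = "\<lambda>t. snd (sol \<mu> (0, 1) t)" and ?\<theta> = "angle \<mu>"
  define C where "C = coeff_bound"
  have C: "C > 0" "\<And>t. p t \<le> C" "\<And>t. \<bar>Q t\<bar> \<le> C" "\<And>t. 1 / p t \<le> C"
    unfolding C_def by (rule coeff_bound)+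
  define a where "a t = (p t * (Q t + \<mu>) - 1 / p t) * (sin (?\<theta> t) * cos (?\<theta> t))" for t
  have a_le: "\<bar>a t\<bar> \<le> C * (C + \<bar>\<mu>\<bar>) + C" for t
  proof -
    have "\<bar>p t * (Q t + \<mu>) - 1 / p t\<bar> \<le> \<bar>p t * (Q t + \<mu>)\<bar> + \<bar>1 / p t\<bar>" by (rule abs_triangle_ineq4)
    also have "\<dots> \<le> C * (C + \<bar>\<mu>\<bar>) + C"
      using C(2-4)[of t] p_pos[of t] C(1) unfolding abs_mult by (intro add_mono mult_mono) auto
    finally have 1: "\<bar>p t * (Q t + \<mu>) - 1 / p t\<bar> \<le> C * (C + \<bar>\<mu>\<bar>) + C" .
    have "\<bar>a t\<bar> \<le> (C * (C + \<bar>\<mu>\<bar>) + C) * 1"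
      unfolding a_def abs_mult[of "p t * (Q t + \<mu>) - 1 / p t"]
      using 1 C(1) by (intro mult_mono) (auto simp: abs_mult mult_le_one)
    then show ?thesis by simp
  qed
  define Z where "Z t = ?y t * cos (?\<theta> t) - ?w t * sin (?\<theta> t)" for t
  have Z_deriv: "(Z has_real_derivative a t * Z t) (at t)" for t
  proof -
    define \<theta>' where "\<theta>' = angle_rhs \<mu> t (?\<theta> t)"
    have d: "(?y has_real_derivative ?w t / p t) (at t)" "(?w has_real_derivative - (p t * (Q t + \<mu>) * ?y t)) (at t)"
      "(?\<theta> has_real_derivative \<theta>') (at t)"
      using solves_derivs[OF sol(1)] angle_deriv unfolding \<theta>'_def by blast+
    have "(Z has_real_derivative ?w t / p t * cos (?\<theta> t) + ?y t * (- sin (?\<theta> t) * \<theta>')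
        - (- (p t * (Q t + \<mu>) * ?y t) * sin (?\<theta> t) + ?w t * (cos (?\<theta> t) * \<theta>'))) (at t)"
      unfolding Z_def by (auto intro!: derivative_eq_intros d)
    moreover have "?w t / p t * cos (?\<theta> t) + ?y t * (- sin (?\<theta> t) * \<theta>')
        - (- (p t * (Q t + \<mu>) * ?y t) * sin (?\<theta> t) + ?w t * (cos (?\<theta> t) * \<theta>')) = a t * Z t"
    proof -
      define u v where "u = 1 / p t" and "v = p t * (Q t + \<mu>)"
      define s c where "s = sin (?\<theta> t)" and "c = cos (?\<theta> t)"
      have sc: "s * s + c * c = 1" unfolding s_def c_def using sin_cos_squared_add[of "?\<theta> t"] by (simp add: power2_eq_square)
      have "?w t * u * c + ?y t * (- s * (u * c * c + v * s * s)) - (- (v * ?y t) * s + ?w t * (c * (u * c * c + v * s * s)))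
          - (v - u) * (s * c) * (?y t * c - ?w t * s)
        = (1 - (s * s + c * c)) * (?w t * u * c + v * ?y t * s)" by (simp add: algebra_simps)
      then show ?thesis unfolding sc
        by (simp add: a_def Z_def \<theta>'_def angle_rhs_def power2_eq_square flip: s_def c_def v_def)
          (simp add: u_def algebra_simps)
    qed
    ultimately show ?thesis by simp
  qed
  have "Z t = 0"
  proof (rule ode_unique[where f = "\<lambda>t u. a t * u" and x = Z and y = "\<lambda>t. 0" and L = "C * (C + \<bar>\<mu>\<bar>) + C"])
    show "norm (a t * u - a t * v) \<le> (C * (C + \<bar>\<mu>\<bar>) + C) * norm (u - v)" for t u v
      using a_le[of t] by (simp add: abs_mult mult_right_mono flip: right_diff_distrib)
    show "(Z has_vector_derivative a t * Z t) (at t)" for t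
      using Z_deriv by (simp add: has_real_derivative_iff_has_vector_derivative)
  qed (use C(1) in \<open>auto simp: Z_def sol(2) angle_0\<close>)
  then show ?thesis by (simp add: Z_def)
qed

lemma polar_radius_pos: "fst (sol \<mu> (0, 1) t) * sin (angle \<mu> t) + snd (sol \<mu> (0, 1) t) * cos (angle \<mu> t) > 0"
proof -
  let ?y = "\<lambda>t. fst (sol \<mu> (0, 1) t)" and ?w = "\<lambda>t. snd (sol \<mu> (0, 1) t)" and ?\<theta> = "angle \<mu>"
  define \<rho> where "\<rho> t = ?y t * sin (?\<theta> t) + ?w t * cos (?\<theta> t)" for t
  have nz: "\<rho> t \<noteq> 0" for t
  proof
    assume "\<rho> t = 0"
    have "(\<rho> t)\<^sup>2 + (?y t * cos (?\<theta> t) - ?w t * sin (?\<theta> t))\<^sup>2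
        = ((?y t)\<^sup>2 + (?w t)\<^sup>2) * ((sin (?\<theta> t))\<^sup>2 + (cos (?\<theta> t))\<^sup>2)"
      unfolding \<rho>_def by algebra
    then have "(?y t)\<^sup>2 + (?w t)\<^sup>2 = 0" using \<open>\<rho> t = 0\<close> angle_is_polar_angle[of \<mu> t] by simp
    then have "sol \<mu> (0, 1) t = 0" by (simp add: prod_eq_iff sum_power2_eq_zero_iff)
    then show False using wronskian_fundamental[of \<mu> t] by simp
  qed
  have cont: "continuous_on UNIV \<rho>"
    unfolding \<rho>_def
    by (intro continuous_intros DERIV_continuous_on[of UNIV _ "\<lambda>t. _ t"]
        continuous_at_imp_continuous_on ballI DERIV_isCont[OF solves_derivs(1)[OF sol(1)]]
        DERIV_isCont[OF solves_derivs(2)[OF sol(1)]] DERIV_isCont[OF angle_deriv])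
  have "\<rho> 0 = 1" by (simp add: \<rho>_def sol(2) angle_0)
  have "connected (\<rho> ` UNIV)" by (rule connected_continuous_image[OF cont]) simp
  have "\<rho> t > 0"
  proof (rule ccontr)
    assume "\<not> \<rho> t > 0"
    then have "0 \<in> range \<rho>"
      using connectedD_interval[OF \<open>connected (range \<rho>)\<close>, of "\<rho> t" "\<rho> 0" 0] \<open>\<rho> 0 = 1\<close> by simp
    then show False using nz by (metis imageE)
  qed
  then show ?thesis by (simp add: \<rho>_def)
qed

text \<open>When the angle is a multiple of \<open>\<pi>\<close>, the monodromy matrix is triangular with diagonal entries \<open>w\<close> and
  \<open>1 / w\<close>, and the parity of the multiple decides the sign of \<open>w\<close>.\<close>

lemma discriminant_at_dirichlet:
  assumes "angle \<mu> P = real k * pi"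
  shows "even k \<Longrightarrow> discriminant \<mu> \<ge> 2" and "odd k \<Longrightarrow> discriminant \<mu> \<le> - 2"
proof -
  let ?y = "fst (sol \<mu> (0, 1) P)" and ?w = "snd (sol \<mu> (0, 1) P)" and ?a = "fst (sol \<mu> (1, 0) P)"
  have s: "sin (angle \<mu> P) = 0" and c: "cos (angle \<mu> P) = (-1) ^ k" unfolding assms by simp_all
  have y: "?y = 0" using angle_is_polar_angle[of \<mu> P] by (simp add: s c)
  have w: "?w * (-1) ^ k > 0" using polar_radius_pos[of \<mu> P] by (simp add: s c)
  have aw: "?a * ?w = 1" using wronskian_fundamental[of \<mu> P] y by simp
  have D: "discriminant \<mu> * ?w = 1 + ?w\<^sup>2" by (simp add: discriminant_def distrib_right aw power2_eq_square)
  have sq: "(?w - 1)\<^sup>2 \<ge> 0" "(?w + 1)\<^sup>2 \<ge> 0" by simp_all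
  show "discriminant \<mu> \<ge> 2" if "even k"
  proof -
    have "?w > 0" using w that by simp
    moreover have "2 * ?w \<le> discriminant \<mu> * ?w" using D sq(1) by (simp add: power2_eq_square algebra_simps)
    ultimately show ?thesis by simp
  qed
  show "discriminant \<mu> \<le> - 2" if "odd k"
  proof -
    have "?w < 0" using w that by simp
    moreover have "(- 2) * ?w \<le> discriminant \<mu> * ?w" using D sq(2) by (simp add: power2_eq_square algebra_simps)
    ultimately show ?thesis by (metis mult_le_cancel_right not_less_iff_gr_or_eq order_less_imp_not_less)
  qed
qed

text \<open>The period is cut into \<open>k\<close> equal pieces; for large \<open>\<mu>\<close> the angle gains at least \<open>\<pi>\<close> on each of them.\<close>

lemma angle_end_unbounded: "\<exists>\<mu>\<ge>M. angle \<mu> P \<ge> real k * pi"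
proof (cases "k = 0")
  case True
  define A where "A = 1 / coeff_bound"
  define C where "C = coeff_bound"
  have AC: "A > 0" "C > 0" "\<And>t. A \<le> p t" "\<And>t. \<bar>Q t\<bar> \<le> C"
    unfolding A_def C_def by (rule coeff_bound)+
  have "angle (max M C) P \<ge> 0"
  proof -
    have "angle (max M C) 0 \<le> angle (max M C) P"
    proof (rule DERIV_nonneg_imp_nondecreasing[where f = "angle (max M C)"])
      fix t
      have "p t * (Q t + max M C) \<ge> 0" using AC(4)[of t] p_pos[of t]
        by (intro mult_nonneg_nonneg[OF less_imp_le]) (simp, smt (verit) max.cobounded2)
      then have "angle_rhs (max M C) t (angle (max M C) t) \<ge> 0"
        unfolding angle_rhs_def using p_pos[of t]
        by (intro add_nonneg_nonneg[OF mult_nonneg_nonneg mult_nonneg_nonneg]) auto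
      then show "\<exists>y. (angle (max M C) has_real_derivative y) (at t) \<and> 0 \<le> y" using angle_deriv by blast
    qed (use P in simp)
    then show ?thesis by (simp add: angle_0)
  qed
  then show ?thesis using True by (intro exI[of _ "max M C"]) simp
next
  case False
  define A where "A = 1 / coeff_bound"
  define C where "C = coeff_bound"
  have AC: "A > 0" "C > 0" "\<And>t. A \<le> p t" "\<And>t. \<bar>Q t\<bar> \<le> C" "\<And>t. A \<le> 1 / p t"
    unfolding A_def C_def by (rule coeff_bound)+
  define h where "h = P / real k"
  have h: "h > 0" using P False by (simp add: h_def)
  \<comment> \<open>chosen so that \<open>A * B\<close> exceeds the square of \<open>pi / h\<close>\<close>
  define B where "B = ((pi / h)\<^sup>2 + A) / A"
  have B: "B > 0" using AC h by (simp add: B_def add_nonneg_pos)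
  have "h * sqrt (A * B) > pi"
  proof -
    have "pi / h < sqrt (A * B)" using AC by (intro real_less_rsqrt) (simp add: B_def)
    then show ?thesis using h by (simp add: pos_divide_less_eq mult.commute)
  qed
  define \<mu> where "\<mu> = max M (C + B / A)"
  have vB: "p t * (Q t + \<mu>) \<ge> B" for t
  proof -
    have "Q t + \<mu> \<ge> B / A" using AC(4)[of t] by (simp add: \<mu>_def)
    then have "p t * (Q t + \<mu>) \<ge> A * (B / A)"
      using AC(1,3) B p_pos[of t] by (intro mult_mono) (auto simp: less_imp_le)
    then show ?thesis using AC(1) by simp
  qed
  have "angle \<mu> (real i * h) \<ge> real i * pi" for i
  proof (induction i)
    case (Suc i)
    have "(of_int (int i) + 1) * pi \<le> angle \<mu> (real i * h + h)"
      by (rule pruefer_angle_advances[where u = "\<lambda>t. 1 / p t" and v = "\<lambda>t. p t * (Q t + \<mu>)",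
            OF _ AC(1) B AC(5) vB \<open>h * sqrt (A * B) > pi\<close>])
        (use Suc angle_deriv in \<open>auto simp: angle_rhs_def\<close>)
    then show ?case by (simp add: algebra_simps)
  qed (simp add: angle_0)
  from this[of k] False show ?thesis by (intro exI[of _ \<mu>]) (auto simp: h_def \<mu>_def)
qed

text \<open>Between parameters where the angle reaches consecutive multiples of \<open>\<pi>\<close>, the discriminant crosses
  the value \<open>2\<close>.\<close>

lemma eigenvalues_unbounded: "\<exists>\<mu>\<in>eigenvalues. M \<le> \<mu>"
proof -
  obtain k :: nat where "angle M P < real k * pi" using reals_Archimedean3[OF pi_gt_zero] by blast
  then have k: "angle M P \<le> real (2 * k) * pi" "angle M P \<le> real (2 * k + 1) * pi"
    by (auto simp: algebra_simps elim!: less_imp_le[OF less_le_trans] intro: add_increasing)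
  obtain \<mu>' where \<mu>': "\<mu>' \<ge> M" "angle \<mu>' P \<ge> real (2 * k + 1) * pi" using angle_end_unbounded by blast
  have c: "continuous_on S (\<lambda>\<mu>. angle \<mu> P)" "continuous_on S discriminant" for S
    using angle_end_continuous discriminant_continuous continuous_on_subset by blast+
  have "real (2 * k) * pi \<le> angle \<mu>' P" using \<mu>'(2) by (simp add: algebra_simps) (smt (verit) pi_gt_zero)
  then obtain \<mu>1 where \<mu>1: "\<mu>1 \<ge> M" "angle \<mu>1 P = real (2 * k) * pi"
    using IVT'[of "\<lambda>\<mu>. angle \<mu> P" M "real (2 * k) * pi" \<mu>'] k \<mu>'(1) c(1) by auto
  obtain \<mu>2 where \<mu>2: "\<mu>2 \<ge> M" "angle \<mu>2 P = real (2 * k + 1) * pi"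
    using IVT'[of "\<lambda>\<mu>. angle \<mu> P" M "real (2 * k + 1) * pi" \<mu>'] k \<mu>' c(1) by auto
  have D: "discriminant \<mu>1 \<ge> 2" "discriminant \<mu>2 \<le> 2"
    using discriminant_at_dirichlet[OF \<mu>1(2)] discriminant_at_dirichlet[OF \<mu>2(2)] by auto
  have "\<exists>\<mu>. M \<le> \<mu> \<and> discriminant \<mu> = 2"
  proof (cases "\<mu>1 \<le> \<mu>2")
    case True then show ?thesis
      using IVT2'[of discriminant \<mu>2 2 \<mu>1, OF _ _ _ c(2)] D \<mu>1(1) by (meson order_trans)
  next
    case False then show ?thesis
      using IVT'[of discriminant \<mu>2 2 \<mu>1, OF _ _ _ c(2)] D \<mu>2(1) by (meson order_trans linear)
  qed
  then show ?thesis using eigenvalue_if_discriminant by blast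
qed

section \<open>Discreteness of the periodic spectrum\<close>

text \<open>If \<open>Q + \<mu>\<close> were negative everywhere, the periodic function \<open>p y y'\<close> would be nondecreasing, hence
  constant, and both terms of its derivative would vanish.\<close>

lemma eigenvalues_bounded_below: "\<exists>m. \<forall>\<mu>\<in>eigenvalues. m \<le> \<mu>"
proof -
  define C where "C = coeff_bound"
  have C: "\<And>t. \<bar>Q t\<bar> \<le> C"
    unfolding C_def by (rule coeff_bound)+
  have "- C \<le> \<mu>" if ev: "\<mu> \<in> eigenvalues" for \<mu>
  proof (rule ccontr)
    assume "\<not> - C \<le> \<mu>"
    then have neg: "Q t + \<mu> < 0" for t using C[of t] by linarith
    obtain x where x: "solves \<mu> x" "\<And>t. x (t + P) = x t" "\<exists>t. x t \<noteq> 0"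
      using ev unfolding eigenvalues_def by blast
    let ?F = "\<lambda>t. fst (x t) * snd (x t)"
    let ?F' = "\<lambda>t. (snd (x t))\<^sup>2 / p t - p t * (Q t + \<mu>) * (fst (x t))\<^sup>2"
    have d: "(?F has_real_derivative ?F' t) (at t)" for t
      using DERIV_mult'[OF solves_derivs[OF x(1)], of t]
      by (rule back_subst[of "\<lambda>d. (_ has_real_derivative d) (at t)"]) (simp add: power2_eq_square algebra_simps)
    have nonneg: "(snd (x t))\<^sup>2 / p t \<ge> 0" "- (p t * (Q t + \<mu>)) * (fst (x t))\<^sup>2 \<ge> 0" for t
      using p_pos[of t] neg[of t] by (auto simp: mult_le_0_iff intro: mult_nonneg_nonneg)
    have F'0: "?F' t \<ge> 0" for t using add_nonneg_nonneg[OF nonneg[of t]] by (simp add: algebra_simps)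
    have mono: "?F s \<le> ?F t" if "s \<le> t" for s t
      by (rule DERIV_nonneg_imp_nondecreasing[OF that]) (use d F'0 in blast)
    have "x t = 0" if "0 < t" "t < P" for t
    proof -
      have const: "?F s = ?F 0" if "0 < s" "s < P" for s
        using mono[of 0 s] mono[of s P] x(2)[of 0] that by simp
      have "(?F has_real_derivative 0) (at t)"
        by (rule has_field_derivative_transform_within_open[of "\<lambda>_. ?F 0" 0 t "{0<..<P}"])
          (use that const in auto)
      then have "?F' t = 0" using d DERIV_unique by blast
      then have "(snd (x t))\<^sup>2 / p t = 0" "(p t * (Q t + \<mu>)) * (fst (x t))\<^sup>2 = 0"
        using nonneg[of t] unfolding mult_minus_left by linarith+
      then show ?thesis using p_pos[of t] neg[of t] by (simp add: prod_eq_iff)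
    qed
    then have "x (P / 2) = 0" using P by simp
    then show False
      using x(3) solves_zero_everywhere[OF x(1)] by blast
  qed
  then show ?thesis by blast
qed


text \<open>Eigenfunctions for different eigenvalues are orthogonal with weight \<open>p\<close>: the Wronskian is
  periodic, and its derivative is the weighted product.\<close>

lemma eigenfunctions_orthogonal:
  assumes x: "solves \<mu> x" "\<And>t. x (t + P) = x t" and y: "solves \<nu> y" "\<And>t. y (t + P) = y t" and "\<mu> \<noteq> \<nu>"
  shows "integral {0..P} (\<lambda>t. p t * (fst (x t) * fst (y t))) = 0"
proof -
  let ?W = "\<lambda>t. fst (x t) * snd (y t) - fst (y t) * snd (x t)"
  have "((\<lambda>t. (\<mu> - \<nu>) * (p t * (fst (x t) * fst (y t)))) has_integral ?W P - ?W 0) {0..P}"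
    by (rule fundamental_theorem_of_calculus)
      (use P wronskian_deriv[OF x(1) y(1)] in
        \<open>auto simp: has_real_derivative_iff_has_vector_derivative intro: has_vector_derivative_at_within\<close>)
  then have "integral {0..P} (\<lambda>t. (\<mu> - \<nu>) * (p t * (fst (x t) * fst (y t)))) = 0"
    using x(2)[of 0] y(2)[of 0] by (simp add: integral_unique del: integral_mult_right)
  then show ?thesis using \<open>\<mu> \<noteq> \<nu>\<close> by simp
qed

lemma solves_continuous: "solves \<mu> x \<Longrightarrow> continuous_on S x"
  unfolding solves_def
  by (meson continuous_at_imp_continuous_on has_vector_derivative_continuous)

text \<open>Eigenfunctions with bounded eigenvalues and unit initial data subconverge. Their limit
  would be orthogonal to itself if the eigenvalues were pairwise distinct.\<close>

lemma eigenvalues_finite_below: "finite {\<mu> \<in> eigenvalues. \<mu> \<le> M}"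
proof (rule ccontr)
  assume inf: "infinite {\<mu> \<in> eigenvalues. \<mu> \<le> M}"
  obtain lo where lo: "\<forall>\<mu>\<in>eigenvalues. lo \<le> \<mu>" using eigenvalues_bounded_below by blast
  obtain m :: "nat \<Rightarrow> real" where m: "inj m" "range m \<subseteq> {\<mu> \<in> eigenvalues. \<mu> \<le> M}"
    using infinite_countable_subset[OF inf] by blast
  have "\<exists>v. norm v = 1 \<and> (\<forall>t. sol (m i) v (t + P) = sol (m i) v t)" for i
  proof -
    have "m i \<in> eigenvalues" using m(2) by auto
    then obtain x where x: "solves (m i) x" "\<And>t. x (t + P) = x t" "\<exists>t. x t \<noteq> 0"
      unfolding eigenvalues_def by blast
    have nz: "norm (x 0) \<noteq> 0" using x(3) solves_nonzero[OF x(1)] by auto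
    let ?v = "(1 / norm (x 0)) *\<^sub>R x 0"
    have "solves (m i) (\<lambda>t. (1 / norm (x 0)) *\<^sub>R x t)"
      using solves_combine[OF x(1) x(1), of "1 / norm (x 0)" 0] by simp
    then have eq: "sol (m i) ?v t = (1 / norm (x 0)) *\<^sub>R x t" for t by (rule sol_eqI[symmetric])
    have "norm ?v = 1" using nz by simp
    moreover have "sol (m i) ?v (t + P) = sol (m i) ?v t" for t by (simp only: eq x(2))
    ultimately show ?thesis by blast
  qed
  then obtain w where w: "\<And>i. norm (w i) = 1" "\<And>i t. sol (m i) (w i) (t + P) = sol (m i) (w i) t"
    by metis
  have "compact ({lo..M} \<times> sphere (0 :: real \<times> real) 1)"
    by (intro compact_Times compact_sphere) simp
  then have "seq_compact ({lo..M} \<times> sphere (0 :: real \<times> real) 1)"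
    by (rule compact_imp_seq_compact)
  moreover have "\<forall>i. (m i, w i) \<in> {lo..M} \<times> sphere 0 1"
    using m(2) lo w(1) by auto
  ultimately obtain l s where l: "l \<in> {lo..M} \<times> sphere (0 :: real \<times> real) 1"
    and s: "strict_mono s" "((\<lambda>i. (m i, w i)) \<circ> s) \<longlonglongrightarrow> l"
    unfolding seq_compact_def by (metis (no_types, lifting))
  obtain \<mu> v where l_eq: "l = (\<mu>, v)" by (cases l)
  have v: "norm v = 1" using l l_eq by simp
  have lim: "(\<lambda>i. m (s i)) \<longlonglongrightarrow> \<mu>" "(\<lambda>i. w (s i)) \<longlonglongrightarrow> v"
    using tendsto_fst[OF s(2)] tendsto_snd[OF s(2)] by (simp_all add: l_eq o_def)
  define x where "x i = sol (m (s i)) (w (s i))" for i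
  let ?y = "sol \<mu> v"
  have unif: "uniform_limit {0..P} x ?y sequentially"
    using sol_tendsto_uniform[OF lim] unfolding x_def .
  \<comment> \<open>consecutive members of the sequence have different eigenvalues, so their products integrate to zero\<close>
  have unif': "uniform_limit {0..P} (\<lambda>i. x (Suc i)) ?y sequentially"
    using sol_tendsto_uniform[OF LIMSEQ_Suc[OF lim(1)] LIMSEQ_Suc[OF lim(2)]] unfolding x_def .
  have bounded: "bounded ((\<lambda>t. f (?y t)) ` {0..P})" if "continuous_on UNIV f" for f :: "real \<times> real \<Rightarrow> real"
    by (intro compact_imp_bounded compact_continuous_image continuous_on_compose2[OF that] solves_continuous[OF sol(1)]) auto
  have bp: "bounded (p ` {0..P})"
    by (intro compact_imp_bounded compact_continuous_image continuous_on_subset[OF p_cont]) auto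
  have u1: "uniform_limit {0..P} (\<lambda>i t. fst (x i t) * fst (x (Suc i) t)) (\<lambda>t. fst (?y t) * fst (?y t)) sequentially"
    by (intro uniform_limit_intros bounded continuous_intros bounded_linear.uniform_limit[OF bounded_linear_fst] unif unif')
  have b1: "bounded ((\<lambda>t. fst (?y t) * fst (?y t)) ` {0..P})"
    by (rule bounded[of "\<lambda>z. fst z * fst z"]) (intro continuous_intros)
  have u: "uniform_limit {0..P} (\<lambda>i t. p t * (fst (x i t) * fst (x (Suc i) t))) (\<lambda>t. p t * (fst (?y t) * fst (?y t))) sequentially"
    by (intro uniform_limit_intros bp b1 u1)
  have cont: "continuous_on {0..P} (\<lambda>t. p t * (fst (x i t) * fst (x j t)))" for i j
    unfolding x_def
    by (intro continuous_intros continuous_on_subset[OF p_cont] solves_continuous[OF sol(1)]) auto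
  obtain I J where IJ: "\<And>i. ((\<lambda>t. p t * (fst (x i t) * fst (x (Suc i) t))) has_integral I i) {0..P}"
    "((\<lambda>t. p t * (fst (?y t) * fst (?y t))) has_integral J) {0..P}" "I \<longlonglongrightarrow> J"
    by (rule uniform_limit_integral[OF u cont]) auto
  have "I i = 0" for i
  proof -
    have "m (s i) \<noteq> m (s (Suc i))"
      using m(1) s(1) by (metis injD lessI less_irrefl strict_mono_less)
    then have "integral {0..P} (\<lambda>t. p t * (fst (x i t) * fst (x (Suc i) t))) = 0"
      unfolding x_def by (rule eigenfunctions_orthogonal[OF sol(1) w(2) sol(1) w(2)])
    then show ?thesis using IJ(1) integral_unique by metis
  qed
  then have "I = (\<lambda>i. 0)" by auto
  then have "J = 0" using IJ(3) by (simp add: LIMSEQ_const_iff)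
  then have int0: "integral {0..P} (\<lambda>t. p t * (fst (?y t) * fst (?y t))) = 0"
    using IJ(2) by (simp add: integral_unique)
  have "\<forall>t\<in>{0..P}. p t * (fst (?y t) * fst (?y t)) = 0"
  proof (rule integral_eq_0_iff[THEN iffD1, OF _ _ _ int0])
    show "continuous_on {0..P} (\<lambda>t. p t * (fst (?y t) * fst (?y t)))"
      by (intro continuous_intros continuous_on_subset[OF p_cont] solves_continuous[OF sol(1)]) auto
  qed (use P p_pos in \<open>auto simp: less_imp_le\<close>)
  then have y0: "fst (?y t) = 0" if "0 \<le> t" "t \<le> P" for t
    using that p_pos[of t] by (metis atLeastAtMost_iff less_irrefl mult_eq_0_iff)
  let ?t = "P / 2"
  have "((\<lambda>t. fst (?y t)) has_real_derivative 0) (at ?t)"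
    by (rule has_field_derivative_transform_within_open[of "\<lambda>_. 0" 0 ?t "{0<..<P}"]) (use P y0 in auto)
  then have "snd (?y ?t) / p ?t = 0" using solves_derivs(1)[OF sol(1)] DERIV_unique by blast
  then have "?y ?t = 0" using y0[of ?t] P p_pos[of ?t] by (simp add: prod_eq_iff)
  then have "?y 0 = 0" by (rule solves_zero_everywhere[OF sol(1)])
  then show False using v by (simp add: sol(2))
qed

theorem eigenvalues_listing: "\<exists>a. strict_mono_on {1..} a \<and> a ` {1::nat..} = eigenvalues"
  by (rule ex_strict_mono_listing[OF eigenvalues_unbounded eigenvalues_finite_below])

end

text \<open>The scalar form of the equation, with \<open>p' / p\<close> as the coefficient of the first derivative.\<close>

theorem (in periodic_sturm_liouville) eigenvalues_scalar:
  assumes p': "\<And>t. (p has_real_derivative p' t) (at t)"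
  shows "eigenvalues = {\<mu>. \<exists>z. (\<forall>t. z differentiable (at t) \<and> deriv z differentiable (at t)) \<and>
      (\<forall>t. z (t + P) = z t) \<and> (\<exists>t. z t \<noteq> 0) \<and>
      (\<forall>t. deriv (deriv z) t + p' t / p t * deriv z t + Q t * z t + \<mu> * z t = 0)}"
    (is "_ = {\<mu>. \<exists>z. ?E \<mu> z}")
proof (intro set_eqI iffI)
  fix \<mu> assume "\<mu> \<in> eigenvalues"
  then obtain x where x: "solves \<mu> x" "\<And>t. x (t + P) = x t" "\<exists>t. x t \<noteq> 0"
    unfolding eigenvalues_def by blast
  let ?z = "\<lambda>t. fst (x t)"
  have dz: "(?z has_real_derivative snd (x t) / p t) (at t)" for t using solves_derivs(1)[OF x(1)] .
  then have z': "deriv ?z = (\<lambda>t. snd (x t) / p t)" using DERIV_imp_deriv by blast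
  have dz': "(deriv ?z has_real_derivative - ((Q t + \<mu>) * ?z t) - p' t / p t * deriv ?z t) (at t)" for t
  proof -
    have "(deriv ?z has_real_derivative (- (p t * (Q t + \<mu>) * fst (x t)) * p t - snd (x t) * p' t) / (p t * p t)) (at t)"
      unfolding z' using p_pos[of t] by (intro DERIV_divide solves_derivs(2)[OF x(1)] p') auto
    moreover have "(- (p t * (Q t + \<mu>) * fst (x t)) * p t - snd (x t) * p' t) / (p t * p t)
        = - ((Q t + \<mu>) * ?z t) - p' t / p t * deriv ?z t"
      using p_pos[of t] unfolding z' by (simp add: field_simps)
    ultimately show ?thesis by simp
  qed
  have "\<exists>t. ?z t \<noteq> 0"
  proof (rule ccontr)
    assume "\<not> ?thesis"
    then have z0: "?z = (\<lambda>t. 0)" by auto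
    then have "deriv ?z = (\<lambda>t. 0)" by simp
    then have "snd (x t) = 0" for t using z' p_pos[of t] by (metis divide_eq_0_iff less_irrefl)
    then show False using x(3) z0 by (metis fst_conv prod.collapse zero_prod_def)
  qed
  moreover have "deriv (deriv ?z) t + p' t / p t * deriv ?z t + Q t * ?z t + \<mu> * ?z t = 0" for t
    using DERIV_imp_deriv[OF dz'[of t]] by (simp add: algebra_simps)
  moreover have "?z differentiable (at t) \<and> deriv ?z differentiable (at t)" for t
    using dz dz' unfolding real_differentiable_def by blast
  ultimately have "?E \<mu> ?z" by (simp add: x(2))
  then show "\<mu> \<in> {\<mu>. \<exists>z. ?E \<mu> z}" by blast
next
  fix \<mu> assume "\<mu> \<in> {\<mu>. \<exists>z. ?E \<mu> z}"
  then obtain z where z: "?E \<mu> z" by blast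
  then have d: "(z has_real_derivative deriv z t) (at t)" "(deriv z has_real_derivative deriv (deriv z) t) (at t)" for t
    by (simp_all add: DERIV_deriv_iff_real_differentiable)
  have z'_per: "deriv z (t + P) = deriv z t" for t
  proof (rule DERIV_unique)
    have "((\<lambda>s. z (s + P)) has_real_derivative deriv z (t + P)) (at t)" using d(1)[of "t + P"] by (simp only: DERIV_shift)
    then show "(z has_real_derivative deriv z (t + P)) (at t)" using z by simp
  qed (rule d)
  let ?x = "\<lambda>t. (z t, p t * deriv z t)"
  have "solves \<mu> ?x" unfolding solves_def
  proof
    fix t
    have "((\<lambda>t. p t * deriv z t) has_real_derivative p' t * deriv z t + deriv (deriv z) t * p t) (at t)"
      by (intro DERIV_mult p' d)
    moreover have "p' t * deriv z t + deriv (deriv z) t * p t = - (p t * (Q t + \<mu>) * z t)"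
    proof -
      have "p t * (deriv (deriv z) t + p' t / p t * deriv z t + Q t * z t + \<mu> * z t) = 0" using z by simp
      then show ?thesis using p_pos[of t] by (simp add: algebra_simps)
    qed
    ultimately have "((\<lambda>t. p t * deriv z t) has_vector_derivative - (p t * (Q t + \<mu>) * z t)) (at t)"
      by (simp add: has_real_derivative_iff_has_vector_derivative)
    moreover have "(z has_vector_derivative deriv z t) (at t)"
      using d(1) by (simp add: has_real_derivative_iff_has_vector_derivative)
    ultimately show "(?x has_vector_derivative first_order_system \<mu> t (?x t)) (at t)"
      using p_pos[of t] by (simp add: first_order_system_def has_vector_derivative_Pair)
  qed
  then show "\<mu> \<in> eigenvalues" unfolding eigenvalues_def
    using z p_per z'_per by (auto intro!: exI[of _ ?x] simp: zero_prod_def)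
qed

section \<open>Green's identity on an annulus\<close>

abbreviation dir_deriv :: "('a::real_normed_vector \<Rightarrow> 'b::real_normed_vector) \<Rightarrow> 'a \<Rightarrow> 'a \<Rightarrow> 'b" where
  "dir_deriv f v \<equiv> (\<lambda>x. frechet_derivative f (at x) v)"

definition flat_laplacian :: "('a::euclidean_space \<Rightarrow> real) \<Rightarrow> 'a \<Rightarrow> real" where
  "flat_laplacian F x = (\<Sum>b\<in>Basis. dir_deriv (dir_deriv F b) b x)"

text \<open>A box that contains every unit translate of the ball of radius \<open>2\<close>.\<close>

definition test_box :: "'a::euclidean_space set" where
  "test_box = cbox (- 3 *\<^sub>R One) (3 *\<^sub>R One)"

lemma test_boxI: "norm x \<le> 3 \<Longrightarrow> x \<in> test_box"
  using Basis_le_norm[of _ x] unfolding test_box_def mem_box by (force simp: inner_sum_left_Basis abs_le_iff)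

text \<open>The integral of \<open>x \<mapsto> h (x + s v)\<close> does not depend on \<open>s\<close>, since Lebesgue measure is translation invariant;
  differentiate at \<open>s = 0\<close>. The box leaves room for these translations.\<close>

lemma integral_dir_deriv_compact_support:
  fixes h :: "'a::euclidean_space \<Rightarrow> real"
  assumes h: "\<And>x. (h has_derivative h' x) (at x)" and cont: "continuous_on UNIV (\<lambda>x. h' x v)"
    and supp: "\<And>x. norm x > 2 \<Longrightarrow> h x = 0" and v: "norm v \<le> 1"
  shows "integral test_box (\<lambda>x. h' x v) = 0"
proof -
  let ?a = "- 3 *\<^sub>R One :: 'a" and ?b = "3 *\<^sub>R One :: 'a"
  have h_cont: "continuous_on S h" for S
    using h by (meson continuous_at_imp_continuous_on has_derivative_continuous)
  let ?\<Phi> = "\<lambda>s. integral (cbox ?a ?b) (\<lambda>x. h (x + s *\<^sub>R v))"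
  have "(?\<Phi> has_field_derivative integral (cbox ?a ?b) (\<lambda>x. h' (x + 0 *\<^sub>R v) v)) (at 0 within {-1<..<1})"
  proof (rule leibniz_rule_field_derivative[where fx = "\<lambda>s x. h' (x + s *\<^sub>R v) v"])
    fix s x
    have "((\<lambda>s. h (x + s *\<^sub>R v)) has_derivative (\<lambda>y. h' (x + s *\<^sub>R v) (y *\<^sub>R v))) (at s)"
      by (rule has_derivative_compose[of "\<lambda>s. x + s *\<^sub>R v" "\<lambda>y. y *\<^sub>R v" s UNIV h, OF _ h])
        (auto intro!: derivative_eq_intros)
    moreover have "h' (x + s *\<^sub>R v) (y *\<^sub>R v) = h' (x + s *\<^sub>R v) v * y" for y
      using linear_cmul[OF has_derivative_linear[OF h]] by simp
    ultimately show "((\<lambda>s. h (x + s *\<^sub>R v)) has_real_derivative h' (x + s *\<^sub>R v) v) (at s within {-1<..<1})"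
      by (simp add: has_field_derivative_def has_derivative_at_withinI)
  next
    show "(\<lambda>x. h (x + s *\<^sub>R v)) integrable_on cbox ?a ?b" for s
      by (intro integrable_continuous continuous_on_compose2[OF h_cont[of UNIV]] continuous_intros) auto
    show "continuous_on ({- 1<..<1} \<times> cbox ?a ?b) (\<lambda>(s, x). h' (x + s *\<^sub>R v) v)"
      unfolding case_prod_beta
      by (intro continuous_on_compose2[OF cont] continuous_intros) auto
  qed auto
  then have d: "(?\<Phi> has_real_derivative integral test_box (\<lambda>x. h' x v)) (at 0)"
    by (simp add: test_box_def at_within_open[of 0 "{-1<..<1}"])
  have const: "?\<Phi> s = ?\<Phi> 0" if s: "s \<in> {-1<..<1}" for s
  proof -
    have out: "h (x + s *\<^sub>R v) = 0" if "\<bar>s\<bar> < 1" "x \<notin> test_box" for x s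
    proof (rule supp)
      have "norm x > 3" using test_boxI[of x] that by force
      moreover have "norm (s *\<^sub>R v) \<le> 1" using that v by (simp add: mult_le_one)
      ultimately show "norm (x + s *\<^sub>R v) > 2" using norm_diff_ineq[of x "s *\<^sub>R v"] by linarith
    qed
    have "((\<lambda>x. h x) has_integral ?\<Phi> 0) (cbox ?a ?b)"
      using integrable_continuous[OF h_cont] by (simp add: integrable_integral)
    from has_integral_affinity[OF this, of 1 "s *\<^sub>R v"]
    have "((\<lambda>x. h (x + s *\<^sub>R v)) has_integral ?\<Phi> 0) ((\<lambda>x. x + - (s *\<^sub>R v)) ` cbox ?a ?b)" by simp
    then have 1: "((\<lambda>x. h (x + s *\<^sub>R v)) has_integral ?\<Phi> 0) UNIV"
    proof (rule has_integral_on_superset)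
      fix x assume "x \<notin> (\<lambda>x. x + - (s *\<^sub>R v)) ` cbox ?a ?b"
      then have "x + s *\<^sub>R v \<notin> test_box"
        unfolding test_box_def by (metis (no_types, lifting) add.right_neutral add_uminus_conv_diff add_diff_cancel_right' image_eqI)
      then show "h (x + s *\<^sub>R v) = 0" using out[of 0 "x + s *\<^sub>R v"] by simp
    qed simp
    have "((\<lambda>x. h (x + s *\<^sub>R v)) has_integral ?\<Phi> s) (cbox ?a ?b)"
      by (intro integrable_integral integrable_continuous continuous_on_compose2[OF h_cont[of UNIV]] continuous_intros) auto
    then have "((\<lambda>x. h (x + s *\<^sub>R v)) has_integral ?\<Phi> s) UNIV"
      by (rule has_integral_on_superset) (use s out test_box_def in auto)
    with 1 show ?thesis using has_integral_unique by blast
  qed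
  have "(?\<Phi> has_real_derivative 0) (at 0)"
    by (rule has_field_derivative_transform_within_open[of "\<lambda>_. ?\<Phi> 0" 0 0 "{-1<..<1}"]) (use const in auto)
  with d show ?thesis using DERIV_unique by blast
qed

text \<open>A radial weight supported in the annulus \<open>1 \<le> |x| \<le> 2\<close>, as a function of \<open>|x|\<^sup>2\<close>.\<close>

definition bump :: "real \<Rightarrow> real" where
  "bump s = (max 0 ((s - 1) * (4 - s)))\<^sup>2"

definition bump' :: "real \<Rightarrow> real" where
  "bump' s = 2 * max 0 ((s - 1) * (4 - s)) * (5 - 2 * s)"

lemma max0_square_deriv: "((\<lambda>u::real. (max 0 u)\<^sup>2) has_real_derivative 2 * max 0 u) (at u)"
proof -
  consider "u < 0" | "u > 0" | "u = 0" by linarith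
  then show ?thesis
  proof cases
    case 1
    have "((\<lambda>u::real. (max 0 u)\<^sup>2) has_real_derivative 0) (at u)"
      by (rule has_field_derivative_transform_within_open[of "\<lambda>_. 0" 0 u "{..<0}"]) (use 1 in auto)
    then show ?thesis using 1 by simp
  next
    case 2
    have "((\<lambda>u::real. (max 0 u)\<^sup>2) has_real_derivative 2 * u) (at u)"
      by (rule has_field_derivative_transform_within_open[of "\<lambda>u. u\<^sup>2" _ u "{0<..}"])
        (use 2 in \<open>auto intro!: derivative_eq_intros\<close>)
    then show ?thesis using 2 by simp
  next
    case 3
    have "((\<lambda>h::real. (max 0 h)\<^sup>2 / h) \<longlongrightarrow> 0) (at 0)"
    proof (rule Lim_null_comparison[OF always_eventually])
      show "\<forall>h::real. norm ((max 0 h)\<^sup>2 / h) \<le> \<bar>h\<bar>"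
        by (auto simp: max_def power2_eq_square)
      show "((\<lambda>h::real. \<bar>h\<bar>) \<longlongrightarrow> 0) (at 0)"
        using tendsto_rabs[OF tendsto_ident_at, of "0::real" UNIV] by simp
    qed
    then show ?thesis using 3 by (simp add: DERIV_def)
  qed
qed

lemma bump_deriv: "(bump has_real_derivative bump' s) (at s)"
proof -
  have "((\<lambda>s. (s - 1) * (4 - s)) has_real_derivative 5 - 2 * s) (at s)"
    by (auto intro!: derivative_eq_intros)
  from DERIV_chain2[OF max0_square_deriv this] show ?thesis by (simp add: bump_def[abs_def] bump'_def)
qed

lemma bump_inner_continuous:
  "continuous_on S (\<lambda>x. bump (x \<bullet> x))" "continuous_on S (\<lambda>x. bump' (x \<bullet> x))"
  unfolding bump_def bump'_def by (intro continuous_intros)+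

lemma bump_nonneg: "bump s \<ge> 0" by (simp add: bump_def)

lemma bump_zero: "s \<le> 1 \<Longrightarrow> bump s = 0" "s \<ge> 4 \<Longrightarrow> bump s = 0" "s \<le> 1 \<Longrightarrow> bump' s = 0" "s \<ge> 4 \<Longrightarrow> bump' s = 0"
  by (auto simp: bump_def bump'_def mult_le_0_iff)

lemma inner_self_ge_4: "norm x > 2 \<Longrightarrow> x \<bullet> x \<ge> 4"
  using power_mono[of 2 "norm x" 2] by (simp add: power2_norm_eq_inner)

lemma inner_self_le_1: "norm x \<le> 1 \<Longrightarrow> x \<bullet> x \<le> 1"
  using power_mono[of "norm x" 1 2] by (simp add: power2_norm_eq_inner)

text \<open>A function that is continuous off the origin becomes continuous everywhere when it is
  cut off near the origin.\<close>

lemma continuous_cutoff: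
  fixes g :: "'a::real_inner \<Rightarrow> 'b::real_normed_vector"
  assumes g: "continuous_on (- {0}) g" and z: "\<And>x. norm x < 1 \<Longrightarrow> g x = 0"
  shows "continuous_on UNIV g"
proof (rule continuous_at_imp_continuous_on, intro ballI)
  fix x :: 'a
  show "isCont g x"
  proof (cases "x = 0")
    case True
    have "continuous_on (ball 0 1) g" by (rule continuous_on_eq[of _ "\<lambda>_. 0"]) (auto simp: z)
    then show ?thesis using True by (simp add: continuous_on_eq_continuous_at)
  next
    case False
    then show ?thesis using g continuous_on_eq_continuous_at[of "- {0}" g] by auto
  qed
qed

text \<open>Green's identity for functions without radial derivative: the radial weight then contributes
  no boundary term.\<close>

lemma green_annulus:
  fixes F G :: "'a::euclidean_space \<Rightarrow> real"
  assumes F: "smooth_on_open (- {0}) F" and G: "smooth_on_open (- {0}) G"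
    and radial: "\<And>x. x \<noteq> 0 \<Longrightarrow> dir_deriv F x x = 0" "\<And>x. x \<noteq> 0 \<Longrightarrow> dir_deriv G x x = 0"
  shows "integral test_box (\<lambda>x. bump (x \<bullet> x) * (x \<bullet> x) * (F x * flat_laplacian G x - G x * flat_laplacian F x)) = 0"
proof -
  define c where "c x = bump (x \<bullet> x) * (x \<bullet> x)" for x :: 'a
  define c' where "c' x v = (bump' (x \<bullet> x) * (x \<bullet> x) + bump (x \<bullet> x)) * (2 * (x \<bullet> v))" for x v :: 'a
  have c_deriv: "(c has_derivative c' x) (at x)" for x
  proof -
    have "((\<lambda>s. bump s * s) has_real_derivative bump' s * s + bump s) (at s)" for s
      by (auto intro!: derivative_eq_intros bump_deriv)
    moreover have "((\<lambda>x. x \<bullet> x) has_derivative (\<lambda>v. 2 * (x \<bullet> v))) (at x)"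
      by (auto intro!: derivative_eq_intros simp: inner_commute)
    ultimately have "((\<lambda>x. bump (x \<bullet> x) * (x \<bullet> x)) has_derivative (\<lambda>v. 2 * (x \<bullet> v) * (bump' (x \<bullet> x) * (x \<bullet> x) + bump (x \<bullet> x)))) (at x)"
      by (rule DERIV_compose_FDERIV[where f = "\<lambda>s. bump s * s" and g = "\<lambda>x. x \<bullet> x"])
    then show ?thesis unfolding c_def c'_def by (simp add: mult.commute)
  qed
  have open0: "open (- {0 :: 'a})" by auto
  define h where "h b x = c x * (F x * dir_deriv G b x - G x * dir_deriv F b x)" for b x
  define h' where "h' b x v = (if x = 0 then 0 else c' x v * (F x * dir_deriv G b x - G x * dir_deriv F b x)
     + c x * ((F x * dir_deriv (dir_deriv G b) v x + dir_deriv F v x * dir_deriv G b x)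
            - (G x * dir_deriv (dir_deriv F b) v x + dir_deriv G v x * dir_deriv F b x)))" for b x v
  have c_zero: "c x = 0" "c' x v = 0" if "norm x \<le> 1 \<or> norm x > 2" for x v
    using that inner_self_ge_4[of x] inner_self_le_1[of x] by (auto simp: c_def c'_def bump_zero)
  have h_deriv: "(h b has_derivative h' b x) (at x)" for b x
  proof (cases "x = 0")
    case True
    have "((\<lambda>_. 0) has_derivative (\<lambda>_. 0)) (at x)" by simp
    then have "(h b has_derivative (\<lambda>_. 0)) (at x)"
      by (rule has_derivative_transform_within_open[of _ _ _ _ "ball 0 1"])
        (use True in \<open>auto simp: h_def c_zero\<close>)
    then show ?thesis using True by (simp add: h'_def[abs_def])
  next
    case False
    then have x: "x \<in> - {0}" by simp
    note dF = smooth_has_derivative[OF F x] and dG = smooth_has_derivative[OF G x]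
      and ddF = smooth_has_derivative[OF smooth_frechet_derivative[OF F, of b] x]
      and ddG = smooth_has_derivative[OF smooth_frechet_derivative[OF G, of b] x]
    have "((\<lambda>x. c x * (F x * dir_deriv G b x - G x * dir_deriv F b x)) has_derivative
       (\<lambda>v. c x * ((F x * dir_deriv (dir_deriv G b) v x + dir_deriv F v x * dir_deriv G b x)
            - (G x * dir_deriv (dir_deriv F b) v x + dir_deriv G v x * dir_deriv F b x))
           + c' x v * (F x * dir_deriv G b x - G x * dir_deriv F b x))) (at x)"
      by (intro has_derivative_mult has_derivative_diff dF dG ddF ddG c_deriv)
    then show ?thesis using False by (simp add: h_def[abs_def] h'_def[abs_def] add.commute)
  qed
  have "continuous_on UNIV (\<lambda>x. h' b x b)" for b
  proof (rule continuous_cutoff)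
    note cts = smooth_continuous_on[OF F] smooth_continuous_on[OF smooth_frechet_derivative[OF F]]
      smooth_continuous_on[OF smooth_frechet_derivative[OF smooth_frechet_derivative[OF F]]]
      smooth_continuous_on[OF G] smooth_continuous_on[OF smooth_frechet_derivative[OF G]]
      smooth_continuous_on[OF smooth_frechet_derivative[OF smooth_frechet_derivative[OF G]]]
    show "h' b x b = 0" if "norm x < 1" for x using c_zero[of x] that by (simp add: h'_def)
    have "continuous_on (- {0}) (\<lambda>x. c' x b * (F x * dir_deriv G b x - G x * dir_deriv F b x)
       + c x * ((F x * dir_deriv (dir_deriv G b) b x + dir_deriv F b x * dir_deriv G b x)
              - (G x * dir_deriv (dir_deriv F b) b x + dir_deriv G b x * dir_deriv F b x)))"
      unfolding c_def c'_def
      by (intro continuous_intros cts bump_inner_continuous)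
    then show "continuous_on (- {0}) (\<lambda>x. h' b x b)"
      by (rule continuous_on_eq) (auto simp: h'_def)
  qed
  note cont = this
  have int0: "integral test_box (\<lambda>x. h' b x b) = 0" if "b \<in> Basis" for b
    by (rule integral_dir_deriv_compact_support[OF h_deriv cont]) (use that in \<open>auto simp: h_def c_zero\<close>)
  have "(\<Sum>b\<in>Basis. h' b x b) = c x * (F x * flat_laplacian G x - G x * flat_laplacian F x)" for x
  proof (cases "x = 0")
    case True then show ?thesis by (simp add: h'_def c_zero)
  next
    case False
    have rad: "(\<Sum>b\<in>Basis. (x \<bullet> b) * dir_deriv H b x) = 0" if "smooth_on_open (- {0}) H" "dir_deriv H x x = 0" for H :: "'a \<Rightarrow> real"
    proof -
      have "dir_deriv H x x = (\<Sum>b\<in>Basis. (x \<bullet> b) *\<^sub>R dir_deriv H b x)"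
        by (rule linear_eq_sum_Basis[OF has_derivative_linear[OF smooth_has_derivative[OF that(1)]]]) (use False in auto)
      with that show ?thesis by simp
    qed
    define q where "q = 2 * (bump' (x \<bullet> x) * (x \<bullet> x) + bump (x \<bullet> x))"
    have c'_eq: "c' x b = q * (x \<bullet> b)" for b by (simp add: c'_def q_def)
    have "(\<Sum>b\<in>Basis. h' b x b) = (\<Sum>b\<in>Basis. c' x b * (F x * dir_deriv G b x - G x * dir_deriv F b x)
       + c x * (F x * dir_deriv (dir_deriv G b) b x - G x * dir_deriv (dir_deriv F b) b x))"
      using False by (intro sum.cong) (auto simp: h'_def algebra_simps)
    also have "\<dots> = q * (F x * (\<Sum>b\<in>Basis. (x \<bullet> b) * dir_deriv G b x) - G x * (\<Sum>b\<in>Basis. (x \<bullet> b) * dir_deriv F b x))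
       + c x * (F x * flat_laplacian G x - G x * flat_laplacian F x)"
      unfolding flat_laplacian_def c'_eq
      by (simp add: sum.distrib sum_distrib_left sum_subtractf right_diff_distrib mult_ac)
    finally show ?thesis using rad[OF F] rad[OF G] radial False by simp
  qed
  then have "integral test_box (\<lambda>x. c x * (F x * flat_laplacian G x - G x * flat_laplacian F x))
     = integral test_box (\<lambda>x. \<Sum>b\<in>Basis. h' b x b)" by simp
  also have "\<dots> = (\<Sum>b\<in>Basis. integral test_box (\<lambda>x. h' b x b))"
    unfolding test_box_def
    by (intro integral_sum integrable_continuous continuous_on_subset[OF cont]) auto
  also have "\<dots> = 0" using int0 by simp
  finally show ?thesis by (simp add: c_def)
qed

section \<open>Functions that are constant on rays\<close>

lemma smooth_sgn: "smooth_on_open (- {0}) (sgn :: 'a::euclidean_space \<Rightarrow> 'a)"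
  unfolding sgn_div_norm[abs_def] by (intro smooth_intros) auto

text \<open>Differentiation lowers the degree of homogeneity by one. The factor \<open>c s\<close> covers the degrees needed
  below without powers of negative exponent.\<close>

lemma dir_deriv_homogeneous:
  fixes F :: "'a::euclidean_space \<Rightarrow> real"
  assumes F: "smooth_on_open (- {0}) F" and hom: "\<And>x s. s > 0 \<Longrightarrow> F (s *\<^sub>R x) = c s * F x"
    and "x \<noteq> 0" "s > 0"
  shows "s * dir_deriv F v (s *\<^sub>R x) = c s * dir_deriv F v x"
proof -
  have "((\<lambda>x. F (s *\<^sub>R x)) has_derivative (\<lambda>v. dir_deriv F (s *\<^sub>R v) (s *\<^sub>R x))) (at x)"
    by (rule has_derivative_compose[OF _ smooth_has_derivative[OF F]])
      (use assms in \<open>auto intro!: derivative_eq_intros\<close>)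
  moreover have "((\<lambda>x. F (s *\<^sub>R x)) has_derivative (\<lambda>v. c s * dir_deriv F v x)) (at x)"
    using has_derivative_mult_right[OF smooth_has_derivative[OF F], of x "c s"] assms by simp
  ultimately have "dir_deriv F (s *\<^sub>R v) (s *\<^sub>R x) = c s * dir_deriv F v x"
    using has_derivative_unique by metis
  moreover have "dir_deriv F (s *\<^sub>R v) (s *\<^sub>R x) = s * dir_deriv F v (s *\<^sub>R x)"
    using linear_cmul[OF has_derivative_linear[OF smooth_has_derivative[OF F]]] assms by simp
  ultimately show ?thesis by simp
qed

lemma radial_derivative_zero:
  fixes F :: "'a::euclidean_space \<Rightarrow> real"
  assumes F: "smooth_on_open (- {0}) F" and hom: "\<And>x s. s > 0 \<Longrightarrow> F (s *\<^sub>R x) = F x" and "x \<noteq> 0"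
  shows "dir_deriv F x x = 0"
proof -
  have "((\<lambda>s. F (s *\<^sub>R x)) has_derivative (\<lambda>y. dir_deriv F (y *\<^sub>R x) (1 *\<^sub>R x))) (at 1)"
    by (rule has_derivative_compose[OF _ smooth_has_derivative[OF F]])
      (use assms in \<open>auto intro!: derivative_eq_intros\<close>)
  moreover have "((\<lambda>s. F (s *\<^sub>R x)) has_derivative (\<lambda>y. 0)) (at 1)"
    by (rule has_derivative_transform_within_open[of "\<lambda>_. F x" _ _ _ "{0<..}"]) (use hom in auto)
  ultimately have "(\<lambda>y. dir_deriv F (y *\<^sub>R x) (1 *\<^sub>R x)) = (\<lambda>y. 0)" by (rule has_derivative_unique)
  from fun_cong[OF this, of 1] show ?thesis by simp
qed

lemma dir_deriv_homogeneous_twice: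
  fixes F :: "'a::euclidean_space \<Rightarrow> real"
  assumes F: "smooth_on_open (- {0}) F" and hom: "\<And>x s. s > 0 \<Longrightarrow> F (s *\<^sub>R x) = F x"
    and "x \<noteq> 0" "s > 0"
  shows "s\<^sup>2 * dir_deriv (dir_deriv F v) w (s *\<^sub>R x) = dir_deriv (dir_deriv F v) w x"
proof -
  define G where "G x = (if x = 0 then 0 else dir_deriv F v x)" for x
  have d: "s * dir_deriv F v (s *\<^sub>R x) = dir_deriv F v x" if "x \<noteq> 0" "s > 0" for x s
    using dir_deriv_homogeneous[OF F, of "\<lambda>_. 1" x s v] hom that by simp
  have hG: "G (s *\<^sub>R x) = inverse s * G x" if "s > 0" for x s
    using d[of x s] that by (auto simp: G_def field_simps)
  have sG: "smooth_on_open (- {0}) G"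
    by (rule smooth_cong[OF _ _ smooth_frechet_derivative[OF F, of v]]) (auto simp: G_def)
  have GF: "dir_deriv G w y = dir_deriv (dir_deriv F v) w y" if "y \<noteq> 0" for y
  proof -
    have "(G has_derivative frechet_derivative (dir_deriv F v) (at y)) (at y)"
      by (rule has_derivative_transform_within_open[OF smooth_has_derivative[OF smooth_frechet_derivative[OF F, of v]], of y "- {0}"])
        (use that in \<open>auto simp: G_def\<close>)
    then show ?thesis by (simp add: frechet_derivative_eqI)
  qed
  have "s * dir_deriv G w (s *\<^sub>R x) = inverse s * dir_deriv G w x"
    by (rule dir_deriv_homogeneous[OF sG hG]) (use assms in auto)
  then show ?thesis using GF[of x] GF[of "s *\<^sub>R x"] assms by (simp add: power2_eq_square field_simps)
qed

text \<open>The flat Laplacian of a function that is constant on rays is homogeneous of degree \<open>- 2\<close>, so it is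
  determined by its values on the sphere.\<close>

lemma flat_laplacian_homogeneous:
  fixes F :: "'a::euclidean_space \<Rightarrow> real"
  assumes F: "smooth_on_open (- {0}) F" and hom: "\<And>x s. s > 0 \<Longrightarrow> F (s *\<^sub>R x) = F x" and "x \<noteq> 0"
  shows "(x \<bullet> x) * flat_laplacian F x = flat_laplacian F (sgn x)"
proof -
  have "(norm x)\<^sup>2 * dir_deriv (dir_deriv F b) b (norm x *\<^sub>R sgn x) = dir_deriv (dir_deriv F b) b (sgn x)" for b
    by (rule dir_deriv_homogeneous_twice[OF F hom]) (use assms in \<open>auto simp: sgn_zero_iff\<close>)
  then show ?thesis
    using assms(3) by (simp add: flat_laplacian_def sum_distrib_left sgn_div_norm power2_norm_eq_inner)
qed

lemma has_derivative_inverse_norm: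
  fixes x :: "'a::euclidean_space"
  assumes "x \<noteq> 0"
  shows "((\<lambda>x. inverse (norm x)) has_derivative (\<lambda>v. - (x \<bullet> v) * inverse (norm x) ^ 3)) (at x)"
proof -
  have "((\<lambda>x. inverse (norm x)) has_derivative (\<lambda>v. - (inverse (norm x) * (v \<bullet> sgn x) * inverse (norm x)))) (at x)"
    by (rule Deriv.has_derivative_inverse[OF _ has_derivative_norm]) (use assms in auto)
  then show ?thesis
    by (rule back_subst[of "\<lambda>d. (_ has_derivative d) (at x)"])
      (use assms in \<open>auto simp: fun_eq_iff sgn_div_norm power3_eq_cube inner_commute divide_inverse\<close>)
qed

text \<open>A ridge function depends on the height \<open>y \<bullet> e\<close> only; its Laplacian is the
  Gegenbauer operator in the height.\<close>

lemma flat_laplacian_ridge: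
  fixes e x :: "'a::euclidean_space" and g g' g'' :: "real \<Rightarrow> real"
  assumes e: "norm e = 1" and x: "x \<noteq> 0"
    and g: "\<And>s. (g has_real_derivative g' s) (at s)" "\<And>s. (g' has_real_derivative g'' s) (at s)"
  defines "h \<equiv> \<lambda>x. sgn x \<bullet> e"
  shows "(x \<bullet> x) * flat_laplacian (\<lambda>x. g (h x)) x
     = (1 - (h x)\<^sup>2) * g'' (h x) - (real DIM('a) - 1) * h x * g' (h x)"
proof -
  define \<rho> where "\<rho> = (\<lambda>x::'a. inverse (norm x))"
  have h_eq: "h x = (x \<bullet> e) * \<rho> x" for x by (simp add: h_def \<rho>_def sgn_div_norm)
  have \<rho>: "(\<rho> has_derivative (\<lambda>v. - (x \<bullet> v) * \<rho> x ^ 3)) (at x)" if "x \<noteq> 0" for x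
    unfolding \<rho>_def by (rule has_derivative_inverse_norm[OF that])
  define k where "k x b = (b \<bullet> e) * \<rho> x - (x \<bullet> e) * (x \<bullet> b) * \<rho> x ^ 3" for x b
  have h_deriv: "(h has_derivative k x) (at x)" if "x \<noteq> 0" for x
    unfolding h_eq[abs_def]
    by (rule derivative_eq_intros \<rho>[OF that] refl | simp)+ (auto simp: k_def fun_eq_iff algebra_simps)
  have gh: "((\<lambda>x. g (h x)) has_derivative (\<lambda>b. k x b * g' (h x))) (at x)" if "x \<noteq> 0" for x
    using DERIV_compose_FDERIV[OF g(1) h_deriv[OF that]] .
  have first: "dir_deriv (\<lambda>x. g (h x)) b y = k y b * g' (h y)" if "y \<noteq> 0" for y b
    using frechet_derivative_eqI[OF gh[OF that]] by simp
  define k' where "k' b = - 2 * (b \<bullet> e) * (x \<bullet> b) * \<rho> x ^ 3 - (x \<bullet> e) * (b \<bullet> b) * \<rho> x ^ 3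
      + 3 * (x \<bullet> e) * (x \<bullet> b)\<^sup>2 * \<rho> x ^ 5" for b
  have second: "dir_deriv (dir_deriv (\<lambda>x. g (h x)) b) b x = k' b * g' (h x) + (k x b)\<^sup>2 * g'' (h x)" for b
  proof -
    have kd: "((\<lambda>y. k y b) has_derivative (\<lambda>v. - (b \<bullet> e) * (x \<bullet> v) * \<rho> x ^ 3
        - (((v \<bullet> e) * (x \<bullet> b) + (x \<bullet> e) * (v \<bullet> b)) * \<rho> x ^ 3
           + (x \<bullet> e) * (x \<bullet> b) * (3 * \<rho> x ^ 2 * (- (x \<bullet> v) * \<rho> x ^ 3))))) (at x)"
      unfolding k_def by (rule derivative_eq_intros \<rho>[OF x] refl | simp)+ (auto simp: fun_eq_iff algebra_simps)
    have "((\<lambda>y. k y b * g' (h y)) has_derivative (\<lambda>v. k x b * (k x v * g'' (h x)) +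
        (- (b \<bullet> e) * (x \<bullet> v) * \<rho> x ^ 3
        - (((v \<bullet> e) * (x \<bullet> b) + (x \<bullet> e) * (v \<bullet> b)) * \<rho> x ^ 3
           + (x \<bullet> e) * (x \<bullet> b) * (3 * \<rho> x ^ 2 * (- (x \<bullet> v) * \<rho> x ^ 3)))) * g' (h x))) (at x)" (is "(_ has_derivative ?D) _")
      by (rule has_derivative_mult[OF kd DERIV_compose_FDERIV[OF g(2) h_deriv[OF x]]])
    then have "(dir_deriv (\<lambda>x. g (h x)) b has_derivative ?D) (at x)"
      by (rule has_derivative_transform_within_open[of _ _ _ _ "- {0}"]) (use x first in auto)
    then have "dir_deriv (dir_deriv (\<lambda>x. g (h x)) b) b x = ?D b" by (simp add: frechet_derivative_eqI)
    also have "\<dots> = k' b * g' (h x) + (k x b)\<^sup>2 * g'' (h x)"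
      by (simp add: k'_def power2_eq_square eval_nat_numeral algebra_simps)
    finally show ?thesis .
  qed
  have parseval: "(\<Sum>b\<in>Basis. (b \<bullet> u) * (b \<bullet> v)) = u \<bullet> v" for u v :: 'a
    by (simp add: euclidean_inner[of u v] inner_commute)
  have nx: "\<rho> x ^ 2 * (x \<bullet> x) = 1" using x by (simp add: \<rho>_def power2_norm_eq_inner[symmetric] field_simps)
  have ee: "e \<bullet> e = 1" using e by (simp add: norm_eq_1)
  have s1: "(\<Sum>b\<in>Basis. (k x b)\<^sup>2) = \<rho> x ^ 2 * (1 - (h x)\<^sup>2)"
  proof -
    have "(\<Sum>b\<in>Basis. (k x b)\<^sup>2) = (\<Sum>b\<in>Basis. \<rho> x ^ 2 * ((b \<bullet> e) * (b \<bullet> e))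
        - 2 * (x \<bullet> e) * \<rho> x ^ 4 * ((b \<bullet> e) * (b \<bullet> x)) + (x \<bullet> e)\<^sup>2 * \<rho> x ^ 6 * ((b \<bullet> x) * (b \<bullet> x)))"
      by (intro sum.cong refl) (simp add: k_def power2_eq_square eval_nat_numeral algebra_simps inner_commute)
    also have "\<dots> = \<rho> x ^ 2 * (e \<bullet> e) - 2 * (x \<bullet> e) * \<rho> x ^ 4 * (e \<bullet> x) + (x \<bullet> e)\<^sup>2 * \<rho> x ^ 6 * (x \<bullet> x)"
      unfolding sum.distrib sum_subtractf sum_distrib_left[symmetric] parseval ..
    also have "\<dots> = \<rho> x ^ 2 * ((e \<bullet> e) - 2 * (x \<bullet> e)\<^sup>2 * \<rho> x ^ 2 + (x \<bullet> e)\<^sup>2 * \<rho> x ^ 2 * (\<rho> x ^ 2 * (x \<bullet> x)))"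
      by (simp add: power2_eq_square eval_nat_numeral algebra_simps inner_commute)
    finally show ?thesis unfolding nx ee h_eq by (simp add: power_mult_distrib)
  qed
  have s2: "(\<Sum>b\<in>Basis. k' b) = - (real DIM('a) - 1) * h x * \<rho> x ^ 2"
  proof -
    have "(\<Sum>b\<in>Basis. k' b) = (\<Sum>b\<in>Basis. - 2 * \<rho> x ^ 3 * ((b \<bullet> e) * (b \<bullet> x)) - (x \<bullet> e) * \<rho> x ^ 3
      + 3 * (x \<bullet> e) * \<rho> x ^ 5 * ((b \<bullet> x) * (b \<bullet> x)))"
      by (intro sum.cong refl) (simp add: k'_def power2_eq_square algebra_simps inner_commute)
    also have "\<dots> = - 2 * \<rho> x ^ 3 * (e \<bullet> x) - real DIM('a) * ((x \<bullet> e) * \<rho> x ^ 3) + 3 * (x \<bullet> e) * \<rho> x ^ 5 * (x \<bullet> x)"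
      unfolding sum.distrib sum_subtractf sum_distrib_left[symmetric] parseval by simp
    also have "\<dots> = (x \<bullet> e) * \<rho> x ^ 3 * (- 2 - real DIM('a) + 3 * (\<rho> x ^ 2 * (x \<bullet> x)))"
      by (simp add: eval_nat_numeral algebra_simps inner_commute)
    finally show ?thesis unfolding nx h_eq by (simp add: eval_nat_numeral algebra_simps)
  qed
  have "flat_laplacian (\<lambda>x. g (h x)) x = (\<Sum>b\<in>Basis. k' b) * g' (h x) + (\<Sum>b\<in>Basis. (k x b)\<^sup>2) * g'' (h x)"
    unfolding flat_laplacian_def second by (simp add: sum.distrib sum_distrib_right)
  also have "\<dots> = \<rho> x ^ 2 * ((1 - (h x)\<^sup>2) * g'' (h x) - (real DIM('a) - 1) * h x * g' (h x))"
    unfolding s1 s2 by (simp add: algebra_simps)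
  finally have "(x \<bullet> x) * flat_laplacian (\<lambda>x. g (h x)) x
      = (\<rho> x ^ 2 * (x \<bullet> x)) * ((1 - (h x)\<^sup>2) * g'' (h x) - (real DIM('a) - 1) * h x * g' (h x))"
    by (simp only: mult_ac)
  then show ?thesis unfolding nx by simp
qed

section \<open>Averages over the unit sphere\<close>

text \<open>Up to a constant factor, \<open>sphere_mean\<close> is the integral over the unit sphere.\<close>

definition sphere_mean :: "('a::euclidean_space \<Rightarrow> real) \<Rightarrow> real" where
  "sphere_mean f = integral test_box (\<lambda>x. bump (x \<bullet> x) * f (sgn x))"

lemma sgn_in_sphere: "x \<noteq> 0 \<Longrightarrow> sgn x \<in> sphere 0 1" for x :: "'a::euclidean_space"
  unfolding mem_sphere_0 by (simp add: norm_sgn)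

lemma sphere_integrand_continuous:
  fixes f :: "'a::euclidean_space \<Rightarrow> real"
  assumes "continuous_on (sphere 0 1) f"
  shows "continuous_on UNIV (\<lambda>x. bump (x \<bullet> x) * f (sgn x))"
proof (rule continuous_cutoff)
  show "continuous_on (- {0}) (\<lambda>x. bump (x \<bullet> x) * f (sgn x))"
    by (rule continuous_on_mult[OF bump_inner_continuous(1) continuous_on_compose2[OF assms]])
      (use sgn_in_sphere in \<open>fastforce intro!: continuous_intros\<close>)+
  show "bump (x \<bullet> x) * f (sgn x) = 0" if "norm x < 1" for x :: 'a
    using that inner_self_le_1[of x] by (simp add: bump_zero)
qed

lemma sphere_integrand_integrable:
  fixes f :: "'a::euclidean_space \<Rightarrow> real"
  assumes "continuous_on (sphere 0 1) f"
  shows "(\<lambda>x. bump (x \<bullet> x) * f (sgn x)) integrable_on test_box"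
  unfolding test_box_def
  by (rule integrable_continuous[OF continuous_on_subset[OF sphere_integrand_continuous[OF assms]]]) simp

lemma sphere_mean_add:
  assumes "continuous_on (sphere 0 1) f" "continuous_on (sphere 0 1) g"
  shows "sphere_mean (\<lambda>y. f y + g y) = sphere_mean f + sphere_mean g"
  unfolding sphere_mean_def distrib_left
  by (intro integral_add sphere_integrand_integrable assms)

lemma sphere_mean_cmult: "sphere_mean (\<lambda>y. c * f y) = c * sphere_mean f"
  unfolding sphere_mean_def by (simp add: mult.left_commute[of _ c])

lemma sphere_mean_cong:
  assumes "\<And>y. y \<in> sphere 0 1 \<Longrightarrow> f y = g y"
  shows "sphere_mean f = sphere_mean g"
proof -
  have "bump (x \<bullet> x) * f (sgn x) = bump (x \<bullet> x) * g (sgn x)" for x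
    using assms[OF sgn_in_sphere, of x] by (cases "x = 0") (simp_all add: bump_zero)
  then have "(\<lambda>x. bump (x \<bullet> x) * f (sgn x)) = (\<lambda>x. bump (x \<bullet> x) * g (sgn x))" by blast
  then show ?thesis unfolding sphere_mean_def by (rule arg_cong)
qed

lemma sphere_mean_le:
  assumes "continuous_on (sphere 0 1) f" "continuous_on (sphere 0 1) g" "\<And>y. y \<in> sphere 0 1 \<Longrightarrow> f y \<le> g y"
  shows "sphere_mean f \<le> sphere_mean g"
  unfolding sphere_mean_def
proof (intro integral_le sphere_integrand_integrable assms(1,2))
  fix x show "bump (x \<bullet> x) * f (sgn x) \<le> bump (x \<bullet> x) * g (sgn x)"
    using assms(3)[OF sgn_in_sphere, of x] bump_nonneg[of "x \<bullet> x"]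
    by (cases "x = 0") (simp_all add: bump_zero mult_left_mono)
qed

lemma sphere_mean_square_zero:
  fixes f :: "'a::euclidean_space \<Rightarrow> real"
  assumes f: "continuous_on (sphere 0 1) f" and zero: "sphere_mean (\<lambda>y. (f y)\<^sup>2) = 0" and y: "y \<in> sphere 0 1"
  shows "f y = 0"
proof -
  have c: "continuous_on (sphere 0 1) (\<lambda>y. (f y)\<^sup>2)" by (intro continuous_intros f)
  have "\<forall>x\<in>cbox (- 3 *\<^sub>R One) (3 *\<^sub>R One :: 'a). bump (x \<bullet> x) * (f (sgn x))\<^sup>2 = 0"
  proof (rule integral_cbox_eq_0_iff[THEN iffD1])
    show "continuous_on (cbox (- 3 *\<^sub>R One) (3 *\<^sub>R One)) (\<lambda>x. bump (x \<bullet> x) * (f (sgn x))\<^sup>2)"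
      by (rule continuous_on_subset[OF sphere_integrand_continuous[OF c]]) simp
    show "box (- 3 *\<^sub>R One) (3 *\<^sub>R One :: 'a) \<noteq> {}"
      unfolding box_ne_empty by (auto simp: inner_sum_left_Basis)
  qed (use zero bump_nonneg in \<open>auto simp: sphere_mean_def test_box_def\<close>)
  \<comment> \<open>at radius \<open>3/2\<close> the weight is positive\<close>
  moreover have "(3/2) *\<^sub>R y \<in> test_box" by (rule test_boxI) (use y in simp)
  ultimately have "bump (((3/2) *\<^sub>R y) \<bullet> ((3/2) *\<^sub>R y)) * (f (sgn ((3/2) *\<^sub>R y)))\<^sup>2 = 0"
    unfolding test_box_def by blast
  moreover have "norm y = 1" using y by simp
  then have "sgn y = y" "y \<bullet> y = 1" by (simp_all add: sgn_div_norm flip: norm_eq_1)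
  ultimately show ?thesis by (simp add: sgn_scaleR bump_def)
qed

text \<open>The multiples of the exponentials \<open>exp (y \<bullet> a)\<close> span an algebra that separates points, and each
  exponential is a uniform limit of polynomials in one height function.\<close>

lemma exponential_moments_zero:
  fixes f :: "'a::euclidean_space \<Rightarrow> real"
  assumes f: "continuous_on (sphere 0 1) f"
    and mom: "\<And>e k. norm e = 1 \<Longrightarrow> sphere_mean (\<lambda>y. f y * (y \<bullet> e) ^ k) = 0"
  shows "sphere_mean (\<lambda>y. f y * exp (y \<bullet> a)) = 0"
proof -
  have mom': "sphere_mean (\<lambda>y. f y * (y \<bullet> a) ^ k) = 0" for k
  proof (cases "a = 0")
    case True
    obtain e :: 'a where "norm e = 1" using norm_Basis nonempty_Basis by blast
    from mom[OF this, of 0] show ?thesis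
      using True by (cases k) (auto simp: sphere_mean_def)
  next
    case False
    have "f y * (y \<bullet> a) ^ k = norm a ^ k * (f y * (y \<bullet> sgn a) ^ k)" for y
    proof -
      have "y \<bullet> a = norm a * (y \<bullet> sgn a)" using False by (simp add: sgn_div_norm)
      then show ?thesis by (simp add: power_mult_distrib)
    qed
    then have "(\<lambda>y. f y * (y \<bullet> a) ^ k) = (\<lambda>y. norm a ^ k * (f y * (y \<bullet> sgn a) ^ k))" by blast
    then show ?thesis using mom[of "sgn a" k] False by (simp only: sphere_mean_cmult) (simp add: norm_sgn)
  qed
  let ?B = "cbox (- 3 *\<^sub>R One) (3 *\<^sub>R One) :: 'a set"
  let ?w = "\<lambda>x. bump (x \<bullet> x) * f (sgn x)"
  let ?t = "\<lambda>i x. ?w x * ((sgn x \<bullet> a) ^ i / fact i)"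
  have "compact ((\<lambda>x. ?w x) ` ?B)"
    by (intro compact_continuous_image continuous_on_subset[OF sphere_integrand_continuous[OF f]]) auto
  then have "bounded ((\<lambda>x. ?w x) ` ?B)" by (rule compact_imp_bounded)
  then obtain M where "\<forall>z\<in>(\<lambda>x. ?w x) ` ?B. \<bar>z\<bar> \<le> M" unfolding bounded_real by (elim exE)
  then have M: "\<bar>?w x\<bar> \<le> M" if "x \<in> ?B" for x using that by (simp only: ball_simps)
  have "uniform_limit ?B (\<lambda>n x. \<Sum>i<n. ?t i x) (\<lambda>x. \<Sum>i. ?t i x) sequentially"
  proof (rule Weierstrass_m_test)
    show "norm (?t i x) \<le> M * (norm a ^ i /\<^sub>R fact i)" if "x \<in> ?B" for i x
    proof -
      have "\<bar>sgn x \<bullet> a\<bar> \<le> 1 * norm a"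
        by (rule order_trans[OF Cauchy_Schwarz_ineq2]) (intro mult_right_mono, auto simp: norm_sgn)
      then have "\<bar>sgn x \<bullet> a\<bar> ^ i \<le> norm a ^ i" by (intro power_mono) auto
      then have "\<bar>(sgn x \<bullet> a) ^ i / fact i\<bar> \<le> norm a ^ i / fact i"
        by (simp add: power_abs divide_right_mono)
      moreover have "M \<ge> 0" using M[OF that] by linarith
      ultimately show ?thesis using M[OF that] unfolding real_norm_def abs_mult[of "?w x"]
        by (auto intro!: mult_mono simp: divide_inverse mult.commute)
    qed
    show "summable (\<lambda>i. M * (norm a ^ i /\<^sub>R fact i))"
      by (intro summable_mult summable_exp_generic)
  qed
  moreover have "(\<Sum>i. ?t i x) = ?w x * exp (sgn x \<bullet> a)" for x
    using suminf_mult[OF summable_exp_generic[of "sgn x \<bullet> a"], of "?w x"]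
    by (simp add: exp_def divide_inverse mult.commute)
  ultimately have u: "uniform_limit ?B (\<lambda>n x. \<Sum>i<n. ?t i x) (\<lambda>x. ?w x * exp (sgn x \<bullet> a)) sequentially"
    by simp
  have t_eq: "?t i x = (1 / fact i) * (bump (x \<bullet> x) * (f (sgn x) * (sgn x \<bullet> a) ^ i))" for i x by simp
  have cm: "continuous_on (sphere 0 1) (\<lambda>y. f y * (y \<bullet> a) ^ i)" for i
    by (intro continuous_intros f)
  have ct: "continuous_on UNIV (?t i)" for i
    unfolding t_eq by (rule continuous_on_mult[OF continuous_on_const sphere_integrand_continuous[OF cm]])
  have int_t: "(?t i has_integral 0) ?B" for i
  proof -
    have "((\<lambda>x. bump (x \<bullet> x) * (f (sgn x) * (sgn x \<bullet> a) ^ i)) has_integral 0) test_box"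
      using mom'[of i] integrable_integral[OF sphere_integrand_integrable[OF cm[of i]]]
      unfolding sphere_mean_def by simp
    from has_integral_mult_right[OF this, of "1 / fact i"] show ?thesis unfolding t_eq test_box_def by simp
  qed
  have cs: "continuous_on ?B (\<lambda>x. \<Sum>i<n. ?t i x)" for n
    by (intro continuous_on_sum continuous_on_subset[OF ct] subset_UNIV)
  have "((\<lambda>x. ?w x * exp (sgn x \<bullet> a)) has_integral 0) ?B"
  proof (rule uniform_limit_integral_cbox[OF u cs sequentially_bot])
    fix I J
    assume I: "\<And>n. ((\<lambda>x. \<Sum>i<n. ?t i x) has_integral I n) ?B"
      and J: "((\<lambda>x. ?w x * exp (sgn x \<bullet> a)) has_integral J) ?B" and lim: "I \<longlonglongrightarrow> J"
    have "((\<lambda>x. \<Sum>i<n. ?t i x) has_integral (\<Sum>i<n. 0)) ?B" for n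
      by (rule has_integral_sum[OF _ int_t]) simp
    then have "I n = 0" for n using has_integral_unique[OF I[of n]] by fastforce
    then have "I = (\<lambda>n. 0)" by blast
    then have "J = 0" using lim by (simp add: LIMSEQ_const_iff)
    with J show "((\<lambda>x. ?w x * exp (sgn x \<bullet> a)) has_integral 0) ?B" by simp
  qed
  then show ?thesis by (simp add: sphere_mean_def test_box_def integral_unique mult.assoc)
qed

text \<open>A function with vanishing height moments is orthogonal to all exponentials \<open>exp (y \<bullet> a)\<close>. The set of
  multipliers that preserve this orthogonality is an algebra that contains the exponentials, so it
  approximates the function itself, which is then orthogonal to itself.\<close>

theorem zero_if_height_moments_zero:
  fixes f :: "'a::euclidean_space \<Rightarrow> real"
  assumes f: "continuous_on (sphere 0 1) f"
    and mom: "\<And>e k. norm e = 1 \<Longrightarrow> sphere_mean (\<lambda>y. f y * (y \<bullet> e) ^ k) = 0"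
    and y: "y \<in> sphere 0 1"
  shows "f y = 0"
proof -
  let ?S = "sphere (0 :: 'a) 1"
  define orth where "orth q \<longleftrightarrow> continuous_on ?S q \<and> (\<forall>a. sphere_mean (\<lambda>y. f y * q y * exp (y \<bullet> a)) = 0)" for q
  \<comment> \<open>multipliers that preserve orthogonality form an algebra, although orthogonality itself does not\<close>
  define mult where "mult g \<longleftrightarrow> continuous_on ?S g \<and> (\<forall>q. orth q \<longrightarrow> orth (\<lambda>y. g y * q y))" for g
  have one: "orth (\<lambda>y. 1)"
    unfolding orth_def using exponential_moments_zero[OF f mom] by simp
  have fqe: "continuous_on ?S (\<lambda>y. f y * q y * exp (y \<bullet> a))" if "continuous_on ?S q" for q a
    by (intro continuous_intros f that)
  have mult_exp: "mult (\<lambda>y. exp (y \<bullet> b))" for b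
    unfolding mult_def orth_def
  proof (intro conjI allI impI; (elim conjE)?)
    fix q a assume q: "continuous_on ?S q" "\<forall>a. sphere_mean (\<lambda>y. f y * q y * exp (y \<bullet> a)) = 0"
    have "(\<lambda>y. f y * (exp (y \<bullet> b) * q y) * exp (y \<bullet> a)) = (\<lambda>y. f y * q y * exp (y \<bullet> (a + b)))"
      by (simp add: inner_add_right exp_add fun_eq_iff)
    then show "sphere_mean (\<lambda>y. f y * (exp (y \<bullet> b) * q y) * exp (y \<bullet> a)) = 0" using q(2) by simp
  qed (intro continuous_intros | assumption)+
  have approx: "\<exists>g. mult g \<and> (\<forall>x\<in>?S. \<bar>f x - g x\<bar> < \<epsilon>)" if "\<epsilon> > 0" for \<epsilon>
  proof (rule Stone_Weierstrass_HOL[where P = mult and S = ?S])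
    show "mult (\<lambda>x. c)" for c
      unfolding mult_def orth_def
    proof (intro conjI allI impI; (elim conjE)?)
      fix q a assume q: "continuous_on ?S q" "\<forall>a. sphere_mean (\<lambda>y. f y * q y * exp (y \<bullet> a)) = 0"
      have "(\<lambda>y. f y * (c * q y) * exp (y \<bullet> a)) = (\<lambda>y. c * (f y * q y * exp (y \<bullet> a)))" by (simp add: fun_eq_iff)
      then show "sphere_mean (\<lambda>y. f y * (c * q y) * exp (y \<bullet> a)) = 0" using q(2) by (simp only: sphere_mean_cmult mult_zero_right)
    qed (simp_all add: continuous_on_mult_left)
    show "mult (\<lambda>x. g x + h x)" if "mult g \<and> mult h" for g h
    proof -
      have "orth (\<lambda>y. (g y + h y) * q y)" if q: "orth q" for q
      proof -
        have gq: "orth (\<lambda>y. g y * q y)" "orth (\<lambda>y. h y * q y)" using \<open>mult g \<and> mult h\<close> q by (auto simp: mult_def)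
        have "f y * ((g y + h y) * q y) * exp (y \<bullet> a) = f y * (g y * q y) * exp (y \<bullet> a) + f y * (h y * q y) * exp (y \<bullet> a)" for y a
          by (simp add: algebra_simps)
        then show ?thesis using gq q \<open>mult g \<and> mult h\<close>
          by (auto simp: orth_def mult_def sphere_mean_add fqe intro!: continuous_intros)
      qed
      then show ?thesis using that by (auto simp: mult_def intro!: continuous_intros)
    qed
    show "mult (\<lambda>x. g x * h x)" if "mult g \<and> mult h" for g h
      using that by (auto simp: mult_def mult.assoc intro!: continuous_intros)
    show "\<exists>g. mult g \<and> g x \<noteq> g y" if "x \<in> ?S \<and> y \<in> ?S \<and> x \<noteq> y" for x y
    proof (intro exI conjI)
      show "mult (\<lambda>z. exp (z \<bullet> (x - y)))" by (rule mult_exp)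
      have "(x - y) \<bullet> (x - y) \<noteq> 0" using that by simp
      then show "exp (x \<bullet> (x - y)) \<noteq> exp (y \<bullet> (x - y))" by (simp add: inner_diff_left)
    qed
  qed (use f that in \<open>auto simp: mult_def\<close>)
  have c_abs: "continuous_on ?S (\<lambda>y. \<bar>f y\<bar>)" and c_sq: "continuous_on ?S (\<lambda>y. (f y)\<^sup>2)" by (intro continuous_intros f)+
  have le: "sphere_mean (\<lambda>y. (f y)\<^sup>2) \<le> \<epsilon> * sphere_mean (\<lambda>y. \<bar>f y\<bar>)" if \<epsilon>: "\<epsilon> > 0" for \<epsilon>
  proof -
    obtain g where g: "mult g" "\<And>x. x \<in> ?S \<Longrightarrow> \<bar>f x - g x\<bar> < \<epsilon>" using approx[OF \<epsilon>] by blast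
    have "\<And>q. orth q \<Longrightarrow> orth (\<lambda>y. g y * q y)" using g(1) by (simp add: mult_def)
    from this[OF one] have "orth (\<lambda>y. g y * 1)" .
    then have cg: "continuous_on ?S g" and ge: "\<forall>a. sphere_mean (\<lambda>y. f y * g y * exp (y \<bullet> a)) = 0"
      unfolding orth_def by simp_all
    have fg: "sphere_mean (\<lambda>y. f y * g y) = 0" using ge[rule_format, of 0] by simp
    have c1: "continuous_on ?S (\<lambda>y. f y * g y)" "continuous_on ?S (\<lambda>y. \<epsilon> * \<bar>f y\<bar>)" by (intro continuous_intros f cg)+
    have "sphere_mean (\<lambda>y. (f y)\<^sup>2) \<le> sphere_mean (\<lambda>y. f y * g y + \<epsilon> * \<bar>f y\<bar>)"
    proof (rule sphere_mean_le[OF c_sq])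
      fix y assume y: "y \<in> ?S"
      have "(f y)\<^sup>2 = f y * g y + f y * (f y - g y)" by (simp add: power2_eq_square algebra_simps)
      also have "f y * (f y - g y) \<le> \<bar>f y\<bar> * \<bar>f y - g y\<bar>" by (metis abs_ge_self abs_mult)
      also have "\<dots> \<le> \<bar>f y\<bar> * \<epsilon>" using g(2)[OF y] by (intro mult_left_mono) auto
      finally show "(f y)\<^sup>2 \<le> f y * g y + \<epsilon> * \<bar>f y\<bar>" by (simp add: mult.commute)
    qed (intro continuous_intros c1)
    also have "\<dots> = \<epsilon> * sphere_mean (\<lambda>y. \<bar>f y\<bar>)" by (simp add: sphere_mean_add[OF c1] fg sphere_mean_cmult)
    finally show ?thesis .
  qed
  have nonneg: "0 \<le> sphere_mean (\<lambda>y. (f y)\<^sup>2)" "0 \<le> sphere_mean (\<lambda>y. \<bar>f y\<bar>)"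
    using sphere_mean_le[OF _ c_sq, of "\<lambda>_. 0"] sphere_mean_le[OF _ c_abs, of "\<lambda>_. 0"]
    by (simp_all add: sphere_mean_def)
  have "sphere_mean (\<lambda>y. (f y)\<^sup>2) \<le> 0"
  proof (rule field_le_epsilon)
    fix d :: real assume d: "d > 0"
    let ?A = "sphere_mean (\<lambda>y. \<bar>f y\<bar>)"
    have "d / (?A + 1) * ?A \<le> d" using d nonneg(2) by (simp add: divide_le_eq algebra_simps)
    with le[of "d / (?A + 1)"] d nonneg(2) show "sphere_mean (\<lambda>y. (f y)\<^sup>2) \<le> 0 + d" by simp
  qed
  with nonneg(1) show ?thesis using sphere_mean_square_zero[OF f _ y] by simp
qed

text \<open>Green's identity against a power of a height function. The powers form a triangular system for
  the spherical Laplacian.\<close>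

lemma height_moment_laplacian:
  fixes F :: "'a::euclidean_space \<Rightarrow> real" and e :: 'a
  assumes F: "smooth_on_open (- {0}) F" and hom: "\<And>x s. s > 0 \<Longrightarrow> F (s *\<^sub>R x) = F x" and e: "norm e = 1"
  shows "sphere_mean (\<lambda>y. flat_laplacian F y * (y \<bullet> e) ^ k) =
     real k * (real k - 1) * sphere_mean (\<lambda>y. F y * (y \<bullet> e) ^ (k - 2))
     - real k * (real k + real DIM('a) - 2) * sphere_mean (\<lambda>y. F y * (y \<bullet> e) ^ k)"
proof -
  define h where "h = (\<lambda>x::'a. sgn x \<bullet> e)"
  let ?G = "\<lambda>x. h x ^ k"
  have sG: "smooth_on_open (- {0}) ?G" unfolding h_def by (intro smooth_intros smooth_sgn) auto
  have homG: "?G (s *\<^sub>R x) = ?G x" if "s > 0" for x s using that by (simp add: h_def sgn_scaleR)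
  have g1: "((\<lambda>s. s ^ k) has_real_derivative real k * s ^ (k - 1)) (at s)" for s
    by (auto intro!: derivative_eq_intros)
  have g2: "((\<lambda>s. real k * s ^ (k - 1)) has_real_derivative real k * (real k - 1) * s ^ (k - 2)) (at s)" for s
    by (cases k) (auto intro!: derivative_eq_intros simp: numeral_2_eq_2)
  have lapG: "(x \<bullet> x) * flat_laplacian ?G x = real k * (real k - 1) * h x ^ (k - 2) - real k * (real k + real DIM('a) - 2) * h x ^ k"
    if "x \<noteq> 0" for x
  proof -
    have "(x \<bullet> x) * flat_laplacian ?G x = (1 - (h x)\<^sup>2) * (real k * (real k - 1) * h x ^ (k - 2)) - (real DIM('a) - 1) * h x * (real k * h x ^ (k - 1))"
      using flat_laplacian_ridge[OF e that g1 g2] by (simp add: h_def)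
    also have "\<dots> = real k * (real k - 1) * h x ^ (k - 2) - real k * (real k - 1) * (h x)\<^sup>2 * h x ^ (k - 2)
        - (real DIM('a) - 1) * (real k * (h x * h x ^ (k - 1)))" by (simp add: algebra_simps)
    also have "real k * (real k - 1) * (h x)\<^sup>2 * h x ^ (k - 2) = real k * (real k - 1) * h x ^ k"
    proof -
      consider "k = 0" | "k = 1" | j where "k = Suc (Suc j)" by (metis One_nat_def not0_implies_Suc)
      then show ?thesis by cases (auto simp: power2_eq_square)
    qed
    also have "real k * (h x * h x ^ (k - 1)) = real k * h x ^ k" by (cases k) auto
    finally show ?thesis by (simp add: algebra_simps)
  qed
  have pw: "bump (x \<bullet> x) * (x \<bullet> x) * (F x * flat_laplacian ?G x - ?G x * flat_laplacian F x)
     = real k * (real k - 1) * (bump (x \<bullet> x) * (F (sgn x) * (sgn x \<bullet> e) ^ (k - 2)))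
       - real k * (real k + real DIM('a) - 2) * (bump (x \<bullet> x) * (F (sgn x) * (sgn x \<bullet> e) ^ k))
       - bump (x \<bullet> x) * (flat_laplacian F (sgn x) * (sgn x \<bullet> e) ^ k)" for x
  proof (cases "x = 0")
    case True then show ?thesis by (simp add: bump_zero)
  next
    case False
    have F_sgn: "F (sgn x) = F x" using hom[of "inverse (norm x)" x] False by (simp add: sgn_div_norm)
    have "(x \<bullet> x) * (F x * flat_laplacian ?G x - ?G x * flat_laplacian F x)
      = F x * ((x \<bullet> x) * flat_laplacian ?G x) - ?G x * ((x \<bullet> x) * flat_laplacian F x)" by (simp add: algebra_simps)
    also have "\<dots> = F x * (real k * (real k - 1) * h x ^ (k - 2) - real k * (real k + real DIM('a) - 2) * h x ^ k)
       - h x ^ k * flat_laplacian F (sgn x)"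
      by (simp only: lapG[OF False] flat_laplacian_homogeneous[OF F hom False])
    finally have "(x \<bullet> x) * (F x * flat_laplacian ?G x - ?G x * flat_laplacian F x)
      = real k * (real k - 1) * (F x * h x ^ (k - 2)) - real k * (real k + real DIM('a) - 2) * (F x * h x ^ k)
        - flat_laplacian F (sgn x) * h x ^ k" by (simp add: algebra_simps)
    then show ?thesis unfolding F_sgn mult.assoc[of "bump (x \<bullet> x)"]
      by (simp only: h_def) (simp add: right_diff_distrib mult_ac)
  qed
  have sphere_sub: "sphere 0 1 \<subseteq> - {0 :: 'a}" by auto
  have cF: "continuous_on (sphere 0 1) F" "continuous_on (sphere 0 1) (flat_laplacian F)"
    unfolding flat_laplacian_def[abs_def]
    by (intro continuous_on_subset[OF _ sphere_sub] continuous_intros smooth_continuous_on smooth_frechet_derivative F)+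
  have i1: "(\<lambda>x. bump (x \<bullet> x) * (F (sgn x) * (sgn x \<bullet> e) ^ j)) integrable_on test_box" for j
    by (rule sphere_integrand_integrable[of "\<lambda>y. F y * (y \<bullet> e) ^ j"]) (intro continuous_intros cF)
  have i2: "(\<lambda>x. bump (x \<bullet> x) * (flat_laplacian F (sgn x) * (sgn x \<bullet> e) ^ k)) integrable_on test_box"
    by (rule sphere_integrand_integrable[of "\<lambda>y. flat_laplacian F y * (y \<bullet> e) ^ k"]) (intro continuous_intros cF)
  have "0 = integral test_box (\<lambda>x. bump (x \<bullet> x) * (x \<bullet> x) * (F x * flat_laplacian ?G x - ?G x * flat_laplacian F x))"
    by (rule green_annulus[OF F sG radial_derivative_zero[OF F hom] radial_derivative_zero[OF sG homG], symmetric])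
  also have "\<dots> = real k * (real k - 1) * sphere_mean (\<lambda>y. F y * (y \<bullet> e) ^ (k - 2))
     - real k * (real k + real DIM('a) - 2) * sphere_mean (\<lambda>y. F y * (y \<bullet> e) ^ k)
     - sphere_mean (\<lambda>y. flat_laplacian F y * (y \<bullet> e) ^ k)"
    unfolding pw sphere_mean_def
    by (intro integral_unique has_integral_diff has_integral_mult_right integrable_integral i1 i2)
  finally show ?thesis by simp
qed

section \<open>Immersed submanifolds\<close>

text \<open>On tangent vectors, the chosen derivative within \<open>N\<close> agrees with every other one, because both
  compute the velocity of the image of a curve.\<close>

lemma differential_eq:
  assumes f: "(f has_derivative f') (at p within N)" and v: "v \<in> tangent_space N p"
  shows "differential N f p v = f' v"
proof -
  have D: "(f has_derivative differential N f p) (at p within N)"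
    unfolding differential_def[abs_def] frechet_derivative_works[symmetric]
    using f by (auto simp: differentiable_def)
  obtain \<gamma> :: "real \<Rightarrow> 'a" where \<gamma>: "range \<gamma> \<subseteq> N" "\<gamma> 0 = p" "(\<gamma> has_derivative (\<lambda>h. h *\<^sub>R v)) (at 0)"
    using v unfolding tangent_space_def has_vector_derivative_def by blast
  have "((\<lambda>s. f (\<gamma> s)) has_derivative (\<lambda>h. g' (h *\<^sub>R v))) (at 0)"
    if "(f has_derivative g') (at p within N)" for g'
    by (rule has_derivative_in_compose[OF \<gamma>(3)]) (use that \<gamma> has_derivative_subset in auto)
  from has_derivative_unique[OF this[OF D] this[OF f]]
  have "(\<lambda>h. differential N f p (h *\<^sub>R v)) = (\<lambda>h. f' (h *\<^sub>R v))" .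
  from fun_cong[OF this, of 1] show ?thesis by simp
qed

lemma has_derivative_within_of_eq_on:
  assumes "(g has_derivative g') (at p)" "\<And>q. q \<in> N \<Longrightarrow> f q = g q" "p \<in> N"
  shows "(f has_derivative g') (at p within N)"
  by (rule has_derivative_transform[OF assms(3,2) has_derivative_at_withinI[OF assms(1)]])

text \<open>At a point where the tangent space is a linear subspace and the differential is injective on it, the
  induced metric is an inner product, and the definite descriptions of gradient and connection
  denote.\<close>

locale immersed_point =
  fixes N :: "'a::euclidean_space set" and F :: "'a \<Rightarrow> 'b::euclidean_space" and p :: 'a
    and F' :: "'a \<Rightarrow> 'b"
  assumes p: "p \<in> N" and F: "(F has_derivative F') (at p within N)"
    and T: "subspace (tangent_space N p)"
    and inj: "\<And>v. v \<in> tangent_space N p \<Longrightarrow> F' v = 0 \<Longrightarrow> v = 0"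
begin

lemma linear: "linear F'" using F by (rule has_derivative_linear)

lemma metric: "v \<in> tangent_space N p \<Longrightarrow> w \<in> tangent_space N p \<Longrightarrow> induced_metric N F p v w = F' v \<bullet> F' w"
  by (simp add: induced_metric_def differential_eq[OF F])

text \<open>An orthonormal basis of the image of the tangent space is pulled back.\<close>

lemma orthonormal_frame_exists: "\<exists>B. orthonormal_frame N F p B"
proof -
  let ?T = "tangent_space N p"
  have sub: "subspace (F' ` ?T)" by (rule linear_subspace_image[OF linear T])
  obtain C where C: "C \<subseteq> F' ` ?T" "pairwise orthogonal C" "\<And>x. x \<in> C \<Longrightarrow> norm x = 1"
    "independent C" "span C = F' ` ?T"
    using orthonormal_basis_subspace[OF sub] by metis
  define h where "h c = (SOME v. v \<in> ?T \<and> F' v = c)" for c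
  have h: "h c \<in> ?T" "F' (h c) = c" if "c \<in> C" for c
  proof -
    have "\<exists>v. v \<in> ?T \<and> F' v = c" using C(1) that by auto
    then show "h c \<in> ?T" "F' (h c) = c" unfolding h_def by (rule someI2_ex; simp)+
  qed
  have im: "F' ` h ` C = C" using h(2) by (auto simp: image_image)
  have "span (h ` C) = ?T"
  proof
    show "span (h ` C) \<subseteq> ?T" by (rule span_minimal[OF _ T]) (use h in auto)
    show "?T \<subseteq> span (h ` C)"
    proof
      fix v assume v: "v \<in> ?T"
      then have "F' v \<in> F' ` span (h ` C)" using C(5) linear_span_image[OF linear, of "h ` C"] im by auto
      then obtain u where u: "u \<in> span (h ` C)" "F' u = F' v" by auto
      then have "u \<in> ?T" using \<open>span (h ` C) \<subseteq> ?T\<close> by blast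
      then have "v - u = 0" using inj[of "v - u"] subspace_diff[OF T v] u(2) linear_diff[OF linear] by auto
      then show "v \<in> span (h ` C)" using u(1) by simp
    qed
  qed
  moreover have "induced_metric N F p u v = (if u = v then 1 else 0)" if uv: "u \<in> h ` C" "v \<in> h ` C" for u v
  proof -
    obtain c d where cd: "c \<in> C" "d \<in> C" "u = h c" "v = h d" using uv by blast
    have "c \<bullet> d = (if c = d then 1 else 0)"
      using C(2,3) cd by (auto simp: pairwise_def orthogonal_def norm_eq_1[symmetric])
    moreover have "(c = d) = (u = v)" using cd h(2) by metis
    ultimately show ?thesis using cd h by (simp add: metric)
  qed
  moreover have "finite (h ` C)" using C(4) independent_imp_finite by blast
  ultimately show ?thesis unfolding orthonormal_frame_def by blast
qed

abbreviation "frame \<equiv> some_frame N F p"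

lemma frame: "finite frame" "span frame = tangent_space N p" "frame \<subseteq> tangent_space N p"
  "\<And>u v. u \<in> frame \<Longrightarrow> v \<in> frame \<Longrightarrow> F' u \<bullet> F' v = (if u = v then 1 else 0)"
proof -
  have *: "orthonormal_frame N F p frame"
    unfolding some_frame_def by (rule someI_ex[OF orthonormal_frame_exists])
  then show 1: "finite frame" "span frame = tangent_space N p" by (auto simp: orthonormal_frame_def)
  then show 2: "frame \<subseteq> tangent_space N p" using span_superset by blast
  show "F' u \<bullet> F' v = (if u = v then 1 else 0)" if "u \<in> frame" "v \<in> frame" for u v
    using * that metric[of u v] subsetD[OF 2 that(1)] subsetD[OF 2 that(2)]
    unfolding orthonormal_frame_def by auto
qed

lemma frame_expand: "v \<in> tangent_space N p \<Longrightarrow> F' v = (\<Sum>b\<in>frame. (F' v \<bullet> F' b) *\<^sub>R F' b)"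
  unfolding frame(2)[symmetric]
proof (induction v rule: span_induct_alt)
  case base then show ?case by (simp add: linear_0[OF linear])
next
  case (step c x y)
  have "(\<Sum>b\<in>frame. (F' x \<bullet> F' b) *\<^sub>R F' b) = (\<Sum>b\<in>frame. if b = x then F' x else 0)"
    by (rule sum.cong) (use frame(4)[OF step(1)] in auto)
  also have "\<dots> = F' x" using frame(1) step(1) by simp
  finally have "F' x = (\<Sum>b\<in>frame. (F' x \<bullet> F' b) *\<^sub>R F' b)" ..
  then have "F' (c *\<^sub>R x + y) = c *\<^sub>R (\<Sum>b\<in>frame. (F' x \<bullet> F' b) *\<^sub>R F' b) + (\<Sum>b\<in>frame. (F' y \<bullet> F' b) *\<^sub>R F' b)"
    using step(2) by (simp add: linear_add[OF linear] linear_cmul[OF linear])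
  also have "\<dots> = (\<Sum>b\<in>frame. (F' (c *\<^sub>R x + y) \<bullet> F' b) *\<^sub>R F' b)"
    by (simp add: linear_add[OF linear] linear_cmul[OF linear] inner_add_left scaleR_left_distrib sum.distrib scaleR_sum_right)
  finally show ?case .
qed

lemma metric_determines:
  assumes "v \<in> tangent_space N p" "w \<in> tangent_space N p"
    and "\<And>u. u \<in> tangent_space N p \<Longrightarrow> F' v \<bullet> F' u = F' w \<bullet> F' u"
  shows "v = w"
proof -
  have "F' (v - w) \<bullet> F' (v - w) = 0"
    using assms(3)[OF subspace_diff[OF T assms(1,2)]] by (simp add: linear_diff[OF linear] inner_diff_left)
  then show ?thesis using inj[OF subspace_diff[OF T assms(1,2)]] by simp
qed

lemma gradient_eqI:
  assumes f: "(f has_derivative f') (at p within N)" and w: "w \<in> tangent_space N p"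
    and eq: "\<And>v. v \<in> tangent_space N p \<Longrightarrow> F' w \<bullet> F' v = f' v"
  shows "gradient N F f p = w"
  unfolding gradient_def
proof (rule the_equality)
  show "w \<in> tangent_space N p \<and> (\<forall>v\<in>tangent_space N p. induced_metric N F p w v = differential N f p v)"
    using w eq by (simp add: metric differential_eq[OF f])
  fix u assume u: "u \<in> tangent_space N p \<and> (\<forall>v\<in>tangent_space N p. induced_metric N F p u v = differential N f p v)"
  then show "u = w" using w eq
    by (intro metric_determines) (auto simp: metric differential_eq[OF f])
qed

text \<open>The Levi-Civita connection projects the derivative of the pushed-forward field onto the tangent
  space, and the projection is invisible to the trace.\<close>

lemma divergence_eq:
  assumes V: "((\<lambda>q. differential N F q (X q)) has_derivative V') (at p within N)"
  shows "divergence N F X p = (\<Sum>e\<in>frame. V' e \<bullet> F' e)"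
  unfolding divergence_def
proof (rule sum.cong[OF refl])
  fix e assume e: "e \<in> frame"
  then have eT: "e \<in> tangent_space N p" using frame(3) by blast
  let ?P = "\<lambda>w. w \<in> tangent_space N p \<and> (\<forall>u\<in>tangent_space N p. induced_metric N F p w u =
           differential N (\<lambda>q. differential N F q (X q)) p e \<bullet> differential N F p u)"
  \<comment> \<open>the orthogonal projection onto the tangent space\<close>
  define w where "w = (\<Sum>b\<in>frame. (V' e \<bullet> F' b) *\<^sub>R b)"
  have wT: "w \<in> tangent_space N p"
    unfolding w_def using frame(3) by (intro subspace_sum[OF T] subspace_scale[OF T]) auto
  have w: "F' w \<bullet> F' u = V' e \<bullet> F' u" if "u \<in> tangent_space N p" for u
  proof -
    have "F' w \<bullet> F' u = V' e \<bullet> (\<Sum>b\<in>frame. (F' u \<bullet> F' b) *\<^sub>R F' b)"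
      unfolding w_def
      by (simp add: linear_sum[OF linear] linear_cmul[OF linear] inner_sum_left inner_sum_right inner_commute mult.commute)
    then show ?thesis using frame_expand[OF that] by simp
  qed
  have Pw: "?P w"
    using w wT eT by (simp add: metric differential_eq[OF V] differential_eq[OF F])
  moreover have "u = w" if "?P u" for u
    using that w wT eT by (intro metric_determines) (auto simp: metric differential_eq[OF V] differential_eq[OF F])
  ultimately have "covariant_derivative N F X p e = w"
    unfolding covariant_derivative_def by (rule the_equality)
  then show "induced_metric N F p (covariant_derivative N F X p e) e = V' e \<bullet> F' e"
    using w[OF eT] wT eT by (simp add: metric)
qed

end

section \<open>Traces in orthonormal bases\<close>

definition orthonormal_basis :: "'a::euclidean_space set \<Rightarrow> bool" where
  "orthonormal_basis U \<longleftrightarrow> finite U \<and> span U = UNIV \<and> (\<forall>u\<in>U. \<forall>v\<in>U. u \<bullet> v = (if u = v then 1 else 0))"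

lemma orthonormal_basis_expand:
  assumes "orthonormal_basis U"
  shows "x = (\<Sum>u\<in>U. (x \<bullet> u) *\<^sub>R u)"
proof -
  have U: "finite U" "\<And>u v. u \<in> U \<Longrightarrow> v \<in> U \<Longrightarrow> u \<bullet> v = (if u = v then 1 else 0)"
    using assms by (auto simp: orthonormal_basis_def)
  have "x \<in> span U" using assms by (simp add: orthonormal_basis_def)
  then show ?thesis
  proof (induction x rule: span_induct_alt)
    case base then show ?case by simp
  next
    case (step c x y)
    have "(\<Sum>u\<in>U. (x \<bullet> u) *\<^sub>R u) = (\<Sum>u\<in>U. if u = x then x else 0)"
      by (rule sum.cong) (use U(2)[OF step(1)] in auto)
    then have "x = (\<Sum>u\<in>U. (x \<bullet> u) *\<^sub>R u)" using U(1) step(1) by simp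
    then have "c *\<^sub>R x + y = c *\<^sub>R (\<Sum>u\<in>U. (x \<bullet> u) *\<^sub>R u) + (\<Sum>u\<in>U. (y \<bullet> u) *\<^sub>R u)" using step(2) by simp
    also have "\<dots> = (\<Sum>u\<in>U. ((c *\<^sub>R x + y) \<bullet> u) *\<^sub>R u)"
      by (simp add: inner_add_left scaleR_left_distrib sum.distrib scaleR_sum_right)
    finally show ?case .
  qed
qed

lemma orthonormal_basis_parseval:
  assumes "orthonormal_basis U"
  shows "x \<bullet> y = (\<Sum>u\<in>U. (x \<bullet> u) * (y \<bullet> u))"
proof -
  have "x \<bullet> y = (\<Sum>u\<in>U. (x \<bullet> u) *\<^sub>R u) \<bullet> y" by (simp only: orthonormal_basis_expand[OF assms, symmetric])
  also have "\<dots> = (\<Sum>u\<in>U. (x \<bullet> u) * (y \<bullet> u))"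
    unfolding inner_sum_left inner_scaleR_left by (intro sum.cong refl) (simp add: inner_commute)
  finally show ?thesis .
qed

lemma trace_orthonormal_basis:
  fixes L :: "'a::euclidean_space \<Rightarrow> 'a"
  assumes U: "orthonormal_basis U" and L: "linear L"
  shows "(\<Sum>u\<in>U. L u \<bullet> u) = (\<Sum>b\<in>Basis. L b \<bullet> b)"
proof -
  have "(\<Sum>b\<in>Basis. L b \<bullet> b) = (\<Sum>b\<in>Basis. L (\<Sum>u\<in>U. (b \<bullet> u) *\<^sub>R u) \<bullet> b)"
    by (simp only: orthonormal_basis_expand[OF U, symmetric])
  also have "\<dots> = (\<Sum>b\<in>Basis. \<Sum>u\<in>U. (u \<bullet> b) * (L u \<bullet> b))"
    unfolding linear_sum[OF L] linear_cmul[OF L] inner_sum_left inner_scaleR_left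
    by (intro sum.cong refl) (simp add: inner_commute)
  also have "\<dots> = (\<Sum>u\<in>U. \<Sum>b\<in>Basis. (u \<bullet> b) * (L u \<bullet> b))" by (rule sum.swap)
  also have "\<dots> = (\<Sum>u\<in>U. L u \<bullet> u)"
    by (intro sum.cong refl, subst inner_commute, rule euclidean_inner[symmetric])
  finally show ?thesis ..
qed

section \<open>The round sphere\<close>

lemma norm_great_circle:
  fixes y v :: "'a::real_inner"
  assumes "norm y = 1" "v \<bullet> y = 0"
  shows "norm (cos (norm v * s) *\<^sub>R y + sin (norm v * s) *\<^sub>R sgn v) = 1"
proof -
  have yy: "y \<bullet> y = 1" using assms by (simp add: norm_eq_1)
  have yv: "y \<bullet> sgn v = 0" using assms by (simp add: sgn_div_norm inner_commute)
  have "(cos (norm v * s) *\<^sub>R y + sin (norm v * s) *\<^sub>R sgn v) \<bullet> (cos (norm v * s) *\<^sub>R y + sin (norm v * s) *\<^sub>R sgn v)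
     = (cos (norm v * s))\<^sup>2 + (sin (norm v * s))\<^sup>2 * (sgn v \<bullet> sgn v)"
    by (simp add: inner_add_left inner_add_right yy yv inner_commute[of "sgn v" y] power2_eq_square)
  also have "\<dots> = 1"
  proof (cases "v = 0")
    case False
    then have "sgn v \<bullet> sgn v = 1" by (simp add: norm_eq_1[symmetric] norm_sgn)
    then show ?thesis by simp
  qed simp
  finally show ?thesis by (simp add: norm_eq_1)
qed

lemma great_circle_derivative:
  fixes y v :: "'a::real_inner"
  shows "((\<lambda>s. cos (norm v * s) *\<^sub>R y + sin (norm v * s) *\<^sub>R sgn v) has_vector_derivative v) (at 0)"
  unfolding has_vector_derivative_def
  by (auto intro!: derivative_eq_intros simp: fun_eq_iff sgn_div_norm)

lemma curve_on_sphere_velocity: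
  fixes \<gamma> :: "real \<Rightarrow> 'a::real_inner"
  assumes "\<And>s. norm (\<gamma> s) = 1" "(\<gamma> has_vector_derivative v) (at 0)"
  shows "v \<bullet> \<gamma> 0 = 0"
proof -
  have "((\<lambda>s. \<gamma> s \<bullet> \<gamma> s) has_derivative (\<lambda>h. \<gamma> 0 \<bullet> (h *\<^sub>R v) + (h *\<^sub>R v) \<bullet> \<gamma> 0)) (at 0)"
    using assms(2) unfolding has_vector_derivative_def by (intro has_derivative_inner)
  moreover have "\<gamma> s \<bullet> \<gamma> s = 1" for s using assms(1)[of s] by (simp add: norm_eq_1)
  ultimately have "((\<lambda>s::real. 1::real) has_derivative (\<lambda>h. \<gamma> 0 \<bullet> (h *\<^sub>R v) + (h *\<^sub>R v) \<bullet> \<gamma> 0)) (at 0)" by simp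
  from has_derivative_unique[OF this has_derivative_const] have "(\<lambda>h. \<gamma> 0 \<bullet> (h *\<^sub>R v) + (h *\<^sub>R v) \<bullet> \<gamma> 0) = (\<lambda>h. 0)" .
  from fun_cong[OF this, of 1] show ?thesis by (simp add: inner_commute)
qed

lemma tangent_space_sphere:
  assumes y: "y \<in> (unit_sphere :: (real^'n) set)"
  shows "tangent_space unit_sphere y = {v. v \<bullet> y = 0}"
proof (intro set_eqI iffI)
  fix v assume "v \<in> tangent_space unit_sphere y"
  then show "v \<in> {v. v \<bullet> y = 0}"
    unfolding tangent_space_def unit_sphere_def using curve_on_sphere_velocity by fastforce
next
  fix v assume "v \<in> {v. v \<bullet> y = 0}"
  then show "v \<in> tangent_space unit_sphere y"
    unfolding tangent_space_def using y great_circle_derivative[of v y] norm_great_circle[of y v]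
    by (auto simp: unit_sphere_def intro!: exI[of _ "\<lambda>s. cos (norm v * s) *\<^sub>R y + sin (norm v * s) *\<^sub>R sgn v"] smooth_intros)
qed

text \<open>Composition with a retraction onto \<open>N\<close> replaces the local extensions of \<open>f\<close> by a single one.\<close>

lemma smooth_along_extension:
  assumes f: "smooth_along N f" and W: "open W" and \<rho>: "smooth_on_open W \<rho>" "\<rho> ` W \<subseteq> N"
  shows "smooth_on_open W (\<lambda>x. f (\<rho> x))"
proof (rule smooth_local)
  fix x assume x: "x \<in> W"
  then have "\<rho> x \<in> N" using \<rho>(2) by blast
  then obtain U g where U: "open U" "\<rho> x \<in> U" "smooth_on_open U g" "\<forall>q\<in>N \<inter> U. g q = f q"
    using f unfolding smooth_along_def by blast
  have W': "open (W \<inter> \<rho> -` U)"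
    by (rule continuous_open_preimage[OF smooth_continuous_on[OF \<rho>(1)] W U(1)])
  have "smooth_on_open (W \<inter> \<rho> -` U) (\<lambda>x. g (\<rho> x))"
    by (rule smooth_compose[OF W' U(1) _ smooth_subset[OF \<rho>(1)] U(3)]) auto
  then have "smooth_on_open (W \<inter> \<rho> -` U) (\<lambda>x. f (\<rho> x))"
    by (rule smooth_cong[OF W', rotated]) (use U(4) \<rho>(2) in auto)
  then show "\<exists>U. open U \<and> x \<in> U \<and> smooth_on_open U (\<lambda>x. f (\<rho> x))" using W' x U(2) by blast
qed

text \<open>First derivatives are homogeneous of degree \<open>- 1\<close> (Euler's relation); this is why the radial direction
  does not contribute to the trace of the Hessian.\<close>

lemma radial_derivative_dir_deriv:
  fixes F :: "'a::euclidean_space \<Rightarrow> real"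
  assumes F: "smooth_on_open (- {0}) F" and hom: "\<And>x s. s > 0 \<Longrightarrow> F (s *\<^sub>R x) = F x" and x: "x \<noteq> 0"
  shows "dir_deriv (dir_deriv F v) x x = - dir_deriv F v x"
proof -
  have "((\<lambda>s. s * dir_deriv F v (s *\<^sub>R x)) has_derivative (\<lambda>h. 1 * dir_deriv (dir_deriv F v) (h *\<^sub>R x) (1 *\<^sub>R x) + h * dir_deriv F v (1 *\<^sub>R x))) (at 1)"
    by (intro has_derivative_mult has_derivative_ident
        has_derivative_compose[OF _ smooth_has_derivative[OF smooth_frechet_derivative[OF F]], where f = "\<lambda>s. s *\<^sub>R x"])
      (use x in \<open>auto intro!: derivative_eq_intros\<close>)
  moreover have "((\<lambda>s. s * dir_deriv F v (s *\<^sub>R x)) has_derivative (\<lambda>h. 0)) (at 1)"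
    by (rule has_derivative_transform_within_open[of "\<lambda>_. dir_deriv F v x" _ _ _ "{0<..}"])
      (use dir_deriv_homogeneous[OF F, of "\<lambda>_. 1"] hom x in auto)
  ultimately have "(\<lambda>h. 1 * dir_deriv (dir_deriv F v) (h *\<^sub>R x) (1 *\<^sub>R x) + h * dir_deriv F v (1 *\<^sub>R x)) = (\<lambda>h. 0)"
    by (rule has_derivative_unique)
  from fun_cong[OF this, of 1] show ?thesis by simp
qed

text \<open>The Laplacian of the round sphere is the flat Laplacian of the extension that is constant on rays.\<close>

theorem laplacian_sphere:
  fixes f :: "real^'n \<Rightarrow> real"
  assumes f: "smooth_along unit_sphere f" and y: "y \<in> unit_sphere"
  shows "laplacian unit_sphere (\<lambda>y. y) f y = flat_laplacian (\<lambda>x. f (sgn x)) y"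
proof -
  let ?S = "unit_sphere :: (real^'n) set"
  define F where "F = (\<lambda>x. f (sgn x))"
  have Fs: "smooth_on_open (- {0}) F"
    unfolding F_def
  proof (rule smooth_along_extension[OF f _ smooth_sgn])
    show "sgn ` (- {0}) \<subseteq> ?S" unfolding unit_sphere_def using sgn_in_sphere by blast
  qed auto
  have hom: "F (s *\<^sub>R x) = F x" if "s > 0" for x s using that by (simp add: F_def sgn_scaleR)
  have nz: "q \<in> - {0}" if "q \<in> ?S" for q using that by (auto simp: unit_sphere_def)
  have dF: "(F has_derivative frechet_derivative F (at q)) (at q)" if "q \<in> ?S" for q
    by (rule smooth_has_derivative[OF Fs nz[OF that]])
  have fF: "f q = F q" if "q \<in> ?S" for q using that by (simp add: F_def unit_sphere_def sgn_div_norm)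
  have df: "(f has_derivative frechet_derivative F (at q)) (at q within ?S)" if "q \<in> ?S" for q
    by (rule has_derivative_within_of_eq_on[OF dF[OF that] fF that])
  have imm: "immersed_point ?S (\<lambda>y. y) q (\<lambda>v. v)" if "q \<in> ?S" for q
    by unfold_locales (use that in \<open>auto simp: tangent_space_sphere subspace_hyperplane2 inner_commute\<close>)
  define G where "G = (\<lambda>x. \<Sum>b\<in>Basis. dir_deriv F b x *\<^sub>R b)"
  have G_inner: "G q \<bullet> v = frechet_derivative F (at q) v" if "q \<in> ?S" for q v
    using linear_eq_sum_Basis[OF has_derivative_linear[OF dF[OF that]], of v]
    unfolding G_def inner_sum_left inner_scaleR_left by (simp add: inner_commute mult.commute)
  have grad: "gradient ?S (\<lambda>y. y) f q = G q" if q: "q \<in> ?S" for q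
  proof (rule immersed_point.gradient_eqI[OF imm[OF q] df[OF q]])
    show "G q \<in> tangent_space ?S q"
      using G_inner[OF q, of q] radial_derivative_zero[OF Fs hom, of q] nz[OF q] by (simp add: tangent_space_sphere[OF q])
  qed (use G_inner[OF q] in auto)
  define G' where "G' = (\<lambda>v. \<Sum>b\<in>Basis. dir_deriv (dir_deriv F b) v y *\<^sub>R b)"
  have dG: "(G has_derivative G') (at y)"
    unfolding G_def G'_def
    by (intro has_derivative_sum has_derivative_scaleR_left smooth_has_derivative[OF smooth_frechet_derivative[OF Fs]] nz y)
  have field_eq: "differential ?S (\<lambda>y. y) q (gradient ?S (\<lambda>y. y) f q) = G q" if q: "q \<in> ?S" for q
  proof -
    have "G q \<in> tangent_space ?S q"
      using G_inner[OF q, of q] radial_derivative_zero[OF Fs hom, of q] nz[OF q] by (simp add: tangent_space_sphere[OF q])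
    then show ?thesis unfolding grad[OF q] by (rule differential_eq[OF has_derivative_ident])
  qed
  interpret immersed_point ?S "\<lambda>y. y" y "\<lambda>v. v" by (rule imm[OF y])
  have div: "laplacian ?S (\<lambda>y. y) f y = (\<Sum>e\<in>frame. G' e \<bullet> e)"
    unfolding laplacian_def
    by (rule divergence_eq[OF has_derivative_within_of_eq_on[OF dG field_eq y]])
  have yy: "y \<bullet> y = 1" using y by (simp add: unit_sphere_def norm_eq_1)
  have tangent: "e \<bullet> y = 0" if "e \<in> frame" for e using frame(3) that tangent_space_sphere[OF y] by auto
  have y_notin: "y \<notin> frame" using tangent[of y] yy by auto
  have "orthonormal_basis (insert y frame)"
    unfolding orthonormal_basis_def
  proof (intro conjI ballI)
    show "u \<bullet> v = (if u = v then 1 else 0)" if "u \<in> insert y frame" "v \<in> insert y frame" for u v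
      using that frame(4) tangent yy by (auto simp: inner_commute)
    have "x \<in> span (insert y frame)" for x
    proof -
      have "x - (x \<bullet> y) *\<^sub>R y \<in> span frame"
        unfolding frame(2) tangent_space_sphere[OF y] by (simp add: inner_diff_left yy)
      then have "x - (x \<bullet> y) *\<^sub>R y \<in> span (insert y frame)" by (meson span_mono subset_insertI subsetD)
      then show ?thesis by (metis diff_add_cancel insertI1 span_add span_base span_scale)
    qed
    then show "span (insert y frame) = UNIV" by blast
  qed (use frame(1) in simp)
  from trace_orthonormal_basis[OF this has_derivative_linear[OF dG]]
  have "G' y \<bullet> y + (\<Sum>e\<in>frame. G' e \<bullet> e) = (\<Sum>b\<in>Basis. G' b \<bullet> b)"
    using frame(1) y_notin by simp
  moreover have "G' y \<bullet> y = 0"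
  proof -
    have "G' y = - G y"
      using radial_derivative_dir_deriv[OF Fs hom] nz[OF y] by (simp add: G'_def G_def sum_negf)
    then show ?thesis using G_inner[OF y, of y] radial_derivative_zero[OF Fs hom, of y] nz[OF y] by simp
  qed
  moreover have "(\<Sum>b\<in>Basis. G' b \<bullet> b) = flat_laplacian F y"
    by (simp add: G'_def flat_laplacian_def inner_sum_left inner_Basis if_distrib cong: if_cong)
  ultimately show ?thesis using div by (simp add: F_def)
qed

section \<open>Rotational immersions\<close>

lemma tangent_space_cylinder:
  assumes y: "y \<in> (unit_sphere :: (real^'n) set)"
  shows "tangent_space cylinder (y, t) = {(v, s). v \<bullet> y = 0}"
proof (intro set_eqI iffI)
  fix w :: "(real^'n) \<times> real" assume "w \<in> tangent_space cylinder (y, t)"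
  then obtain \<gamma> :: "real \<Rightarrow> (real^'n) \<times> real" where \<gamma>: "range \<gamma> \<subseteq> cylinder" "\<gamma> 0 = (y, t)" "(\<gamma> has_vector_derivative w) (at 0)"
    unfolding tangent_space_def by blast
  have n: "norm (fst (\<gamma> s)) = 1" for s
  proof -
    have "\<gamma> s \<in> cylinder" using \<gamma>(1) by blast
    then show ?thesis by (auto simp: cylinder_def unit_sphere_def)
  qed
  have "fst w \<bullet> fst (\<gamma> 0) = 0"
    by (rule curve_on_sphere_velocity[OF n bounded_linear.has_vector_derivative[OF bounded_linear_fst \<gamma>(3)]])
  then show "w \<in> {(v, s). v \<bullet> y = 0}" using \<gamma>(2) by (simp add: case_prod_beta)
next
  fix w :: "(real^'n) \<times> real" assume "w \<in> {(v, s). v \<bullet> y = 0}"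
  then obtain v :: "real^'n" and a :: real where w: "w = (v, a)" "v \<bullet> y = 0" by blast
  let ?\<gamma> = "\<lambda>s. (cos (norm v * s) *\<^sub>R y + sin (norm v * s) *\<^sub>R sgn v, t + s * a)"
  have "smooth_on_open UNIV ?\<gamma>" by (intro smooth_intros open_UNIV)
  moreover have "range ?\<gamma> \<subseteq> cylinder"
    using norm_great_circle[of y v] y w(2) by (auto simp: cylinder_def unit_sphere_def)
  moreover have "?\<gamma> 0 = (y, t)" by simp
  moreover have "(?\<gamma> has_vector_derivative w) (at 0)"
    unfolding w(1) by (intro has_vector_derivative_Pair great_circle_derivative)
      (auto intro!: derivative_eq_intros simp: has_real_derivative_iff_has_vector_derivative[symmetric])
  ultimately show "w \<in> tangent_space cylinder (y, t)" unfolding tangent_space_def by blast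
qed

text \<open>A rotational hypersurface with profile curve \<open>(r, \<gamma>)\<close> parametrized by arc length.\<close>

locale rotational_immersion =
  fixes r :: "real \<Rightarrow> real" and \<gamma> :: "real \<Rightarrow> real \<times> real" and r' r'' :: "real \<Rightarrow> real" and \<gamma>' \<gamma>'' :: "real \<Rightarrow> real \<times> real"
    and Psi :: "(real^'n) \<times> real \<Rightarrow> (real^'n) \<times> real \<times> real"
  assumes r_pos: "\<And>t. r t > 0"
    and r': "\<And>t. (r has_real_derivative r' t) (at t)" and r'': "\<And>t. (r' has_real_derivative r'' t) (at t)"
    and \<gamma>': "\<And>t. (\<gamma> has_vector_derivative \<gamma>' t) (at t)" and \<gamma>'': "\<And>t. (\<gamma>' has_vector_derivative \<gamma>'' t) (at t)"
    and arc_length: "\<And>t. (r' t)\<^sup>2 + \<gamma>' t \<bullet> \<gamma>' t = 1"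
    and Psi: "Psi = (\<lambda>(x, t). (r t *\<^sub>R x, \<gamma> t))"
begin

definition Psi' :: "(real^'n) \<times> real \<Rightarrow> (real^'n) \<times> real \<Rightarrow> (real^'n) \<times> real \<times> real" where
  "Psi' p = (\<lambda>(v, s). (r (snd p) *\<^sub>R v + (s * r' (snd p)) *\<^sub>R fst p, s *\<^sub>R \<gamma>' (snd p)))"

lemma r'_deriv: "(r has_derivative (\<lambda>h. h * r' t)) (at t)" "(r' has_derivative (\<lambda>h. h * r'' t)) (at t)"
  "(\<gamma> has_derivative (\<lambda>h. h *\<^sub>R \<gamma>' t)) (at t)" "(\<gamma>' has_derivative (\<lambda>h. h *\<^sub>R \<gamma>'' t)) (at t)"
  using r'[of t] r''[of t] \<gamma>'[of t] \<gamma>''[of t]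
  unfolding has_real_derivative_iff_has_vector_derivative has_vector_derivative_def by simp_all

lemma along_snd:
  "(f has_derivative f') (at (snd p)) \<Longrightarrow> ((\<lambda>q. f (snd q)) has_derivative (\<lambda>w. f' (snd w))) (at p)"
  by (rule has_derivative_compose[OF has_derivative_snd[OF has_derivative_ident]])

lemma Psi_deriv: "(Psi has_derivative Psi' p) (at p)"
proof -
  have "((\<lambda>q. (r (snd q) *\<^sub>R fst q, \<gamma> (snd q))) has_derivative
     (\<lambda>w. (r (snd p) *\<^sub>R fst w + (snd w * r' (snd p)) *\<^sub>R fst p, snd w *\<^sub>R \<gamma>' (snd p)))) (at p)"
    by (intro has_derivative_Pair has_derivative_scaleR along_snd r'_deriv has_derivative_fst has_derivative_ident)
  then show ?thesis by (simp add: Psi Psi'_def case_prod_beta[abs_def])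
qed

lemma arc_length_deriv: "r' t * r'' t + \<gamma>' t \<bullet> \<gamma>'' t = 0"
proof -
  have "((\<lambda>t. (r' t)\<^sup>2 + \<gamma>' t \<bullet> \<gamma>' t) has_derivative (\<lambda>h. 2 * (h * r'' t) * r' t + (\<gamma>' t \<bullet> (h *\<^sub>R \<gamma>'' t) + (h *\<^sub>R \<gamma>'' t) \<bullet> \<gamma>' t))) (at t)"
    by (rule derivative_eq_intros r'_deriv refl | simp)+
  then have "((\<lambda>t. 1::real) has_derivative (\<lambda>h. 2 * (h * r'' t) * r' t + (\<gamma>' t \<bullet> (h *\<^sub>R \<gamma>'' t) + (h *\<^sub>R \<gamma>'' t) \<bullet> \<gamma>' t))) (at t)"
    by (simp add: arc_length)
  from fun_cong[OF has_derivative_unique[OF this has_derivative_const], of 1]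
  show ?thesis by (simp add: inner_commute algebra_simps)
qed

lemma Psi'_inner:
  assumes "x \<bullet> x = 1" "v \<bullet> x = 0" "w \<bullet> x = 0"
  shows "Psi' (x, t) (v, s) \<bullet> Psi' (x, t) (w, u) = (r t)\<^sup>2 * (v \<bullet> w) + s * u"
proof -
  have "Psi' (x, t) (v, s) \<bullet> Psi' (x, t) (w, u) = (r t)\<^sup>2 * (v \<bullet> w) + s * u * ((r' t)\<^sup>2 + \<gamma>' t \<bullet> \<gamma>' t)"
  proof -
    have x: "x \<bullet> v = 0" "x \<bullet> w = 0" using assms by (simp_all add: inner_commute)
    show ?thesis unfolding Psi'_def
      by (simp add: inner_add_left inner_add_right assms x) (simp add: power2_eq_square algebra_simps)
  qed
  then show ?thesis by (simp add: arc_length)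
qed

lemma immersed_point: "p \<in> cylinder \<Longrightarrow> immersed_point cylinder Psi p (Psi' p)"
proof -
  assume p: "p \<in> cylinder"
  obtain x t where xt: "p = (x, t)" by (cases p)
  have x: "x \<in> unit_sphere" "x \<bullet> x = 1" using p by (auto simp: xt cylinder_def unit_sphere_def norm_eq_1)
  note T = tangent_space_cylinder[OF x(1), of t]
  show ?thesis
  proof
    show "subspace (tangent_space cylinder p)"
      unfolding xt T by (auto simp: subspace_def inner_add_left zero_prod_def)
    show "v = 0" if v: "v \<in> tangent_space cylinder p" "Psi' p v = 0" for v
    proof -
      obtain w s where ws: "v = (w, s)" "w \<bullet> x = 0" using v(1) unfolding xt T by blast
      have "(r t)\<^sup>2 * (w \<bullet> w) + s * s = 0"
        using Psi'_inner[OF x(2) ws(2) ws(2), of t s s] v(2) by (simp add: xt ws)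
      moreover have "(r t)\<^sup>2 * (w \<bullet> w) \<ge> 0" "s * s \<ge> 0" by auto
      ultimately have "(r t)\<^sup>2 * (w \<bullet> w) = 0" "s * s = 0" by linarith+
      then show ?thesis using r_pos[of t] by (simp add: ws zero_prod_def)
    qed
    show "(Psi has_derivative Psi' p) (at p within cylinder)" by (rule has_derivative_at_withinI[OF Psi_deriv])
  qed (rule p)
qed

text \<open>In the coordinates \<open>(r v, s)\<close> a frame of the hypersurface is orthonormal in the Euclidean sense,
  and the position vector completes it to a basis.\<close>

definition frame_coords :: "real \<Rightarrow> (real^'n) \<times> real \<Rightarrow> (real^'n) \<times> real" where
  "frame_coords t = (\<lambda>(v, s). (r t *\<^sub>R v, s))"

lemma frame_basis:
  fixes x :: "real^'n" and t :: real
  assumes x: "x \<in> unit_sphere"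
  defines "B \<equiv> some_frame cylinder Psi (x, t)"
  shows "orthonormal_basis (insert (x, 0) (frame_coords t ` B))" "(x, 0) \<notin> frame_coords t ` B"
    "inj_on (frame_coords t) B" "finite B" "\<And>v s. (v, s) \<in> B \<Longrightarrow> v \<bullet> x = 0"
proof -
  have xx: "x \<bullet> x = 1" using x by (simp add: unit_sphere_def norm_eq_1)
  interpret immersed_point cylinder Psi "(x, t)" "Psi' (x, t)"
    by (rule immersed_point) (use x in \<open>simp add: cylinder_def\<close>)
  let ?J = "frame_coords t"
  note T = tangent_space_cylinder[OF x, of t]
  note fr = frame[folded B_def]
  show B: "v \<bullet> x = 0" if "(v, s) \<in> B" for v s using fr(3) that unfolding T by blast
  show fin: "finite B" by (rule fr(1))
  have J_inner: "?J a \<bullet> ?J b = (if a = b then 1 else 0)" if ab: "a \<in> B" "b \<in> B" for a b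
  proof -
    obtain v s w u where ab_eq: "a = (v, s)" "b = (w, u)" by fastforce
    have "?J a \<bullet> ?J b = Psi' (x, t) a \<bullet> Psi' (x, t) b"
      using Psi'_inner[OF xx, of v w t s u] B ab unfolding ab_eq
      by (simp add: frame_coords_def inner_prod_def power2_eq_square)
    then show ?thesis using fr(4)[OF ab] by simp
  qed
  show inj: "inj_on ?J B"
  proof (rule inj_onI, rule ccontr)
    fix a b assume "a \<in> B" "b \<in> B" "?J a = ?J b" "a \<noteq> b"
    then show False using J_inner[of a b] J_inner[of a a] by simp
  qed
  have x_J: "(x, 0) \<bullet> ?J a = 0" if "a \<in> B" for a
    using B that by (cases a) (auto simp: frame_coords_def inner_prod_def inner_commute)
  show nin: "(x, 0) \<notin> ?J ` B"
  proof
    assume "(x, 0) \<in> ?J ` B"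
    then have "(x, 0) \<bullet> (x, 0 :: real) = 0" using x_J by force
    then show False by (simp add: inner_prod_def xx)
  qed
  have lin: "linear ?J" by (rule linearI) (auto simp: frame_coords_def algebra_simps)
  have "z \<in> span (insert (x, 0) (?J ` B))" for z
  proof -
    obtain w s where z: "z = (w, s)" by (cases z)
    let ?w = "w - (w \<bullet> x) *\<^sub>R x"
    have "((1 / r t) *\<^sub>R ?w, s) \<in> span B" unfolding fr(2) T by (simp add: inner_diff_left xx)
    then have "?J ((1 / r t) *\<^sub>R ?w, s) \<in> span (?J ` B)" using linear_span_image[OF lin] by blast
    moreover have "?J ((1 / r t) *\<^sub>R ?w, s) = (?w, s)" using r_pos[of t] by (simp add: frame_coords_def)
    ultimately have "(?w, s) \<in> span (insert (x, 0) (?J ` B))" by (metis span_mono subset_insertI subsetD)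
    moreover have "(w \<bullet> x) *\<^sub>R (x, 0 :: real) \<in> span (insert (x, 0) (?J ` B))" by (intro span_scale span_base) simp
    ultimately have "(?w, s) + (w \<bullet> x) *\<^sub>R (x, 0) \<in> span (insert (x, 0) (?J ` B))" by (rule span_add)
    then show ?thesis by (simp add: z)
  qed
  then show "orthonormal_basis (insert (x, 0) (?J ` B))"
    unfolding orthonormal_basis_def
  proof (intro conjI ballI)
    fix u v assume "u \<in> insert (x, 0) (?J ` B)" "v \<in> insert (x, 0) (?J ` B)"
    then consider "u = (x, 0)" "v = (x, 0)" | b where "u = (x, 0)" "b \<in> B" "v = ?J b"
      | a where "a \<in> B" "u = ?J a" "v = (x, 0)" | a b where "a \<in> B" "u = ?J a" "b \<in> B" "v = ?J b" by blast
    then show "u \<bullet> v = (if u = v then 1 else 0)"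
    proof cases
      case 1 then show ?thesis by (simp add: xx)
    next
      case (2 b) then have "u \<noteq> v" using nin by blast
      then show ?thesis using x_J[OF 2(2)] 2 by simp
    next
      case (3 a) then have "u \<noteq> v" using nin imageI[OF 3(1), of ?J] by metis
      then show ?thesis using x_J[OF 3(1)] 3 inner_commute[of u v] by simp
    next
      case (4 a b) then show ?thesis using J_inner[of a b] inj_onD[OF inj, of a b] by auto
    qed
  qed (use fin in auto)
qed

lemma frame_trace:
  assumes x: "x \<in> unit_sphere" and L: "linear L"
  shows "(\<Sum>e\<in>some_frame cylinder Psi (x, t). L (frame_coords t e) \<bullet> frame_coords t e)
     = (\<Sum>b\<in>Basis. L (b, 0) \<bullet> (b, 0)) + L (0, 1) \<bullet> (0, 1) - L (x, 0) \<bullet> (x, 0)"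
proof -
  let ?B = "some_frame cylinder Psi (x, t)"
  note fb = frame_basis[OF x, where t = t]
  have "(\<Sum>e\<in>?B. L (frame_coords t e) \<bullet> frame_coords t e) + L (x, 0) \<bullet> (x, 0)
      = (\<Sum>u\<in>insert (x, 0) (frame_coords t ` ?B). L u \<bullet> u)"
    using fb by (simp add: sum.reindex)
  also have "\<dots> = (\<Sum>b\<in>Basis. L b \<bullet> b)" by (rule trace_orthonormal_basis[OF fb(1) L])
  also have "\<dots> = (\<Sum>b\<in>Basis. L (b, 0) \<bullet> (b, 0)) + L (0, 1) \<bullet> (0, 1)"
  proof -
    have inj: "inj_on (\<lambda>b::real^'n. (b, 0::real)) Basis" by (rule inj_onI) simp
    have "(\<lambda>b::real^'n. (b, 0::real)) ` Basis \<inter> {(0, 1)} = {}" by auto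
    then show ?thesis unfolding Basis_prod_def by (subst sum.union_disjoint) (auto simp: sum.reindex[OF inj])
  qed
  finally show ?thesis by simp
qed

end

definition radial_extension :: "((real^'n) \<times> real \<Rightarrow> real) \<Rightarrow> (real^'n) \<times> real \<Rightarrow> real" where
  "radial_extension f = (\<lambda>(x, t). f (sgn x, t))"

abbreviation punctured :: "((real^'n) \<times> real) set" where
  "punctured \<equiv> (- {0}) \<times> UNIV"

lemma open_punctured: "open punctured" by (intro open_Times) auto

lemma radial_extension_smooth:
  assumes "smooth_along cylinder f"
  shows "smooth_on_open punctured (radial_extension f)"
proof -
  have "smooth_on_open punctured (\<lambda>p. sgn (fst p))"
    by (rule smooth_compose[of _ "- {0}", OF open_punctured _ _ _ smooth_sgn]) (auto intro: smooth_fst[OF open_punctured smooth_id[OF open_punctured]])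
  then have sm: "smooth_on_open punctured (\<lambda>p. (sgn (fst p), snd p))"
    by (intro smooth_intros open_punctured)
  have "smooth_on_open punctured (\<lambda>p. f (sgn (fst p), snd p))"
  proof (rule smooth_along_extension[OF assms open_punctured sm])
    show "(\<lambda>p. (sgn (fst p), snd p)) ` punctured \<subseteq> cylinder"
      unfolding cylinder_def unit_sphere_def using sgn_in_sphere by fastforce
  qed
  then show ?thesis by (simp add: radial_extension_def case_prod_beta[abs_def])
qed

lemma radial_extension_eq: "q \<in> cylinder \<Longrightarrow> radial_extension f q = f q"
  by (auto simp: radial_extension_def cylinder_def unit_sphere_def sgn_div_norm)

text \<open>For fixed \<open>t\<close>, derivatives of the slice are derivatives in the directions \<open>(v, 0)\<close>.\<close>

lemma slice_smooth:
  assumes F: "smooth_on_open punctured F"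
  shows "smooth_on_open (- {0}) (\<lambda>x. F (x, t))"
  by (rule smooth_compose[OF _ open_punctured _ _ F]) (auto intro!: smooth_intros)

lemma slice_dir_deriv:
  assumes F: "smooth_on_open punctured (F :: _ \<Rightarrow> real)" and x: "x \<noteq> 0"
  shows "dir_deriv (\<lambda>x. F (x, t)) v x = dir_deriv F (v, 0) (x, t)"
proof -
  have "((\<lambda>x. F (x, t)) has_derivative (\<lambda>v. dir_deriv F (v, 0) (x, t))) (at x)"
    by (rule has_derivative_compose[OF has_derivative_Pair[OF has_derivative_ident has_derivative_const] smooth_has_derivative[OF F]])
      (use x in simp)
  then show ?thesis by (simp add: frechet_derivative_eqI)
qed

lemma slice_dir_deriv_twice:
  assumes F: "smooth_on_open punctured (F :: _ \<Rightarrow> real)" and x: "x \<noteq> 0"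
  shows "dir_deriv (dir_deriv (\<lambda>x. F (x, t)) v) w x = dir_deriv (dir_deriv F (v, 0)) (w, 0) (x, t)"
proof -
  have "frechet_derivative (dir_deriv (\<lambda>x. F (x, t)) v) (at x) = frechet_derivative (\<lambda>x. dir_deriv F (v, 0) (x, t)) (at x)"
  proof (rule frechet_derivative_cong_open(2)[of "- {0}"])
    show "(\<lambda>x. dir_deriv F (v, 0) (x, t)) differentiable at x"
      by (rule differentiableI[OF smooth_has_derivative[OF slice_smooth[OF smooth_frechet_derivative[OF F]]]])
        (use x in simp)
  qed (use x slice_dir_deriv[OF F] in auto)
  then show ?thesis using slice_dir_deriv[OF smooth_frechet_derivative[OF F] x] by simp
qed

lemma slice_laplacian:
  assumes F: "smooth_on_open punctured (F :: _ \<Rightarrow> real)" and x: "x \<noteq> 0"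
  shows "flat_laplacian (\<lambda>x. F (x, t)) x = (\<Sum>b\<in>Basis. dir_deriv (dir_deriv F (b, 0)) (b, 0) (x, t))"
  by (simp add: flat_laplacian_def slice_dir_deriv_twice[OF F x])

context rotational_immersion
begin

text \<open>The gradient is pushed forward to a field along the immersion, its derivative is paired with the
  differential of the immersion, and the resulting quadratic form is a linear operator in frame
  coordinates. The trace over a frame is the full trace minus the radial term, which vanishes except
  for the warping contribution.\<close>

theorem laplacian_rotational:
  fixes f :: "(real^'n) \<times> real \<Rightarrow> real"
  assumes f: "smooth_along cylinder f" and y: "y \<in> unit_sphere"
  defines "F \<equiv> radial_extension f"
  shows "laplacian cylinder Psi f (y, t) =
     dir_deriv (dir_deriv F (0, 1)) (0, 1) (y, t) + (real CARD('n) - 1) * (r' t / r t) * dir_deriv F (0, 1) (y, t)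
       + flat_laplacian (\<lambda>x. F (x, t)) y / (r t)\<^sup>2"
proof -
  let ?C = "cylinder :: ((real^'n) \<times> real) set"
  have Fs: "smooth_on_open punctured F" unfolding F_def by (rule radial_extension_smooth[OF f])
  have hom: "F (s *\<^sub>R x, t) = F (x, t)" if "s > 0" for x s t
    using that by (simp add: F_def radial_extension_def sgn_scaleR)
  have punct: "q \<in> punctured" if "q \<in> ?C" for q using that by (auto simp: cylinder_def unit_sphere_def)
  have dF: "(F has_derivative frechet_derivative F (at q)) (at q)" if "q \<in> ?C" for q
    by (rule smooth_has_derivative[OF Fs punct[OF that]])
  have ddF: "(dir_deriv F v has_derivative (\<lambda>w. dir_deriv (dir_deriv F v) w q)) (at q)" if "q \<in> ?C" for q v
    by (rule smooth_has_derivative[OF smooth_frechet_derivative[OF Fs] punct[OF that]])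
  have df: "(f has_derivative frechet_derivative F (at q)) (at q within ?C)" if "q \<in> ?C" for q
    by (rule has_derivative_within_of_eq_on[OF dF[OF that] _ that]) (simp add: F_def radial_extension_eq)
  define G where "G q = (\<Sum>b\<in>Basis. dir_deriv F (b, 0) q *\<^sub>R b)" for q
  define G' where "G' w q = (\<Sum>b\<in>Basis. dir_deriv (dir_deriv F (b, 0)) w q *\<^sub>R b)" for w q
  define B where "B = dir_deriv F (0, 1)"
  define B' where "B' w = dir_deriv B w" for w
  have G_inner: "G (x, t) \<bullet> v = dir_deriv F (v, 0) (x, t)" if "x \<noteq> 0" for x v t
    using linear_eq_sum_Basis[OF has_derivative_linear[OF smooth_has_derivative[OF slice_smooth[OF Fs]]], where v = v and x2 = x and t3 = t] that
    unfolding G_def inner_sum_left inner_scaleR_left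
    by (simp add: slice_dir_deriv[OF Fs] inner_commute mult.commute)
  have dF_split: "dir_deriv F (v, s) (x, t) = G (x, t) \<bullet> v + s * B (x, t)" if "x \<noteq> 0" for x v s t
  proof -
    have lin: "linear (frechet_derivative F (at (x, t)))"
      by (rule has_derivative_linear[OF smooth_has_derivative[OF Fs]]) (use that in simp)
    have "dir_deriv F (v, s) (x, t) = dir_deriv F ((v, 0) + s *\<^sub>R (0, 1)) (x, t)" by simp
    also have "\<dots> = dir_deriv F (v, 0) (x, t) + s * dir_deriv F (0, 1) (x, t)"
      by (simp only: linear_add[OF lin] linear_cmul[OF lin] real_scaleR_def)
    finally have "dir_deriv F (v, s) (x, t) = dir_deriv F (v, 0) (x, t) + s * dir_deriv F (0, 1) (x, t)" .
    then show ?thesis using that by (simp add: G_inner B_def)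
  qed
  have G_radial: "G (x, t) \<bullet> x = 0" if "x \<noteq> 0" for x t
    using radial_derivative_zero[OF slice_smooth[OF Fs] hom that] that by (simp add: G_inner slice_dir_deriv[OF Fs])
  define V where "V = (\<lambda>q. ((1 / r (snd q)) *\<^sub>R G q + (B q * r' (snd q)) *\<^sub>R fst q, B q *\<^sub>R \<gamma>' (snd q)))"
  have field_eq: "differential ?C Psi q (gradient ?C Psi f q) = V q" if q: "q \<in> ?C" for q
  proof -
    obtain x t where xt: "q = (x, t)" by (cases q)
    have x: "x \<in> unit_sphere" "x \<bullet> x = 1" "x \<noteq> 0" using q by (auto simp: xt cylinder_def unit_sphere_def norm_eq_1)
    interpret immersed_point ?C Psi q "Psi' q" by (rule immersed_point[OF q])
    let ?w = "((1 / (r t)\<^sup>2) *\<^sub>R G q, B q)"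
    have wT: "?w \<in> tangent_space ?C q" using G_radial[OF x(3)] unfolding xt tangent_space_cylinder[OF x(1)] by simp
    have "gradient ?C Psi f q = ?w"
    proof (rule gradient_eqI[OF df[OF q] wT])
      fix v assume "v \<in> tangent_space ?C q"
      then obtain u s where v: "v = (u, s)" "u \<bullet> x = 0" unfolding xt tangent_space_cylinder[OF x(1)] by blast
      show "Psi' q ?w \<bullet> Psi' q v = frechet_derivative F (at q) v"
        using Psi'_inner[OF x(2) _ v(2), of "(1 / (r t)\<^sup>2) *\<^sub>R G q" t "B q" s] G_radial[OF x(3)] r_pos[of t] dF_split[OF x(3)]
        by (simp add: xt v mult.commute)
    qed
    then have "differential ?C Psi q (gradient ?C Psi f q) = Psi' q ?w" using differential_eq[OF F wT] by simp
    also have "\<dots> = V q" using r_pos[of t] by (simp add: Psi'_def V_def xt power2_eq_square)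
    finally show ?thesis .
  qed
  have yC: "(y, t) \<in> ?C" using y by (simp add: cylinder_def)
  have yy: "y \<bullet> y = 1" "y \<noteq> 0" using y by (auto simp: unit_sphere_def norm_eq_1)
  interpret immersed_point ?C Psi "(y, t)" "Psi' (y, t)" by (rule immersed_point[OF yC])
  have dG: "(G has_derivative (\<lambda>w. G' w (y, t))) (at (y, t))"
    unfolding G_def[abs_def] G'_def by (intro has_derivative_sum has_derivative_scaleR_left ddF yC)
  have dB: "(B has_derivative (\<lambda>w. B' w (y, t))) (at (y, t))" unfolding B'_def B_def by (rule ddF[OF yC])
  define V' where "V' = (\<lambda>w. ((1 / r t) *\<^sub>R G' w (y, t) + (- (snd w * r' t) / (r t)\<^sup>2) *\<^sub>R G (y, t)
      + ((B (y, t) * r' t) *\<^sub>R fst w + (B (y, t) * (snd w * r'' t) + B' w (y, t) * r' t) *\<^sub>R y),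
      B (y, t) *\<^sub>R (snd w *\<^sub>R \<gamma>'' t) + B' w (y, t) *\<^sub>R \<gamma>' t))"
  have dV: "(V has_derivative V') (at (y, t))"
  proof -
    have inv: "((\<lambda>q. 1 / r (snd q)) has_derivative (\<lambda>w. - (snd w * r' t) / (r t)\<^sup>2)) (at (y, t))"
    proof -
      have "((\<lambda>t. 1 / r t) has_derivative (\<lambda>h. - (h * r' t) / (r t)\<^sup>2)) (at t)"
        using r_pos[of t] by (auto intro!: derivative_eq_intros r'_deriv simp: power2_eq_square divide_simps)
      then show ?thesis using along_snd[of "\<lambda>t. 1 / r t" _ "(y, t)"] by simp
    qed
    have r'q: "((\<lambda>q. r' (snd q)) has_derivative (\<lambda>w. snd w * r'' t)) (at (y, t))"
      "((\<lambda>q. \<gamma>' (snd q)) has_derivative (\<lambda>w. snd w *\<^sub>R \<gamma>'' t)) (at (y, t))"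
      using along_snd[of r' "\<lambda>h. h * r'' t" "(y, t)"] along_snd[of \<gamma>' "\<lambda>h. h *\<^sub>R \<gamma>'' t" "(y, t)"] r'_deriv
      by simp_all
    have "(V has_derivative (\<lambda>w. ((1 / r (snd (y, t))) *\<^sub>R G' w (y, t) + (- (snd w * r' t) / (r t)\<^sup>2) *\<^sub>R G (y, t)
      + ((B (y, t) * r' (snd (y, t))) *\<^sub>R fst w + (B (y, t) * (snd w * r'' t) + B' w (y, t) * r' (snd (y, t))) *\<^sub>R fst (y, t)),
      B (y, t) *\<^sub>R (snd w *\<^sub>R \<gamma>'' t) + B' w (y, t) *\<^sub>R \<gamma>' (snd (y, t))))) (at (y, t))"
      unfolding V_def
      by (intro has_derivative_Pair has_derivative_add has_derivative_scaleR has_derivative_mult inv r'q dG dB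
          has_derivative_fst has_derivative_ident)
    then show ?thesis by (simp add: V'_def)
  qed
  have div: "laplacian ?C Psi f (y, t) = (\<Sum>e\<in>frame. V' e \<bullet> Psi' (y, t) e)"
    unfolding laplacian_def by (rule divergence_eq[OF has_derivative_within_of_eq_on[OF dV field_eq yC]])
  have G'_lin: "linear (\<lambda>w. G' w (y, t))" and B'_lin: "linear (\<lambda>w. B' w (y, t))"
    by (rule has_derivative_linear[OF dG], rule has_derivative_linear[OF dB])
  have G'_y: "G' (v, s) (y, t) \<bullet> y = - (G (y, t) \<bullet> v)" for v s
  proof -
    have "((\<lambda>q. G q \<bullet> fst q) has_derivative (\<lambda>w. G (y, t) \<bullet> fst w + G' w (y, t) \<bullet> fst (y, t))) (at (y, t))"
      by (intro has_derivative_inner dG has_derivative_fst has_derivative_ident)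
    moreover have "((\<lambda>q. G q \<bullet> fst q) has_derivative (\<lambda>w. 0)) (at (y, t))"
    proof (rule has_derivative_transform_within_open[of "\<lambda>_. 0" _ _ _ punctured])
      show "0 = G q \<bullet> fst q" if "q \<in> punctured" for q
        using that G_radial[of "fst q" "snd q"] by (simp add: mem_Times_iff)
    qed (use open_punctured yy in auto)
    ultimately have "(\<lambda>w. G (y, t) \<bullet> fst w + G' w (y, t) \<bullet> fst (y, t)) = (\<lambda>w. 0)" by (rule has_derivative_unique)
    from fun_cong[OF this, of "(v, s)"] show ?thesis by simp
  qed
  \<comment> \<open>the quadratic form of the divergence as an operator in frame coordinates \<open>w = (r v, s)\<close>\<close>
  define L where "L = (\<lambda>w. ((1 / r t) *\<^sub>R G' ((1 / r t) *\<^sub>R fst w, snd w) (y, t) - (2 * (r' t / (r t)\<^sup>2) * snd w) *\<^sub>R G (y, t)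
       + (B (y, t) * (r' t / r t)) *\<^sub>R fst w, B' ((1 / r t) *\<^sub>R fst w, snd w) (y, t)))"
  have L_lin: "linear L"
  proof -
    have 1: "linear (\<lambda>w::(real^'n) \<times> real. ((1 / r t) *\<^sub>R fst w, snd w))"
      by (rule linearI) (auto simp: algebra_simps)
    define A b where "A = (\<lambda>w. G' ((1 / r t) *\<^sub>R fst w, snd w) (y, t))"
      and "b = (\<lambda>w. B' ((1 / r t) *\<^sub>R fst w, snd w) (y, t))"
    have c: "linear A" "linear b"
      using linear_compose[OF 1 G'_lin] linear_compose[OF 1 B'_lin] by (simp_all add: A_def b_def o_def)
    define k where "k = 2 * (r' t / (r t)\<^sup>2)"
    have "L = (\<lambda>w. ((1 / r t) *\<^sub>R A w - (k * snd w) *\<^sub>R G (y, t) + (B (y, t) * (r' t / r t)) *\<^sub>R fst w, b w))"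
      unfolding L_def A_def b_def k_def ..
    then show ?thesis
      by (simp only:, intro linearI)
        (simp_all add: linear_add[OF c(1)] linear_add[OF c(2)] linear_cmul[OF c(1)] linear_cmul[OF c(2)] algebra_simps)
  qed
  have summand: "V' e \<bullet> Psi' (y, t) e = L (frame_coords t e) \<bullet> frame_coords t e" if "e \<in> frame" for e
  proof -
    obtain v s where e: "e = (v, s)" by (cases e)
    have v: "v \<bullet> y = 0" using frame_basis(5)[OF y] that e by blast
    have Gy: "G (y, t) \<bullet> y = 0" by (rule G_radial[OF yy(2)])
    define \<rho> g b b' where "\<rho> = r t" "g = G' (v, s) (y, t)" "b = B (y, t)" "b' = B' (v, s) (y, t)"
    note abbr = this
    have \<rho>: "\<rho> > 0" using r_pos by (simp add: abbr)
    have gy: "g \<bullet> y = - (G (y, t) \<bullet> v)" unfolding abbr by (rule G'_y)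
    have gy': "\<gamma>' t \<bullet> \<gamma>' t = 1 - (r' t)\<^sup>2" "\<gamma>'' t \<bullet> \<gamma>' t = - (r' t * r'' t)"
      using arc_length[of t] arc_length_deriv[of t] by (simp_all add: inner_commute)
    have "V' e \<bullet> Psi' (y, t) e = g \<bullet> v - 2 * (r' t / \<rho>) * s * (G (y, t) \<bullet> v) + s * b' + b * \<rho> * r' t * (v \<bullet> v)"
    proof -
      define X where "X = (1 / \<rho>) *\<^sub>R g + (- (s * r' t) / \<rho>\<^sup>2) *\<^sub>R G (y, t)
        + ((b * r' t) *\<^sub>R v + (b * (s * r'' t) + b' * r' t) *\<^sub>R y)"
      have yv: "y \<bullet> v = 0" using v by (simp add: inner_commute)
      have Xv: "X \<bullet> v = g \<bullet> v / \<rho> - s * r' t * (G (y, t) \<bullet> v) / \<rho>\<^sup>2 + b * r' t * (v \<bullet> v)"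
        by (simp add: X_def inner_add_left inner_diff_left yv)
      have Xy: "X \<bullet> y = - (G (y, t) \<bullet> v) / \<rho> + b * s * r'' t + b' * r' t"
        by (simp add: X_def inner_add_left inner_diff_left v gy Gy yy(1))
      define k where "k = (G (y, t) \<bullet> v) / \<rho>"
      have X\<rho>: "\<rho> * (X \<bullet> v) = g \<bullet> v - s * r' t * k + b * \<rho> * r' t * (v \<bullet> v)"
        using \<rho> by (simp add: Xv k_def power2_eq_square field_simps)
      have Xyk: "X \<bullet> y = - k + b * s * r'' t + b' * r' t" by (simp add: Xy k_def)
      have k: "2 * (r' t / \<rho>) * s * (G (y, t) \<bullet> v) = 2 * s * r' t * k" by (simp add: k_def)
      have "V' e \<bullet> Psi' (y, t) e = X \<bullet> (\<rho> *\<^sub>R v + (s * r' t) *\<^sub>R y)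
          + (b *\<^sub>R (s *\<^sub>R \<gamma>'' t) + b' *\<^sub>R \<gamma>' t) \<bullet> (s *\<^sub>R \<gamma>' t)"
        by (simp add: V'_def Psi'_def e X_def abbr)
      also have "\<dots> = \<rho> * (X \<bullet> v) + s * r' t * (X \<bullet> y) + s * (b * s * (\<gamma>'' t \<bullet> \<gamma>' t) + b' * (\<gamma>' t \<bullet> \<gamma>' t))"
        by (simp add: inner_add_left inner_add_right algebra_simps)
      finally show ?thesis
        unfolding X\<rho> Xyk gy' k by (simp add: algebra_simps power2_eq_square)
    qed
    also have "\<dots> = L (frame_coords t e) \<bullet> frame_coords t e"
    proof -
      have "L (frame_coords t e) = ((1 / \<rho>) *\<^sub>R g - (2 * (r' t / \<rho>\<^sup>2) * s) *\<^sub>R G (y, t) + (b * (r' t / \<rho>)) *\<^sub>R (\<rho> *\<^sub>R v), b')"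
        using \<rho> by (simp add: L_def frame_coords_def e abbr)
      then show ?thesis using \<rho>
        by (simp add: frame_coords_def e inner_prod_def abbr(1)[symmetric] inner_add_left inner_diff_left field_simps power2_eq_square)
    qed
    finally show ?thesis .
  qed
  have "laplacian ?C Psi f (y, t) = (\<Sum>b\<in>Basis. L (b, 0) \<bullet> (b, 0)) + L (0, 1) \<bullet> (0, 1) - L (y, 0) \<bullet> (y, 0)"
    unfolding div using frame_trace[OF y L_lin, where t = t] summand by simp
  also have "(\<Sum>b\<in>Basis. L (b, 0) \<bullet> (b, 0)) = flat_laplacian (\<lambda>x. F (x, t)) y / (r t)\<^sup>2 + real CARD('n) * (r' t / r t) * B (y, t)"
  proof -
    have "L (b, 0) \<bullet> (b, 0) = dir_deriv (dir_deriv F (b, 0)) (b, 0) (y, t) / (r t)\<^sup>2 + B (y, t) * (r' t / r t)" if b: "b \<in> Basis" for b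
    proof -
      have "G' ((1 / r t) *\<^sub>R b, 0) (y, t) = (1 / r t) *\<^sub>R G' (b, 0) (y, t)"
        using linear_cmul[OF G'_lin, of "1 / r t" "(b, 0)"] by simp
      moreover have "G' (b, 0) (y, t) \<bullet> b = dir_deriv (dir_deriv F (b, 0)) (b, 0) (y, t)"
        using b by (simp add: G'_def inner_sum_left inner_Basis if_distrib cong: if_cong)
      ultimately show ?thesis using b by (simp add: L_def inner_prod_def inner_add_left inner_Basis power2_eq_square)
    qed
    then show ?thesis
      by (simp add: slice_laplacian[OF Fs yy(2)] sum.distrib sum_divide_distrib)
  qed
  also have "L (0, 1) \<bullet> (0, 1) = B' (0, 1) (y, t)" by (simp add: L_def inner_prod_def)
  also have "L (y, 0) \<bullet> (y, 0) = B (y, t) * (r' t / r t)"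
  proof -
    have "G' ((1 / r t) *\<^sub>R y, 0) (y, t) \<bullet> y = 0" using G'_y G_radial[OF yy(2)] by simp
    then show ?thesis by (simp add: L_def inner_prod_def inner_add_left yy)
  qed
  finally show ?thesis by (simp add: B'_def B_def left_diff_distrib right_diff_distrib diff_divide_distrib mult_ac)
qed

end

section \<open>Rotational hypersurfaces of constant mean curvature\<close>

lemma smooth_along_UNIV: "smooth_on_open UNIV f \<Longrightarrow> smooth_along N f"
  unfolding smooth_along_def by (auto intro!: exI[of _ UNIV])

lemma smooth_along_continuous:
  assumes "smooth_along N f" "p \<in> N"
  shows "continuous (at p within N) f"
proof -
  obtain U g where U: "open U" "p \<in> U" "smooth_on_open U g" "\<forall>q\<in>N \<inter> U. g q = f q"
    using assms unfolding smooth_along_def by blast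
  have "continuous (at p) g"
    using smooth_continuous_on[OF U(3)] U(1,2) continuous_on_eq_continuous_at by blast
  then have "(g \<longlongrightarrow> g p) (at p within N)"
    using continuous_at_imp_continuous_at_within unfolding continuous_within by blast
  moreover have "g p = f p" using U(2,4) assms(2) by blast
  ultimately have "(g \<longlongrightarrow> f p) (at p within N)" by simp
  moreover have "\<forall>\<^sub>F q in at p within N. g q = f q"
    unfolding eventually_at_topological using U by (intro exI[of _ U]) auto
  ultimately show ?thesis unfolding continuous_within by (rule Lim_transform_eventually)
qed

text \<open>Two unit normals that differ by a sign differ by a locally constant sign.\<close>

lemma sign_locally_constant:
  fixes f g :: "'a::euclidean_space \<Rightarrow> 'b::real_inner"
  assumes f: "continuous (at p within N) f" and g: "continuous (at p within N) g" and "p \<in> N"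
    and unit: "\<And>q. q \<in> N \<Longrightarrow> norm (g q) = 1"
    and sign: "\<And>q. q \<in> N \<Longrightarrow> f q = g q \<or> f q = - g q"
  obtains k :: real where "k\<^sup>2 = 1" "\<forall>\<^sub>F q in at p within N. f q = k *\<^sub>R g q" "f p = k *\<^sub>R g p"
proof -
  let ?k = "\<lambda>q. f q \<bullet> g q"
  have gg: "g q \<bullet> g q = 1" if "q \<in> N" for q using unit[OF that] by (simp add: norm_eq_1)
  have k: "f q = ?k q *\<^sub>R g q \<and> (?k q)\<^sup>2 = 1" if "q \<in> N" for q using sign[OF that] gg[OF that] by auto
  have k1: "?k q = 1 \<or> ?k q = - 1" if "q \<in> N" for q using sign[OF that] gg[OF that] by auto
  have "continuous (at p within N) ?k" using f g by (rule continuous_inner)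
  then have lim: "(?k \<longlongrightarrow> ?k p) (at p within N)" by (simp add: continuous_within)
  have "\<forall>\<^sub>F q in at p within N. dist (?k q) (?k p) < 1" using tendstoD[OF lim] by simp
  moreover have "\<forall>\<^sub>F q in at p within N. q \<in> N" by (simp add: eventually_at_filter)
  ultimately have "\<forall>\<^sub>F q in at p within N. f q = ?k p *\<^sub>R g q"
  proof eventually_elim
    case (elim q)
    then have "?k q = ?k p" using k1[OF elim(2)] k1[OF \<open>p \<in> N\<close>] by (auto simp: dist_real_def)
    then show ?case using k[OF elim(2)] by simp
  qed
  then show ?thesis using that[of "?k p"] k[OF \<open>p \<in> N\<close>] by blast
qed

locale cmc_profile =
  fixes n :: nat and H c :: real and r :: "real \<Rightarrow> real"
  assumes c_pos: "c > 0" and r_smooth: "smooth_on_open UNIV r"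
    and r_pos: "\<And>t. 0 < r t" and r_less: "\<And>t. r t < 1" and nonconst: "\<exists>s t. r s \<noteq> r t"
    and energy: "\<And>t. (deriv r t)\<^sup>2 + (r t)\<^sup>2 * (1 + (lam n H c r t)\<^sup>2) = 1"
begin

abbreviation "lam1 \<equiv> lam n H c r"

text \<open>The function \<open>h\<close> is the deviation of the first principal curvature from \<open>H\<close>; the second one is \<open>\<mu>\<close>.\<close>

definition h where "h t = c powr (- real n / 2) * r t powr (- real n)"

definition \<mu> where "\<mu> t = H - (real n - 1) * h t"

abbreviation "\<theta> \<equiv> theta n H c r"

definition q where "q t = sqrt (1 - (r t)\<^sup>2)"

abbreviation "r' \<equiv> deriv r"
abbreviation "r'' \<equiv> deriv (deriv r)"

lemma lam_eq: "lam1 t = H + h t" by (simp add: lam_def h_def)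

lemma r': "(r has_real_derivative r' t) (at t)" by (rule smooth_deriv[OF r_smooth]) simp

lemma r'_smooth: "smooth_on_open UNIV r'" by (rule smooth_on_deriv[OF open_UNIV r_smooth])

lemma r'': "(r' has_real_derivative r'' t) (at t)" by (rule smooth_deriv[OF r'_smooth]) simp

lemma q2_pos: "1 - (r t)\<^sup>2 > 0"
  using power_strict_mono[OF r_less less_imp_le[OF r_pos], of 2 t] by simp

lemma q_pos: "q t > 0" and q_sq: "(q t)\<^sup>2 = 1 - (r t)\<^sup>2"
  using q2_pos[of t] by (simp_all add: q_def)

lemma lam_smooth: "smooth_on_open UNIV lam1"
  unfolding lam_def[abs_def] by (intro smooth_intros r_smooth open_UNIV r_pos)

lemma h_deriv: "(h has_real_derivative - real n * h t * r' t / r t) (at t)"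
proof -
  have "(h has_real_derivative c powr (- real n / 2) * ((- real n) * r t powr (- real n - 1) * r' t)) (at t)"
    unfolding h_def[abs_def] using r_pos[of t] by (auto intro!: derivative_eq_intros r')
  moreover have "r t powr (- real n - 1) = r t powr (- real n) / r t"
    using r_pos[of t] by (simp add: powr_diff)
  ultimately show ?thesis by (simp add: h_def mult_ac)
qed

lemma lam_deriv: "(lam1 has_real_derivative - real n * h t * r' t / r t) (at t)"
  using DERIV_add[OF DERIV_const[of H] h_deriv] by (simp add: lam_eq[abs_def])

lemma r_lam_deriv: "((\<lambda>t. r t * lam1 t) has_real_derivative \<mu> t * r' t) (at t)"
proof -
  have "((\<lambda>t. r t * lam1 t) has_real_derivative r' t * lam1 t + (- real n * h t * r' t / r t) * r t) (at t)"
    by (rule DERIV_mult[OF r' lam_deriv])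
  then show ?thesis using r_pos[of t]
    by (rule_tac back_subst[of "\<lambda>d. (_ has_real_derivative d) (at t)"]) (auto simp: \<mu>_def lam_eq algebra_simps)
qed

text \<open>Differentiating the first-order equation gives the second-order one only where \<open>r'\<close> does not
  vanish. Where the second-order equation fails, \<open>r\<close> is locally constant, hence so is the defect,
  which therefore never returns to \<open>0\<close>; then \<open>r\<close> would be constant.\<close>

lemma second_order: "r'' t = - r t * (1 + lam1 t * \<mu> t)"
proof -
  define g where "g t = r'' t + r t * (1 + lam1 t * \<mu> t)" for t
  have prod: "r' t * g t = 0" for t
  proof -
    have "((\<lambda>t. (r' t)\<^sup>2 + (r t)\<^sup>2 * (1 + (lam1 t)\<^sup>2)) has_real_derivative
      2 * r'' t * r' t + (2 * r' t * r t * (1 + (lam1 t)\<^sup>2) + (2 * (- real n * h t * r' t / r t) * lam1 t) * (r t)\<^sup>2)) (at t)"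
      by (auto intro!: derivative_eq_intros r' r'' lam_deriv simp: mult_ac)
    then have "((\<lambda>t. 1 :: real) has_real_derivative
      2 * r'' t * r' t + (2 * r' t * r t * (1 + (lam1 t)\<^sup>2) + (2 * (- real n * h t * r' t / r t) * lam1 t) * (r t)\<^sup>2)) (at t)"
      by (simp only: energy)
    then have "2 * r'' t * r' t + (2 * r' t * r t * (1 + (lam1 t)\<^sup>2) + (2 * (- real n * h t * r' t / r t) * lam1 t) * (r t)\<^sup>2) = 0"
      using DERIV_unique DERIV_const by blast
    moreover have "2 * r'' t * r' t + (2 * r' t * r t * (1 + (lam1 t)\<^sup>2) + (2 * (- real n * h t * r' t / r t) * lam1 t) * (r t)\<^sup>2)
      = 2 * (r' t * g t)"
      using r_pos[of t] by (simp add: g_def \<mu>_def lam_eq power2_eq_square field_simps)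
    ultimately show ?thesis by simp
  qed
  have h_cont: "continuous_on UNIV h"
    using h_deriv by (meson DERIV_isCont continuous_at_imp_continuous_on)
  have g_cont: "continuous_on UNIV g"
    unfolding g_def \<mu>_def by (intro continuous_intros h_cont smooth_continuous_on r_smooth r'_smooth lam_smooth smooth_on_deriv open_UNIV)
  have "g t0 = 0" for t0
  proof (rule ccontr)
    assume nz: "g t0 \<noteq> 0"
    let ?S = "{t. g t = g t0}"
    have "closed ?S" by (intro closed_Collect_eq g_cont continuous_on_const)
    moreover have "open ?S"
      unfolding open_contains_ball
    proof
      fix t1 assume "t1 \<in> ?S"
      then have t1: "g t1 = g t0" by simp
      have "open {t. g t \<noteq> 0}" by (intro open_Collect_neq g_cont continuous_on_const)
      moreover have "t1 \<in> {t. g t \<noteq> 0}" using nz t1 by simp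
      ultimately obtain e where e: "e > 0" "ball t1 e \<subseteq> {t. g t \<noteq> 0}" by (rule openE)
      then have r'0: "r' t = 0" if "t \<in> ball t1 e" for t using prod[of t] that by auto
      have "\<exists>d. \<forall>t\<in>ball t1 e. r t = d"
        by (rule has_field_derivative_zero_constant[OF convex_ball])
          (metis r' r'0 has_field_derivative_at_within)
      then have r_const: "r t = r t1" if "t \<in> ball t1 e" for t
        using that e(1) centre_in_ball[of t1 e] by metis
      have "r'' t = 0" if "t \<in> ball t1 e" for t
        by (rule DERIV_unique[OF r'' has_field_derivative_transform_within_open[of "\<lambda>_. 0" 0 t "ball t1 e"]])
          (use that r'0 in auto)
      then have "g t = g t1" if "t \<in> ball t1 e" for t
        using r_const[OF that] that \<open>e > 0\<close> by (simp add: g_def \<mu>_def h_def lam_def)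
      then show "\<exists>e>0. ball t1 e \<subseteq> ?S" using e(1) t1 by (intro exI[of _ e]) auto
    qed
    ultimately have "?S = UNIV" using clopen[of ?S] by auto
    then have "g t \<noteq> 0" for t using nz by (metis UNIV_I mem_Collect_eq)
    then have "(r has_real_derivative 0) (at t)" for t using prod[of t] r'[of t] by simp
    then show False using nonconst DERIV_isconst_all by blast
  qed
  from this[of t] show ?thesis by (simp add: g_def)
qed

lemma theta_deriv: "(\<theta> has_real_derivative r t * lam1 t / (q t)\<^sup>2) (at t)"
proof -
  let ?f = "\<lambda>s. r s * lam1 s / (1 - (r s)\<^sup>2)"
  have cont: "continuous_on S ?f" for S
    using q2_pos by (intro continuous_intros continuous_on_subset[OF smooth_continuous_on[OF r_smooth]]
        continuous_on_subset[OF smooth_continuous_on[OF lam_smooth]]) (auto simp: less_imp_neq[symmetric])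
  have "((\<lambda>t. LBINT s=ereal 0..ereal t. ?f s) has_vector_derivative ?f t) (at t within {-\<bar>t\<bar>-1..\<bar>t\<bar>+1})"
    by (rule interval_integral_FTC2) (use cont in auto)
  then show ?thesis
    by (subst (asm) at_within_Icc_at) (auto simp: theta_def[abs_def] q_sq has_real_derivative_iff_has_vector_derivative)
qed

lemma q_smooth: "smooth_on_open UNIV q"
  unfolding q_def[abs_def] by (intro smooth_intros r_smooth open_UNIV q2_pos)

lemma theta_smooth: "smooth_on_open UNIV \<theta>"
proof (rule smooth_antiderivative[OF open_UNIV theta_deriv])
  show "smooth_on_open UNIV (\<lambda>t. r t * lam1 t / (q t)\<^sup>2)"
    by (intro smooth_intros r_smooth lam_smooth q_smooth open_UNIV) (simp add: order_less_imp_not_eq2[OF q_pos])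
qed

lemma q_deriv: "(q has_real_derivative - (r t * r' t) / q t) (at t)"
  unfolding q_def[abs_def] using q2_pos[of t]
  by (auto intro!: derivative_eq_intros r' simp: q_def field_simps)

text \<open>Everything lives in the rotating frame \<open>(cos \<theta>, sin \<theta>)\<close>, \<open>(- sin \<theta>, cos \<theta>)\<close> of the plane.\<close>

definition rot :: "real \<Rightarrow> real \<Rightarrow> real \<Rightarrow> real \<times> real" where
  "rot t a b = (a * cos (\<theta> t) - b * sin (\<theta> t), a * sin (\<theta> t) + b * cos (\<theta> t))"

lemma rot_inner: "rot t a b \<bullet> rot t a' b' = a * a' + b * b'"
proof -
  have "rot t a b \<bullet> rot t a' b' = (a * a' + b * b') * ((sin (\<theta> t))\<^sup>2 + (cos (\<theta> t))\<^sup>2)"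
    unfolding rot_def inner_Pair inner_real_def by algebra
  then show ?thesis by simp
qed

lemma rot_deriv:
  assumes "(a has_real_derivative a') (at t)" "(b has_real_derivative b') (at t)"
  shows "((\<lambda>t. rot t (a t) (b t)) has_vector_derivative
     rot t (a' - b t * (r t * lam1 t / (q t)\<^sup>2)) (b' + a t * (r t * lam1 t / (q t)\<^sup>2))) (at t)"
  unfolding rot_def
  by (intro has_vector_derivative_Pair; unfold has_real_derivative_iff_has_vector_derivative[symmetric])
    (auto intro!: derivative_eq_intros assms theta_deriv simp: algebra_simps)

lemma rot_surj: "\<exists>a b. z = rot t a b"
proof (intro exI)
  show "z = rot t (fst z * cos (\<theta> t) + snd z * sin (\<theta> t)) (snd z * cos (\<theta> t) - fst z * sin (\<theta> t))"
  proof -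
    have sc: "(sin (\<theta> t))\<^sup>2 + (cos (\<theta> t))\<^sup>2 = 1" by simp
    have "fst z * 1 = (fst z * cos (\<theta> t) + snd z * sin (\<theta> t)) * cos (\<theta> t) - (snd z * cos (\<theta> t) - fst z * sin (\<theta> t)) * sin (\<theta> t)"
      "snd z * 1 = (fst z * cos (\<theta> t) + snd z * sin (\<theta> t)) * sin (\<theta> t) + (snd z * cos (\<theta> t) - fst z * sin (\<theta> t)) * cos (\<theta> t)"
      unfolding sc[symmetric] by algebra+
    then show ?thesis unfolding rot_def by (simp add: prod_eq_iff)
  qed
qed

definition \<gamma> where "\<gamma> t = rot t (q t) 0"
definition \<gamma>' where "\<gamma>' t = rot t (- (r t * r' t) / q t) (r t * lam1 t / q t)"

lemma \<gamma>': "(\<gamma> has_vector_derivative \<gamma>' t) (at t)"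
proof -
  have "(\<gamma> has_vector_derivative rot t (- (r t * r' t) / q t - 0 * (r t * lam1 t / (q t)\<^sup>2)) (0 + q t * (r t * lam1 t / (q t)\<^sup>2))) (at t)"
    unfolding \<gamma>_def[abs_def] by (rule rot_deriv[OF q_deriv DERIV_const])
  moreover have "0 + q t * (r t * lam1 t / (q t)\<^sup>2) = r t * lam1 t / q t"
    using q_pos[of t] by (simp add: power2_eq_square)
  ultimately show ?thesis by (simp add: \<gamma>'_def)
qed

lemma energy': "(r' t)\<^sup>2 + (r t)\<^sup>2 * (lam1 t)\<^sup>2 = (q t)\<^sup>2"
  using energy[of t] by (simp add: q_sq algebra_simps)

lemma unit_speed: "(r' t)\<^sup>2 + \<gamma>' t \<bullet> \<gamma>' t = 1"
proof -
  have "((r' t)\<^sup>2 + \<gamma>' t \<bullet> \<gamma>' t) * (q t)\<^sup>2 = (r' t)\<^sup>2 * ((q t)\<^sup>2 + (r t)\<^sup>2) + (r t)\<^sup>2 * (lam1 t)\<^sup>2"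
    using q_pos[of t] by (simp add: \<gamma>'_def rot_inner power2_eq_square field_simps)
  also have "\<dots> = 1 * (q t)\<^sup>2" using energy'[of t] q_sq[of t] by simp
  finally show ?thesis using q_pos[of t] by simp
qed

lemma \<gamma>'': "\<exists>\<gamma>''. \<forall>t. (\<gamma>' has_vector_derivative \<gamma>'' t) (at t)"
proof -
  have a: "smooth_on_open UNIV (\<lambda>t. - (r t * r' t) / q t)" and b: "smooth_on_open UNIV (\<lambda>t. r t * lam1 t / q t)"
    by (intro smooth_intros r_smooth r'_smooth lam_smooth q_smooth open_UNIV q_pos)+
  show ?thesis
    unfolding \<gamma>'_def[abs_def] using rot_deriv[OF smooth_deriv[OF a UNIV_I] smooth_deriv[OF b UNIV_I]]
    by (intro exI allI)
qed

lemma phi_eq: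
  assumes "CARD('n::finite) = n"
  shows "(phi H c r :: (real^'n) \<times> real \<Rightarrow> _) = (\<lambda>(x, t). (r t *\<^sub>R x, \<gamma> t))"
  by (simp add: phi_def assms \<gamma>_def rot_def q_def fun_eq_iff)

lemma rotational:
  assumes "CARD('n::finite) = n"
  obtains \<gamma>'' where "rotational_immersion r \<gamma> r' r'' \<gamma>' \<gamma>'' (phi H c r :: (real^'n) \<times> real \<Rightarrow> _)"
proof -
  obtain \<gamma>'' where "\<And>t. (\<gamma>' has_vector_derivative \<gamma>'' t) (at t)" using \<gamma>'' by blast
  then have "rotational_immersion r \<gamma> r' r'' \<gamma>' \<gamma>'' (phi H c r :: (real^'n) \<times> real \<Rightarrow> _)"
    by unfold_locales (use r_pos r' r'' \<gamma>' unit_speed phi_eq[OF assms] in auto)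
  then show ?thesis by (rule that)
qed

text \<open>The unit normal is the cross product of the position and the velocity of the profile curve in
  the moving frame.\<close>

definition \<delta> where "\<delta> t = rot t (- ((r t)\<^sup>2 * lam1 t) / q t) (- r' t / q t)"

definition normal :: "(real^'n) \<times> real \<Rightarrow> (real^'n) \<times> real \<times> real" where
  "normal = (\<lambda>(x, t). ((r t * lam1 t) *\<^sub>R x, \<delta> t))"

lemma \<delta>_inner: "\<delta> t \<bullet> \<gamma> t = - ((r t)\<^sup>2 * lam1 t)" "\<delta> t \<bullet> \<gamma>' t = - (r t * lam1 t * r' t)"
  "\<delta> t \<bullet> \<delta> t = 1 - (r t * lam1 t)\<^sup>2"
proof -
  show "\<delta> t \<bullet> \<gamma> t = - ((r t)\<^sup>2 * lam1 t)" using q_pos[of t] by (simp add: \<delta>_def \<gamma>_def rot_inner)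
  have "(\<delta> t \<bullet> \<gamma>' t) * (q t)\<^sup>2 = - (r t * lam1 t * r' t) * (1 - (r t)\<^sup>2)"
    using q_pos[of t] by (simp add: \<delta>_def \<gamma>'_def rot_inner power2_eq_square field_simps)
  also have "\<dots> = - (r t * lam1 t * r' t) * (q t)\<^sup>2" by (simp only: q_sq)
  finally show "\<delta> t \<bullet> \<gamma>' t = - (r t * lam1 t * r' t)"
    using q_pos[of t] by (simp only: mult_right_cancel[of "(q t)\<^sup>2"] zero_less_power less_imp_neq[symmetric] simp_thms)
  have "(\<delta> t \<bullet> \<delta> t) * (q t)\<^sup>2 = (r t)\<^sup>2 * (r t)\<^sup>2 * (lam1 t)\<^sup>2 + (r' t)\<^sup>2"
    using q_pos[of t] by (simp add: \<delta>_def rot_inner power2_eq_square field_simps)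
  also have "(r' t)\<^sup>2 = (q t)\<^sup>2 - (r t)\<^sup>2 * (lam1 t)\<^sup>2" using energy'[of t] by simp
  also have "(r t)\<^sup>2 * (r t)\<^sup>2 * (lam1 t)\<^sup>2 + ((q t)\<^sup>2 - (r t)\<^sup>2 * (lam1 t)\<^sup>2) = (1 - (r t * lam1 t)\<^sup>2) * (q t)\<^sup>2"
    by (simp add: q_sq power_mult_distrib algebra_simps)
  finally show "\<delta> t \<bullet> \<delta> t = 1 - (r t * lam1 t)\<^sup>2" using q_pos[of t] by simp
qed

text \<open>The profile curve is a curve in a two-sphere with curvature \<open>\<mu>\<close>: this is the second principal
  curvature.\<close>

lemma \<delta>_deriv: "(\<delta> has_vector_derivative \<mu> t *\<^sub>R \<gamma>' t) (at t)"
proof -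
  have d1: "((\<lambda>t. - ((r t)\<^sup>2 * lam1 t) / q t) has_real_derivative
      - (r' t * (r t * lam1 t) + (\<mu> t * r' t) * r t) / q t - (r t)\<^sup>2 * lam1 t * (r t * r' t) / (q t)^3) (at t)"
  proof -
    have "((\<lambda>t. - (r t * (r t * lam1 t)) / q t) has_real_derivative
      (- (r' t * (r t * lam1 t) + (\<mu> t * r' t) * r t) * q t - - (r t * (r t * lam1 t)) * (- (r t * r' t) / q t)) / (q t * q t)) (at t)"
      using q_pos[of t] by (intro DERIV_divide DERIV_minus DERIV_mult r' r_lam_deriv q_deriv) auto
    then show ?thesis using q_pos[of t]
      by (simp add: power2_eq_square power3_eq_cube diff_divide_distrib mult_ac) 
  qed
  have d2: "((\<lambda>t. - r' t / q t) has_real_derivative - r'' t / q t - r t * (r' t)\<^sup>2 / (q t)^3) (at t)"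
  proof -
    have "((\<lambda>t. - r' t / q t) has_real_derivative (- r'' t * q t - - r' t * (- (r t * r' t) / q t)) / (q t * q t)) (at t)"
      using q_pos[of t] by (intro DERIV_divide DERIV_minus r'' q_deriv) auto
    then show ?thesis using q_pos[of t]
      by (simp add: power2_eq_square power3_eq_cube diff_divide_distrib mult_ac)
  qed
  define Q where "Q = q t"
  have Q: "Q > 0" "Q\<^sup>2 = 1 - (r t)\<^sup>2" using q_pos q_sq by (auto simp: Q_def)
  have Q3: "Q^3 = Q * Q\<^sup>2" by (simp add: power3_eq_cube power2_eq_square)
  have e1: "- (r' t * (r t * lam1 t) + (\<mu> t * r' t) * r t) / Q - (r t)\<^sup>2 * lam1 t * (r t * r' t) / Q^3
      - (- r' t / Q) * (r t * lam1 t / Q\<^sup>2) = \<mu> t * (- (r t * r' t) / Q)"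
  proof -
    have "(r t * lam1 t * r' t * (1 - (r t)\<^sup>2)) / (Q * Q\<^sup>2) = r t * lam1 t * r' t / Q"
      using Q by (simp flip: Q(2))
    then show ?thesis using Q(1)
      by (simp add: Q3 add_divide_distrib diff_divide_distrib right_diff_distrib power2_eq_square mult_ac)
  qed
  have e2: "- r'' t / Q - r t * (r' t)\<^sup>2 / Q^3 + (- ((r t)\<^sup>2 * lam1 t) / Q) * (r t * lam1 t / Q\<^sup>2) = \<mu> t * (r t * lam1 t / Q)"
  proof -
    have "r t * ((r' t)\<^sup>2 + (r t)\<^sup>2 * (lam1 t)\<^sup>2) / (Q * Q\<^sup>2) = r t / Q"
      using Q(1) energy'[of t] by (simp add: Q_def)
    then show ?thesis using Q(1)
      by (simp add: second_order Q3 add_divide_distrib diff_divide_distrib distrib_left power2_eq_square mult_ac)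
  qed
  have scale: "rot t (\<mu> t * a) (\<mu> t * b) = \<mu> t *\<^sub>R rot t a b" for a b by (simp add: rot_def algebra_simps)
  then show ?thesis
    using rot_deriv[OF d1 d2] unfolding \<delta>_def[abs_def, symmetric] e1[unfolded Q_def] e2[unfolded Q_def]
    by (simp only: \<gamma>'_def scale)
qed

lemma rot_smooth:
  assumes "smooth_on_open UNIV a" "smooth_on_open UNIV b"
  shows "smooth_on_open UNIV (\<lambda>t. rot t (a t) (b t))"
  unfolding rot_def by (intro smooth_intros theta_smooth open_UNIV assms)

lemma normal_smooth: "smooth_on_open UNIV (normal :: (real^'n) \<times> real \<Rightarrow> _)"
proof -
  have comp: "smooth_on_open UNIV (\<lambda>p. f (snd p))" if "smooth_on_open UNIV f" for f :: "real \<Rightarrow> 'c::euclidean_space"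
    by (rule smooth_compose[OF open_UNIV open_UNIV _ smooth_snd[OF open_UNIV smooth_id[OF open_UNIV]] that]) simp
  have "smooth_on_open UNIV \<delta>"
    unfolding \<delta>_def[abs_def]
    by (intro rot_smooth smooth_intros r_smooth r'_smooth lam_smooth q_smooth open_UNIV q_pos)
  then have "smooth_on_open UNIV (\<lambda>p :: (real^'n) \<times> real. ((r (snd p) * lam1 (snd p)) *\<^sub>R fst p, \<delta> (snd p)))"
    by (intro smooth_intros comp r_smooth lam_smooth open_UNIV)
  then show ?thesis by (simp add: normal_def case_prod_beta[abs_def])
qed

end

context cmc_profile begin

lemma normal_deriv:
  fixes p :: "(real^'n) \<times> real"
  shows "(normal has_derivative (\<lambda>(v, s). ((r (snd p) * lam1 (snd p)) *\<^sub>R v + (s * (\<mu> (snd p) * r' (snd p))) *\<^sub>R fst p,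
      s *\<^sub>R (\<mu> (snd p) *\<^sub>R \<gamma>' (snd p))))) (at p)"
proof -
  have s: "((\<lambda>q. f (snd q)) has_derivative (\<lambda>w. snd w *\<^sub>R d)) (at p)" if "(f has_vector_derivative d) (at (snd p))"
    for f :: "real \<Rightarrow> 'c::real_normed_vector" and d
    using has_derivative_compose[OF has_derivative_snd[OF has_derivative_ident] that[unfolded has_vector_derivative_def]] .
  have 1: "((\<lambda>q. r (snd q) * lam1 (snd q)) has_derivative (\<lambda>w. snd w *\<^sub>R (\<mu> (snd p) * r' (snd p)))) (at p)"
    using s[of "\<lambda>t. r t * lam1 t"] r_lam_deriv[unfolded has_real_derivative_iff_has_vector_derivative] by blast
  have "((\<lambda>q. ((r (snd q) * lam1 (snd q)) *\<^sub>R fst q, \<delta> (snd q))) has_derivative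
    (\<lambda>w. ((r (snd p) * lam1 (snd p)) *\<^sub>R fst w + (snd w *\<^sub>R (\<mu> (snd p) * r' (snd p))) *\<^sub>R fst p,
      snd w *\<^sub>R (\<mu> (snd p) *\<^sub>R \<gamma>' (snd p))))) (at p)"
    by (intro has_derivative_Pair has_derivative_scaleR 1 s \<delta>_deriv has_derivative_fst has_derivative_ident)
  then show ?thesis by (simp add: normal_def case_prod_beta[abs_def])
qed

text \<open>In the moving frame, a plane vector orthogonal to the position and to the velocity of the profile
  curve is a multiple of the cross product.\<close>

lemma normal_direction:
  assumes o1: "r t * \<alpha> + z \<bullet> \<gamma> t = 0" and o2: "r' t * \<alpha> + z \<bullet> \<gamma>' t = 0"
  defines "k \<equiv> \<alpha> * (r t * lam1 t) + z \<bullet> \<delta> t"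
  shows "\<alpha> = k * (r t * lam1 t)" "z = k *\<^sub>R \<delta> t"
proof -
  obtain b2 b3 where z: "z = rot t b2 b3" using rot_surj by blast
  define Q \<rho> d L where "Q = q t" and "\<rho> = r t" and "d = r' t" and "L = lam1 t"
  note D = this
  have Q: "Q > 0" "Q\<^sup>2 = 1 - \<rho>\<^sup>2" "d\<^sup>2 + \<rho>\<^sup>2 * L\<^sup>2 = Q\<^sup>2" using q_pos q_sq energy' by (auto simp: D)
  have 1: "\<rho> * \<alpha> + b2 * Q = 0" using o1 by (simp add: z \<gamma>_def rot_inner D)
  have "Q * (d * \<alpha> + (b2 * (- (\<rho> * d) / Q) + b3 * (\<rho> * L / Q))) = 0"
    using o2 by (simp add: z \<gamma>'_def rot_inner D)
  then have 2: "Q * d * \<alpha> - b2 * \<rho> * d + b3 * \<rho> * L = 0" using Q(1) by (simp add: algebra_simps)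
  have k_eq: "k * Q = \<alpha> * \<rho> * L * Q - b2 * \<rho>\<^sup>2 * L - b3 * d"
    unfolding k_def z \<delta>_def rot_inner D[symmetric] using Q(1) by (simp add: field_simps)
  have 3: "d * \<alpha> = - (b3 * \<rho> * L * Q)"
  proof -
    have "Q * (Q * d * \<alpha> - b2 * \<rho> * d + b3 * \<rho> * L) = 0" using 2 by simp
    then have "d * \<alpha> * Q\<^sup>2 - d * \<rho> * (b2 * Q) + b3 * \<rho> * L * Q = 0" by (simp add: power2_eq_square algebra_simps)
    moreover have bq: "b2 * Q = - (\<rho> * \<alpha>)" using 1 by simp
    ultimately have "d * \<alpha> * Q\<^sup>2 - d * \<rho> * (- (\<rho> * \<alpha>)) + b3 * \<rho> * L * Q = 0" by (simp only:)
    then have "d * \<alpha> * (Q\<^sup>2 + \<rho>\<^sup>2) + b3 * \<rho> * L * Q = 0" by (simp add: power2_eq_square algebra_simps)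
    then show ?thesis using Q(2) by simp
  qed
  have b2: "b2 * Q = - (\<rho> * \<alpha>)" using 1 by simp
  have kQ2: "k * Q\<^sup>2 = \<alpha> * \<rho> * L * Q\<^sup>2 + \<rho>\<^sup>2 * L * (\<rho> * \<alpha>) - b3 * d * Q"
  proof -
    have "k * Q\<^sup>2 = (\<alpha> * \<rho> * L * Q - b2 * \<rho>\<^sup>2 * L - b3 * d) * Q" unfolding k_eq[symmetric] by (simp add: power2_eq_square)
    also have "\<dots> = \<alpha> * \<rho> * L * Q\<^sup>2 - \<rho>\<^sup>2 * L * (b2 * Q) - b3 * d * Q" by (simp add: power2_eq_square algebra_simps)
    finally show ?thesis unfolding b2 by simp
  qed
  have kQ2': "k * Q\<^sup>2 = \<alpha> * \<rho> * L - b3 * d * Q"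
  proof -
    have "\<alpha> * \<rho> * L * Q\<^sup>2 + \<rho>\<^sup>2 * L * (\<rho> * \<alpha>) = \<alpha> * \<rho> * L * (Q\<^sup>2 + \<rho>\<^sup>2)"
      by (simp add: power2_eq_square algebra_simps)
    then show ?thesis using kQ2 Q(2) by simp
  qed
  have "k * Q\<^sup>2 * (\<rho> * L) = \<alpha> * (\<rho>\<^sup>2 * L\<^sup>2) - d * (b3 * \<rho> * L * Q)"
    unfolding kQ2' by (simp add: power2_eq_square algebra_simps)
  also have "b3 * \<rho> * L * Q = - (d * \<alpha>)" using 3 by simp
  also have "\<alpha> * (\<rho>\<^sup>2 * L\<^sup>2) - d * (- (d * \<alpha>)) = \<alpha> * (d\<^sup>2 + \<rho>\<^sup>2 * L\<^sup>2)"
    by (simp add: power2_eq_square algebra_simps)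
  finally have A: "\<alpha> = k * (\<rho> * L)" unfolding Q(3) using Q(1) by (simp add: mult_ac)
  then show "\<alpha> = k * (r t * lam1 t)" by (simp add: D)
  have B2: "b2 = k * (- (\<rho>\<^sup>2 * L) / Q)"
  proof -
    have "b2 * Q = - (k * \<rho>\<^sup>2 * L)" unfolding b2 A by (simp add: power2_eq_square)
    then show ?thesis using Q(1) by (simp add: field_simps)
  qed
  have B3: "b3 = k * (- d / Q)"
  proof -
    have "k * Q\<^sup>2 * d = \<rho> * L * (d * \<alpha>) - b3 * d\<^sup>2 * Q"
      unfolding kQ2' by (simp add: power2_eq_square algebra_simps)
    also have "\<dots> = - (b3 * Q * (d\<^sup>2 + \<rho>\<^sup>2 * L\<^sup>2))" unfolding 3 by (simp add: power2_eq_square algebra_simps)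
    finally have "k * d * Q\<^sup>2 = - (b3 * Q) * Q\<^sup>2" unfolding Q(3) by (simp add: mult_ac)
    then have "(k * d + b3 * Q) * Q\<^sup>2 = 0" by (simp add: algebra_simps)
    then have "k * d = - (b3 * Q)" using Q(1) by simp
    then show ?thesis using Q(1) by (simp add: field_simps)
  qed
  have "k *\<^sub>R rot t x y = rot t (k * x) (k * y)" for x y by (simp add: rot_def algebra_simps)
  then show "z = k *\<^sub>R \<delta> t" unfolding z \<delta>_def D[symmetric] by (metis B2 B3)
qed

text \<open>Any unit normal field agrees with the explicit one up to a locally constant sign, which drops out of
  the square. In frame coordinates the shape operator is diagonal, and the sum over the frame is the
  trace of its square without the radial entry.\<close>

theorem norm_A_squared_eq:
  fixes x :: "real^'n"
  assumes dim: "CARD('n) = n" and x: "x \<in> unit_sphere"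
  shows "norm_A_squared cylinder (phi H c r) (x, t) = (real n - 1) * (lam1 t)\<^sup>2 + (\<mu> t)\<^sup>2"
proof -
  let ?C = "cylinder :: ((real^'n) \<times> real) set" and ?phi = "phi H c r :: (real^'n) \<times> real \<Rightarrow> _"
  obtain \<gamma>'' where "rotational_immersion r \<gamma> r' r'' \<gamma>' \<gamma>'' ?phi" by (rule rotational[OF dim])
  then interpret rotational_immersion r \<gamma> r' r'' \<gamma>' \<gamma>'' ?phi .
  have C: "(y, s) \<in> ?C \<longleftrightarrow> norm y = 1" for y s by (auto simp: cylinder_def unit_sphere_def)
  have dphi: "differential ?C ?phi p v = Psi' p v" if "p \<in> ?C" "v \<in> tangent_space ?C p" for p v
    by (rule differential_eq[OF has_derivative_at_withinI[OF Psi_deriv] that(2)])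
  have normal_unit: "norm (normal p) = 1" if p: "p \<in> ?C" for p
  proof -
    obtain y s where ys: "p = (y, s)" by (cases p)
    have "y \<bullet> y = 1" using p by (simp add: ys C norm_eq_1)
    then have "normal p \<bullet> normal p = 1" using \<delta>_inner(3)[of s] by (simp add: normal_def ys power2_eq_square algebra_simps)
    then show ?thesis by (simp add: norm_eq_1)
  qed
  have "unit_normal_field ?C ?phi normal"
    unfolding unit_normal_field_def
  proof (intro conjI ballI)
    show "smooth_along ?C normal" by (rule smooth_along_UNIV[OF normal_smooth])
    fix p assume p: "p \<in> ?C"
    show "norm (normal p) = 1" by (rule normal_unit[OF p])
    obtain y s where ys: "p = (y, s)" by (cases p)
    have y: "y \<in> unit_sphere" "y \<bullet> y = 1" using p by (auto simp: ys cylinder_def unit_sphere_def norm_eq_1)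
    show "normal p \<bullet> ?phi p = 0" using \<delta>_inner(1)[of s] y(2) by (simp add: normal_def Psi ys power2_eq_square)
    fix v assume v: "v \<in> tangent_space ?C p"
    then obtain u a where ua: "v = (u, a)" "u \<bullet> y = 0" unfolding ys tangent_space_cylinder[OF y(1)] by blast
    have "normal p \<bullet> Psi' p v = 0"
      using \<delta>_inner(2)[of s] y(2) ua(2) by (simp add: normal_def Psi'_def ys ua inner_add_right inner_commute[of y u])
    then show "normal p \<bullet> differential ?C ?phi p v = 0" using dphi[OF p v] by simp
  qed
  then have ex: "\<exists>\<nu>. unit_normal_field ?C ?phi \<nu>" by blast
  define \<nu> where "\<nu> = (SOME \<nu>. unit_normal_field ?C ?phi \<nu>)"
  have \<nu>: "unit_normal_field ?C ?phi \<nu>" unfolding \<nu>_def by (rule someI_ex[OF ex])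
  have sign: "\<nu> p = normal p \<or> \<nu> p = - normal p" if p: "p \<in> ?C" for p
  proof -
    obtain y s where ys: "p = (y, s)" by (cases p)
    have y: "y \<in> unit_sphere" "y \<bullet> y = 1" using p by (auto simp: ys cylinder_def unit_sphere_def norm_eq_1)
    obtain a z where az: "\<nu> p = (a, z)" by (cases "\<nu> p")
    have n1: "norm (\<nu> p) = 1" and o1: "\<nu> p \<bullet> ?phi p = 0"
      and o: "\<And>v. v \<in> tangent_space ?C p \<Longrightarrow> \<nu> p \<bullet> differential ?C ?phi p v = 0"
      using \<nu> p unfolding unit_normal_field_def by blast+
    have o2: "\<nu> p \<bullet> Psi' p v = 0" if "v \<in> tangent_space ?C p" for v
      using o[OF that] dphi[OF p that] by simp
    have T: "(u, d) \<in> tangent_space ?C p \<longleftrightarrow> u \<bullet> y = 0" for u d unfolding ys tangent_space_cylinder[OF y(1)] by simp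
    define \<alpha> where "\<alpha> = a \<bullet> y"
    have "a \<bullet> (a - \<alpha> *\<^sub>R y) = 0"
    proof -
      have "(a - \<alpha> *\<^sub>R y) \<bullet> y = 0" by (simp add: \<alpha>_def inner_diff_left y)
      then have "\<nu> p \<bullet> Psi' p (a - \<alpha> *\<^sub>R y, 0) = 0" using o2[of "(a - \<alpha> *\<^sub>R y, 0)"] T by simp
      then show ?thesis using r_pos[of s] unfolding az by (simp add: Psi'_def ys)
    qed
    then have "(a - \<alpha> *\<^sub>R y) \<bullet> (a - \<alpha> *\<^sub>R y) = 0"
      using y by (simp add: inner_diff_left inner_diff_right \<alpha>_def inner_commute)
    then have a: "a = \<alpha> *\<^sub>R y" by simp
    have e1: "r s * \<alpha> + z \<bullet> \<gamma> s = 0" using o1 unfolding az by (simp add: Psi ys a y)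
    have e2: "r' s * \<alpha> + z \<bullet> \<gamma>' s = 0" using o2[of "(0, 1)"] T unfolding az by (simp add: Psi'_def ys a y mult.commute)
    obtain k where k: "\<alpha> = k * (r s * lam1 s)" "z = k *\<^sub>R \<delta> s" using normal_direction[OF e1 e2] by blast
    have eq: "\<nu> p = k *\<^sub>R normal p" unfolding az by (simp add: a k normal_def ys)
    then have "\<bar>k\<bar> = 1" using n1 normal_unit[OF p] by simp
    then show ?thesis using eq by (auto simp: abs_if split: if_splits)
  qed
  have xC: "(x, t) \<in> ?C" using x by (simp add: cylinder_def)
  have xx: "x \<bullet> x = 1" using x by (simp add: unit_sphere_def norm_eq_1)
  define N' where "N' = (\<lambda>(v, s). ((r t * lam1 t) *\<^sub>R v + (s * (\<mu> t * r' t)) *\<^sub>R x, s *\<^sub>R (\<mu> t *\<^sub>R \<gamma>' t)))"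
  have dN: "(normal has_derivative N') (at (x, t))" unfolding N'_def using normal_deriv[of "(x, t)"] by simp
  obtain k :: real where k: "k\<^sup>2 = 1" "\<forall>\<^sub>F q in at (x, t) within ?C. \<nu> q = k *\<^sub>R normal q" "\<nu> (x, t) = k *\<^sub>R normal (x, t)"
  proof (rule sign_locally_constant[OF _ _ xC normal_unit sign])
    show "continuous (at (x, t) within ?C) \<nu>"
      using \<nu> xC smooth_along_continuous unfolding unit_normal_field_def by blast
    show "continuous (at (x, t) within ?C) normal"
      by (rule smooth_along_continuous[OF smooth_along_UNIV[OF normal_smooth] xC])
  qed
  have d\<nu>: "(\<nu> has_derivative (\<lambda>w. k *\<^sub>R N' w)) (at (x, t) within ?C)"
    by (rule has_derivative_transform_eventually[OF has_derivative_scaleR_right[OF has_derivative_at_withinI[OF dN], of k]])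
      (use k xC in \<open>auto elim: eventually_mono\<close>)
  let ?B = "some_frame ?C ?phi (x, t)"
  note fb = frame_basis[OF x, where t = t]
  have T: "e \<in> tangent_space ?C (x, t)" if "e \<in> ?B" for e
    using fb(5) that unfolding tangent_space_cylinder[OF x] by auto
  define S where "S = (\<lambda>(w, s). (lam1 t *\<^sub>R w, \<mu> t * s) :: (real^'n) \<times> real)"
  have sff: "(second_fundamental_form ?C ?phi \<nu> (x, t) u v)\<^sup>2 = (S (frame_coords t u) \<bullet> frame_coords t v)\<^sup>2"
    if uv: "u \<in> ?B" "v \<in> ?B" for u v
  proof -
    obtain a s b d where ab: "u = (a, s)" "v = (b, d)" by fastforce
    have ax: "a \<bullet> x = 0" "b \<bullet> x = 0" using fb(5) uv ab by blast+
    have "N' u \<bullet> Psi' (x, t) v = lam1 t * (r t)\<^sup>2 * (a \<bullet> b) + \<mu> t * s * d * ((r' t)\<^sup>2 + \<gamma>' t \<bullet> \<gamma>' t)"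
    proof -
      have xa: "x \<bullet> a = 0" "x \<bullet> b = 0" using ax by (simp_all add: inner_commute)
      show ?thesis
        by (simp add: N'_def Psi'_def ab inner_add_left inner_add_right ax xx xa)
          (simp add: power2_eq_square algebra_simps)
    qed
    also have "\<dots> = S (frame_coords t u) \<bullet> frame_coords t v"
      by (simp only: arc_length) (simp add: S_def frame_coords_def ab power2_eq_square)
    finally have "second_fundamental_form ?C ?phi \<nu> (x, t) u v = - k * (S (frame_coords t u) \<bullet> frame_coords t v)"
      by (simp add: second_fundamental_form_def differential_eq[OF d\<nu> T[OF uv(1)]] dphi[OF xC T[OF uv(2)]])
    then show ?thesis using k(1) by (simp add: power_mult_distrib)
  qed
  have S_lin: "linear (\<lambda>w. S (S w))" by (rule linearI) (auto simp: S_def algebra_simps)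
  have row: "(\<Sum>v\<in>?B. (S (frame_coords t u) \<bullet> frame_coords t v)\<^sup>2) = S (S (frame_coords t u)) \<bullet> frame_coords t u" if u: "u \<in> ?B" for u
  proof -
    let ?w = "S (frame_coords t u)"
    have "?w \<bullet> ?w = (\<Sum>b\<in>insert (x, 0) (frame_coords t ` ?B). (?w \<bullet> b)\<^sup>2)"
      using orthonormal_basis_parseval[OF fb(1), of ?w ?w] by (simp add: power2_eq_square)
    also have "\<dots> = (?w \<bullet> (x, 0))\<^sup>2 + (\<Sum>v\<in>?B. (?w \<bullet> frame_coords t v)\<^sup>2)"
      using fb(2-4) by (simp add: sum.reindex)
    also have "?w \<bullet> (x, 0) = 0" using fb(5) u by (cases u) (simp add: S_def frame_coords_def)
    finally have "(\<Sum>v\<in>?B. (?w \<bullet> frame_coords t v)\<^sup>2) = ?w \<bullet> ?w" by simp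
    also have "\<dots> = S ?w \<bullet> frame_coords t u" by (cases "frame_coords t u") (simp add: S_def)
    finally show ?thesis .
  qed
  have "norm_A_squared ?C ?phi (x, t) = (\<Sum>u\<in>?B. \<Sum>v\<in>?B. (second_fundamental_form ?C ?phi \<nu> (x, t) u v)\<^sup>2)"
    by (simp add: norm_A_squared_def Let_def \<nu>_def)
  also have "\<dots> = (\<Sum>u\<in>?B. S (S (frame_coords t u)) \<bullet> frame_coords t u)"
    using sff row by simp
  also have "\<dots> = (\<Sum>b\<in>Basis. S (S (b, 0)) \<bullet> (b, 0)) + S (S (0, 1)) \<bullet> (0, 1) - S (S (x, 0)) \<bullet> (x, 0)"
    by (rule frame_trace[OF x S_lin])
  also have "\<dots> = (real n - 1) * (lam1 t)\<^sup>2 + (\<mu> t)\<^sup>2"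
    by (simp add: S_def xx dim[symmetric] power2_eq_square algebra_simps)
  finally show ?thesis .
qed

lemma principal_curvature_squares:
  "(real n - 1) * (lam1 t)\<^sup>2 + (\<mu> t)\<^sup>2 = real n * H\<^sup>2 + real n * (real n - 1) * c powr (- real n) * r t powr (- 2 * real n)"
proof -
  have "c powr (- real n / 2) * c powr (- real n / 2) = c powr (- real n)"
    by (simp flip: powr_add)
  moreover have "r t powr (- real n) * r t powr (- real n) = r t powr (- 2 * real n)"
    by (simp only: powr_add[symmetric]) simp
  ultimately have "(h t)\<^sup>2 = c powr (- real n) * r t powr (- 2 * real n)"
    by (simp only: h_def power2_eq_square mult_ac)
  moreover have "(real n - 1) * (lam1 t)\<^sup>2 + (\<mu> t)\<^sup>2 = real n * H\<^sup>2 + real n * (real n - 1) * (h t)\<^sup>2"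
    by (simp add: lam_eq \<mu>_def power2_eq_square algebra_simps)
  ultimately show ?thesis by simp
qed

end

section \<open>Gegenbauer polynomials\<close>

text \<open>The coefficients are given by the power series recursion of the equation, started at \<open>0\<close> or \<open>1\<close>
  according to the parity of the degree.\<close>

fun gegenbauer_coeff :: "nat \<Rightarrow> nat \<Rightarrow> nat \<Rightarrow> real" where
  "gegenbauer_coeff n j 0 = (if even j then 1 else 0)"
| "gegenbauer_coeff n j (Suc 0) = (if odd j then 1 else 0)"
| "gegenbauer_coeff n j (Suc (Suc i)) = gegenbauer_coeff n j i *
     (real i * (real i + real n - 2) - real j * (real j + real n - 2)) / ((real i + 2) * (real i + 1))"

lemma gegenbauer_coeff_parity: "even i \<noteq> even j \<Longrightarrow> gegenbauer_coeff n j i = 0"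
  by (induction n j i rule: gegenbauer_coeff.induct) auto

lemma gegenbauer_coeff_zero: "gegenbauer_coeff n j (j + Suc d) = 0"
proof (induction d rule: induct_nat_012)
  case 0 then show ?case by (simp add: gegenbauer_coeff_parity)
next
  case 1 then show ?case by simp
next
  case (ge2 d)
  then show ?case by simp
qed

definition gegenbauer :: "nat \<Rightarrow> nat \<Rightarrow> real poly" where
  "gegenbauer n j = (\<Sum>i\<le>j. monom (gegenbauer_coeff n j i) i)"

lemma coeff_gegenbauer: "coeff (gegenbauer n j) i = gegenbauer_coeff n j i"
proof (cases "i \<le> j")
  case True then show ?thesis by (simp add: gegenbauer_def coeff_sum)
next
  case False
  then obtain d where "i = j + Suc d" by (metis add_Suc_right less_imp_Suc_add not_le)
  then show ?thesis using gegenbauer_coeff_zero False by (simp add: gegenbauer_def coeff_sum)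
qed

lemma gegenbauer_nonzero: "gegenbauer n j \<noteq> 0"
proof
  assume "gegenbauer n j = 0"
  then have "gegenbauer_coeff n j i = 0" for i using coeff_gegenbauer[of n j i] by simp
  from this[of 0] this[of "Suc 0"] show False by (auto split: if_splits)
qed

text \<open>The series solution of Gegenbauer's equation terminates at degree \<open>j\<close>, because the recursion
  factor vanishes there.\<close>

lemma gegenbauer_equation:
  "(1 - s\<^sup>2) * poly (pderiv (pderiv (gegenbauer n j))) s - (real n - 1) * s * poly (pderiv (gegenbauer n j)) s
     = - (real j * (real j + real n - 2)) * poly (gegenbauer n j) s"
proof -
  let ?p = "gegenbauer n j"
  let ?\<alpha> = "real j * (real j + real n - 2)"
  let ?q = "pderiv (pderiv ?p) - monom 1 2 * pderiv (pderiv ?p) - smult (real n - 1) (monom 1 1 * pderiv ?p) + smult ?\<alpha> ?p"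
  have "?q = 0"
  proof (rule poly_eqI)
    fix i
    have rec: "(real i + 2) * (real i + 1) * gegenbauer_coeff n j (Suc (Suc i))
        = gegenbauer_coeff n j i * (real i * (real i + real n - 2) - ?\<alpha>)" by simp
    consider "i = 0" | "i = 1" | d where "i = Suc (Suc d)" by (metis One_nat_def not0_implies_Suc)
    then show "coeff ?q i = coeff 0 i"
    proof cases
      case 1
      then show ?thesis using rec by (simp add: coeff_pderiv coeff_monom_mult coeff_gegenbauer numeral_2_eq_2 del: gegenbauer_coeff.simps)
    next
      case 2
      then show ?thesis using rec
        by (simp add: coeff_pderiv coeff_monom_mult coeff_gegenbauer del: gegenbauer_coeff.simps) (simp add: algebra_simps del: gegenbauer_coeff.simps)
    next
      case (3 d)
      then show ?thesis using rec
        by (simp add: coeff_pderiv coeff_monom_mult coeff_gegenbauer numeral_2_eq_2 del: gegenbauer_coeff.simps) (simp add: algebra_simps del: gegenbauer_coeff.simps)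
    qed
  qed
  then have "poly ?q s = 0" by simp
  then show ?thesis by (simp add: poly_monom algebra_simps power2_eq_square)
qed

text \<open>Bootstrapping: a twice differentiable solution of a linear equation with smooth coefficients is
  smooth.\<close>

lemma linear_ode_smooth:
  fixes z A B :: "real \<Rightarrow> real"
  assumes z: "\<And>t. z differentiable (at t)" "\<And>t. deriv z differentiable (at t)"
    and ode: "\<And>t. deriv (deriv z) t = A t * deriv z t + B t * z t"
    and AB: "smooth_on_open UNIV A" "smooth_on_open UNIV B"
  shows "smooth_on_open UNIV z"
proof -
  have d: "(z has_real_derivative deriv z t) (at t)" "(deriv z has_real_derivative A t * deriv z t + B t * z t) (at t)" for t
    unfolding ode[symmetric] DERIV_deriv_iff_real_differentiable by (rule z)+
  have "times_differentiable k UNIV z \<and> times_differentiable k UNIV (deriv z)" for k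
  proof (induction k)
    case 0
    then show ?case using d by (auto intro!: continuous_at_imp_continuous_on DERIV_isCont)
  next
    case (Suc k)
    have "times_differentiable k UNIV (\<lambda>t. A t * deriv z t + B t * z t)"
      by (intro times_differentiable_add times_differentiable_mult open_UNIV conjunct1[OF Suc] conjunct2[OF Suc]
          smooth_imp_times_differentiable[OF AB(1)] smooth_imp_times_differentiable[OF AB(2)])
    from times_differentiable_Suc_deriv[OF open_UNIV d(2) this]
    have "times_differentiable (Suc k) UNIV (deriv z)" .
    moreover have "times_differentiable (Suc k) UNIV z"
      by (rule times_differentiable_Suc_deriv[OF open_UNIV d(1)]) (rule conjunct2[OF Suc])
    ultimately show ?case by blast
  qed
  then show ?thesis by (simp add: smooth_on_open_def)
qed

section \<open>The separated operators\<close>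

definition warped_operator :: "nat \<Rightarrow> (real \<Rightarrow> real) \<Rightarrow> (real \<Rightarrow> real) \<Rightarrow> (real \<Rightarrow> real) \<Rightarrow> real \<Rightarrow> real" where
  "warped_operator n r Q z t = deriv (deriv z) t + (real n - 1) * (deriv r t / r t) * deriv z t + Q t * z t"

lemma (in cmc_profile) warped_spectrum_listing:
  assumes n: "n \<ge> 2" and P: "P > 0" and per: "\<And>t. r (t + P) = r t"
    and Q: "continuous_on UNIV Q" "\<And>t. Q (t + P) = Q t"
  shows "\<exists>a. ordered_listing a (periodic_spectrum P (warped_operator n r Q))"
proof -
  \<comment> \<open>with this weight the first-order term is absorbed: \<open>p' / p = (n - 1) r' / r\<close>\<close>
  define p where "p t = r t ^ (n - 1)" for t
  define p' where "p' t = real (n - 1) * r t ^ (n - 2) * r' t" for t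
  have p': "(p has_real_derivative p' t) (at t)" for t
    unfolding p_def[abs_def] p'_def
    by (auto intro!: derivative_eq_intros r' simp: numeral_2_eq_2)
  have quot: "p' t / p t = (real n - 1) * (r' t / r t)" for t
  proof -
    obtain k where "n = 2 + k" using n le_Suc_ex by blast
    then have "n = Suc (Suc k)" by simp
    then show ?thesis using r_pos[of t] by (simp add: p_def p'_def field_simps)
  qed
  interpret periodic_sturm_liouville p Q P
  proof
    show "continuous_on UNIV p" unfolding p_def by (intro continuous_intros smooth_continuous_on r_smooth)
  qed (use P Q per r_pos in \<open>auto simp: p_def\<close>)
  have "periodic_spectrum P (warped_operator n r Q) = eigenvalues"
    unfolding eigenvalues_scalar[OF p'] periodic_spectrum_def warped_operator_def quot ..
  then show ?thesis using eigenvalues_listing unfolding ordered_listing_def by simp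
qed

section \<open>Separation of variables\<close>

lemma time_derivative:
  assumes F: "smooth_on_open punctured (F :: (real^'n) \<times> real \<Rightarrow> real)" and x: "x \<noteq> 0"
  shows "((\<lambda>t. F (x, t)) has_real_derivative dir_deriv F (0, 1) (x, t)) (at t)"
proof -
  have dF: "(F has_derivative frechet_derivative F (at (x, t))) (at (x, t))"
    by (rule smooth_has_derivative[OF F]) (use x in simp)
  have "((\<lambda>t. F (x, t)) has_derivative (\<lambda>h. dir_deriv F (0, h) (x, t))) (at t)"
  proof -
    have "((\<lambda>t. (x, t)) has_derivative (\<lambda>h. (0, h))) (at t)"
      by (intro has_derivative_Pair has_derivative_const has_derivative_ident)
    from has_derivative_compose[OF this dF] show ?thesis .
  qed
  moreover have "(\<lambda>h. dir_deriv F (0, h) (x, t)) = (*) (dir_deriv F (0, 1) (x, t))"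
  proof
    show "dir_deriv F (0, h) (x, t) = dir_deriv F (0, 1) (x, t) * h" for h
      using linear_cmul[OF has_derivative_linear[OF dF], of h "(0, 1)"] by simp
  qed
  ultimately show ?thesis unfolding has_field_derivative_def by (simp only:)
qed

text \<open>The weight makes the integrand vanish near the origin, so that it is jointly continuous on the whole
  space, as differentiation under the integral requires.\<close>

lemma continuous_parametric_integrand:
  assumes F: "continuous_on punctured (F :: (real^'n) \<times> real \<Rightarrow> real)" and g: "continuous_on (sphere 0 1) g"
  shows "continuous_on UNIV (\<lambda>(t, x). bump (x \<bullet> x) * (F (sgn x, t) * g (sgn x)))"
proof -
  let ?f = "\<lambda>(t, x). bump (x \<bullet> x) * (F (sgn x, t) * g (sgn x))"
  have 1: "continuous_on (UNIV \<times> - {0}) ?f"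
    unfolding case_prod_beta
  proof (intro continuous_on_mult)
    show "continuous_on (UNIV \<times> - {0}) (\<lambda>p :: real \<times> (real^'n). bump (snd p \<bullet> snd p))"
      by (rule continuous_on_compose2[OF bump_inner_continuous(1)[of UNIV]]) (auto intro!: continuous_intros)
    show "continuous_on (UNIV \<times> - {0}) (\<lambda>p :: real \<times> (real^'n). F (sgn (snd p), fst p))"
      by (rule continuous_on_compose2[OF F]) (auto intro!: continuous_intros simp: sgn_zero_iff)
    show "continuous_on (UNIV \<times> - {0}) (\<lambda>p :: real \<times> (real^'n). g (sgn (snd p)))"
    proof (rule continuous_on_compose2[OF g])
      show "continuous_on (UNIV \<times> - {0}) (\<lambda>p :: real \<times> (real^'n). sgn (snd p))" by (intro continuous_intros) auto
      show "(\<lambda>p :: real \<times> (real^'n). sgn (snd p)) ` (UNIV \<times> - {0}) \<subseteq> sphere 0 1" using sgn_in_sphere by fastforce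
    qed
  qed
  have 2: "continuous_on (UNIV \<times> ball 0 1) ?f"
    by (rule continuous_on_eq[of _ "\<lambda>_. 0"]) (auto simp: bump_zero inner_self_le_1)
  have "open (UNIV \<times> - {0} :: (real \<times> (real^'n)) set)" "open (UNIV \<times> ball 0 1 :: (real \<times> (real^'n)) set)"
    by (intro open_Times; auto)+
  from continuous_on_open_Un[OF this 1 2]
  show ?thesis by (rule continuous_on_subset) auto
qed

lemma sphere_mean_time_derivative:
  assumes F: "smooth_on_open punctured (F :: (real^'n) \<times> real \<Rightarrow> real)" and g: "continuous_on (sphere 0 1) g"
  shows "((\<lambda>t. sphere_mean (\<lambda>y. F (y, t) * g y)) has_real_derivative
      sphere_mean (\<lambda>y. dir_deriv F (0, 1) (y, t) * g y)) (at t)"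
proof -
  let ?G = "dir_deriv F (0, 1)"
  note cF = continuous_parametric_integrand[OF smooth_continuous_on[OF F] g]
    and cG = continuous_parametric_integrand[OF smooth_continuous_on[OF smooth_frechet_derivative[OF F]] g]
  show ?thesis
    unfolding sphere_mean_def test_box_def
  proof (rule leibniz_rule_field_derivative[where U = UNIV and fx = "\<lambda>t x. bump (x \<bullet> x) * (?G (sgn x, t) * g (sgn x))"])
    fix t and x :: "real^'n"
    show "((\<lambda>t. bump (x \<bullet> x) * (F (sgn x, t) * g (sgn x))) has_real_derivative bump (x \<bullet> x) * (?G (sgn x, t) * g (sgn x))) (at t)"
    proof (cases "x = 0")
      case False
      then show ?thesis by (intro DERIV_cmult DERIV_cmult_right time_derivative[OF F]) (simp add: sgn_zero_iff)
    qed (simp add: bump_zero)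
  next
    fix t
    show "(\<lambda>x. bump (x \<bullet> x) * (F (sgn x, t) * g (sgn x))) integrable_on cbox (- 3 *\<^sub>R One) (3 *\<^sub>R One)"
    proof (rule integrable_continuous)
      have "continuous_on (cbox (- 3 *\<^sub>R One) (3 *\<^sub>R One)) (\<lambda>x. (\<lambda>(t, x). bump (x \<bullet> x) * (F (sgn x, t) * g (sgn x))) (t, x))"
        by (rule continuous_on_compose2[OF cF]) (auto intro!: continuous_intros)
      then show "continuous_on (cbox (- 3 *\<^sub>R One) (3 *\<^sub>R One)) (\<lambda>x. bump (x \<bullet> x) * (F (sgn x, t) * g (sgn x)))" by simp
    qed
  qed (use continuous_on_subset[OF cG] in auto)
qed

lemma (in rotational_immersion) separated_eigenfunction:
  fixes z g g' g'' :: "real \<Rightarrow> real" and e y :: "real^'n"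
  assumes z: "smooth_on_open UNIV z" and e: "norm e = 1" and g_smooth: "smooth_on_open UNIV g"
    and g: "\<And>s. (g has_real_derivative g' s) (at s)" "\<And>s. (g' has_real_derivative g'' s) (at s)"
    and geg: "\<And>s. (1 - s\<^sup>2) * g'' s - (real CARD('n) - 1) * s * g' s = - \<alpha> * g s"
    and y: "y \<in> unit_sphere"
  defines "f \<equiv> \<lambda>(y, t). z t * g (y \<bullet> e)"
  shows "smooth_along cylinder f"
    and "laplacian cylinder Psi f (y, t) = (deriv (deriv z) t + (real CARD('n) - 1) * (r' t / r t) * deriv z t - \<alpha> / (r t)\<^sup>2 * z t) * g (y \<bullet> e)"
proof -
  have "smooth_on_open UNIV f"
    unfolding f_def case_prod_beta
    by (intro smooth_mult open_UNIV smooth_compose[OF open_UNIV open_UNIV _ _ z] smooth_compose[OF open_UNIV open_UNIV _ _ g_smooth]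
        smooth_inner smooth_const smooth_fst[OF open_UNIV smooth_id[OF open_UNIV]] smooth_snd[OF open_UNIV smooth_id[OF open_UNIV]]) auto
  then show f: "smooth_along cylinder f" by (rule smooth_along_UNIV)
  define F where "F = radial_extension f"
  have F_eq: "F (x, t) = z t * g (sgn x \<bullet> e)" for x t by (simp add: F_def radial_extension_def f_def)
  have F: "smooth_on_open punctured F" unfolding F_def by (rule radial_extension_smooth[OF f])
  have y1: "norm y = 1" using y by (simp add: unit_sphere_def)
  then have y0: "y \<noteq> 0" and ys: "sgn y = y" by (auto simp: sgn_div_norm)
  have yy: "y \<bullet> y = 1" using y1 by (simp add: norm_eq_1)
  have z': "(z has_real_derivative deriv z t) (at t)" for t by (rule smooth_deriv[OF z]) simp
  have z'': "(deriv z has_real_derivative deriv (deriv z) t) (at t)" for t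
    by (rule smooth_deriv[OF smooth_on_deriv[OF open_UNIV z]]) simp
  have Ft: "dir_deriv F (0, 1) (y, t) = deriv z t * g (y \<bullet> e)" for t
  proof (rule DERIV_unique[OF time_derivative[OF F y0]])
    show "((\<lambda>t. F (y, t)) has_real_derivative deriv z t * g (y \<bullet> e)) (at t)"
      unfolding F_eq ys by (rule DERIV_cmult_right[OF z'])
  qed
  have Ftt: "dir_deriv (dir_deriv F (0, 1)) (0, 1) (y, t) = deriv (deriv z) t * g (y \<bullet> e)"
  proof (rule DERIV_unique[OF time_derivative[OF smooth_frechet_derivative[OF F] y0]])
    show "((\<lambda>t. dir_deriv F (0, 1) (y, t)) has_real_derivative deriv (deriv z) t * g (y \<bullet> e)) (at t)"
      unfolding Ft by (rule DERIV_cmult_right[OF z''])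
  qed
  have lap: "flat_laplacian (\<lambda>x. F (x, t)) y = - \<alpha> * (z t * g (y \<bullet> e))"
  proof -
    have "(y \<bullet> y) * flat_laplacian (\<lambda>x. z t * g (sgn x \<bullet> e)) y
      = (1 - (sgn y \<bullet> e)\<^sup>2) * (z t * g'' (sgn y \<bullet> e)) - (real DIM(real^'n) - 1) * (sgn y \<bullet> e) * (z t * g' (sgn y \<bullet> e))"
      by (rule flat_laplacian_ridge[OF e y0]) (intro DERIV_cmult g)+
    also have "\<dots> = z t * ((1 - (y \<bullet> e)\<^sup>2) * g'' (y \<bullet> e) - (real CARD('n) - 1) * (y \<bullet> e) * g' (y \<bullet> e))"
      by (simp add: ys algebra_simps)
    finally show ?thesis unfolding geg yy by (simp add: F_eq)
  qed
  show "laplacian cylinder Psi f (y, t) = (deriv (deriv z) t + (real CARD('n) - 1) * (r' t / r t) * deriv z t - \<alpha> / (r t)\<^sup>2 * z t) * g (y \<bullet> e)"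
    using laplacian_rotational[OF f y, of t, folded F_def] unfolding Ft Ftt lap by (simp add: algebra_simps)
qed

text \<open>In dimension at least \<open>2\<close> a height function takes every value in \<open>[- 1, 1]\<close>, so a nonzero polynomial
  does not vanish on all of them.\<close>

lemma height_range:
  assumes "CARD('n::finite) \<ge> 2" "\<bar>s\<bar> \<le> 1"
  shows "\<exists>e y :: real^'n. norm e = 1 \<and> norm y = 1 \<and> y \<bullet> e = s \<and> e = axis (SOME i. True) 1"
proof -
  let ?i = "SOME i :: 'n. True"
  have "\<exists>j. j \<noteq> ?i"
  proof (rule ccontr)
    assume "\<not> ?thesis"
    then have "UNIV = {?i}" by auto
    then have "CARD('n) = 1" by (metis card_1_singleton_iff One_nat_def)
    then show False using assms by simp
  qed
  then obtain j where j: "j \<noteq> ?i" by blast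
  let ?e = "axis ?i 1 :: real^'n" and ?f = "axis j 1 :: real^'n"
  let ?y = "s *\<^sub>R ?e + sqrt (1 - s\<^sup>2) *\<^sub>R ?f"
  have ef: "?e \<bullet> ?e = 1" "?f \<bullet> ?f = 1" "?e \<bullet> ?f = 0" "?f \<bullet> ?e = 0" using j by (simp_all add: inner_axis_axis)
  have s: "s\<^sup>2 \<le> 1" using assms(2) by (simp add: abs_square_le_1)
  have "?y \<bullet> ?y = 1" using s by (simp add: inner_add_left inner_add_right ef flip: power2_eq_square)
  moreover have "?y \<bullet> ?e = s" by (simp add: inner_add_left ef)
  ultimately show ?thesis using ef(1) by (intro exI[of _ ?e] exI[of _ ?y]) (simp add: norm_eq_1)
qed

lemma gegenbauer_height_nonzero:
  assumes "CARD('n::finite) \<ge> 2" "p \<noteq> (0 :: real poly)"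
  obtains e y :: "real^'n" where "norm e = 1" "y \<in> unit_sphere" "poly p (y \<bullet> e) \<noteq> 0"
proof -
  have "infinite {-1..1::real}" by simp
  then obtain s where s: "s \<in> {-1..1}" "poly p s \<noteq> 0"
    using poly_roots_finite[OF assms(2)] finite_subset[of "{-1..1}" "{s. poly p s = 0}"] by blast
  then have "\<bar>s\<bar> \<le> 1" by auto
  then show ?thesis using height_range[OF assms(1), of s] s(2) that by (auto simp: unit_sphere_def)
qed

lemma poly_smooth: "smooth_on_open UNIV (poly p :: real \<Rightarrow> real)"
  unfolding poly_altdef[abs_def] by (intro smooth_intros open_UNIV)

text \<open>If a function on the sphere does not vanish, then some height moment does not; the first nonzero
  one isolates a single eigenvalue of the sphere.\<close>

lemma first_nonzero_moment:
  fixes F :: "(real^'n) \<times> real \<Rightarrow> real"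
  assumes F: "smooth_on_open punctured F" and nz: "F (y, t) \<noteq> 0" "y \<in> unit_sphere"
  obtains e k s where "norm e = 1" "sphere_mean (\<lambda>y. F (y, s) * (y \<bullet> e) ^ k) \<noteq> 0"
    "\<And>s j. j < k \<Longrightarrow> sphere_mean (\<lambda>y. F (y, s) * (y \<bullet> e) ^ j) = 0"
proof -
  have "continuous_on (sphere 0 1) (\<lambda>x. F (x, t))"
    by (rule continuous_on_subset[OF smooth_continuous_on[OF slice_smooth[OF F]]]) auto
  then have "\<exists>e k. norm e = 1 \<and> sphere_mean (\<lambda>y. F (y, t) * (y \<bullet> e) ^ k) \<noteq> 0"
    using zero_if_height_moments_zero[of "\<lambda>x. F (x, t)" y] nz unfolding unit_sphere_def by blast
  then obtain e k0 where e: "norm e = 1" and "\<exists>s. sphere_mean (\<lambda>y. F (y, s) * (y \<bullet> e) ^ k0) \<noteq> 0" by blast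
  then obtain k where "\<exists>s. sphere_mean (\<lambda>y. F (y, s) * (y \<bullet> e) ^ k) \<noteq> 0"
    and "\<And>j. j < k \<Longrightarrow> \<not> (\<exists>s. sphere_mean (\<lambda>y. F (y, s) * (y \<bullet> e) ^ j) \<noteq> 0)"
    using exists_least_iff[of "\<lambda>k. \<exists>s. sphere_mean (\<lambda>y. F (y, s) * (y \<bullet> e) ^ k) \<noteq> 0"] by blast
  then show ?thesis using that e by blast
qed

lemma moment_laplacian_first:
  fixes F :: "(real^'n) \<Rightarrow> real"
  assumes F: "smooth_on_open (- {0}) F" and hom: "\<And>x s. s > 0 \<Longrightarrow> F (s *\<^sub>R x) = F x" and e: "norm e = 1"
    and low: "\<And>j. j < k \<Longrightarrow> sphere_mean (\<lambda>y. F y * (y \<bullet> e) ^ j) = 0"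
  shows "sphere_mean (\<lambda>y. flat_laplacian F y * (y \<bullet> e) ^ k) = - alpha (CARD('n)) (k + 1) * sphere_mean (\<lambda>y. F y * (y \<bullet> e) ^ k)"
proof -
  have "real k * (real k - 1) * sphere_mean (\<lambda>y. F y * (y \<bullet> e) ^ (k - 2)) = 0"
    using low[of "k - 2"] by (cases "k = 0 \<or> k = 1") auto
  moreover have "alpha (CARD('n)) (k + 1) = real k * (real k + real DIM(real^'n) - 2)" by (simp add: alpha_def)
  ultimately show ?thesis using height_moment_laplacian[OF F hom e, of k] by (simp only: mult_minus_left diff_0)
qed

text \<open>The height moments of an eigenfunction are periodic solutions of the separated equation.\<close>

theorem (in rotational_immersion) eigenfunction_moment:
  assumes dr: "r' = deriv r" and f: "f \<in> smooth_functions_M P" and nz: "\<exists>p\<in>cylinder. f p \<noteq> 0"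
    and eq: "\<And>y t. y \<in> unit_sphere \<Longrightarrow> laplacian cylinder Psi f (y, t) + W t * f (y, t) + \<mu> * f (y, t) = 0"
  shows "\<exists>k\<ge>1. \<mu> \<in> periodic_spectrum P (warped_operator (CARD('n)) r (\<lambda>t. W t - alpha (CARD('n)) k / (r t)\<^sup>2))"
proof -
  have fs: "smooth_along cylinder f" and per: "\<And>y t. y \<in> unit_sphere \<Longrightarrow> f (y, t + P) = f (y, t)"
    using f by (auto simp: smooth_functions_M_def)
  define F where "F = radial_extension f"
  have F: "smooth_on_open punctured F" unfolding F_def by (rule radial_extension_smooth[OF fs])
  have hom: "F (s *\<^sub>R x, t) = F (x, t)" if "s > 0" for x s t
    using that by (simp add: F_def radial_extension_def sgn_scaleR)
  have fF: "F (y, t) = f (y, t)" if "y \<in> sphere 0 1" for y t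
    unfolding F_def by (rule radial_extension_eq) (use that in \<open>simp add: cylinder_def unit_sphere_def\<close>)
  obtain y0 t0 where "(y0, t0) \<in> cylinder" "f (y0, t0) \<noteq> 0" using nz by (metis surj_pair)
  then have y0: "F (y0, t0) \<noteq> 0" "y0 \<in> unit_sphere"
    using fF[of y0 t0] by (auto simp: cylinder_def unit_sphere_def)
  obtain e k s where e: "norm e = 1" and ks: "sphere_mean (\<lambda>y. F (y, s) * (y \<bullet> e) ^ k) \<noteq> 0"
    and low: "\<And>s j. j < k \<Longrightarrow> sphere_mean (\<lambda>y. F (y, s) * (y \<bullet> e) ^ j) = 0"
    by (rule first_nonzero_moment[OF F y0]) (rule that)
  define g where "g = (\<lambda>y :: real^'n. (y \<bullet> e) ^ k)"
  have g: "continuous_on (sphere 0 1) g" unfolding g_def by (intro continuous_intros)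
  define F1 where "F1 = dir_deriv F (0, 1)"
  define F2 where "F2 = dir_deriv F1 (0, 1)"
  define D where "D t = flat_laplacian (\<lambda>x. F (x, t))" for t
  have F1: "smooth_on_open punctured F1" unfolding F1_def by (rule smooth_frechet_derivative[OF F])
  have F2: "smooth_on_open punctured F2" unfolding F2_def by (rule smooth_frechet_derivative[OF F1])
  define u u1 u2 where "u t = sphere_mean (\<lambda>y. F (y, t) * g y)" and "u1 t = sphere_mean (\<lambda>y. F1 (y, t) * g y)"
    and "u2 t = sphere_mean (\<lambda>y. F2 (y, t) * g y)" for t
  note u_defs = this
  have du: "(u has_real_derivative u1 t) (at t)" "(u1 has_real_derivative u2 t) (at t)" for t
    unfolding u_defs F2_def F1_def by (rule sphere_mean_time_derivative[OF _ g], (rule F smooth_frechet_derivative)+)+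
  have du_eq: "deriv u = u1" "deriv u1 = u2" using du DERIV_imp_deriv by blast+
  have sub: "sphere 0 1 \<subseteq> - {0 :: real^'n}" by auto
  have c: "continuous_on (sphere 0 1) (\<lambda>y. G (y, t) * g y)" if "smooth_on_open punctured G" for G :: "(real^'n) \<times> real \<Rightarrow> real" and t
    by (intro continuous_on_mult g continuous_on_subset[OF smooth_continuous_on[OF slice_smooth[OF that]] sub])
  have cD: "continuous_on (sphere 0 1) (\<lambda>y. D t y * g y)" for t
    unfolding D_def flat_laplacian_def
    by (intro continuous_on_mult g continuous_on_sum continuous_on_subset[OF smooth_continuous_on[OF
          smooth_frechet_derivative[OF smooth_frechet_derivative[OF slice_smooth[OF F]]]] sub])
  have ode: "u2 t + (real CARD('n) - 1) * (r' t / r t) * u1 t + (W t - alpha (CARD('n)) (k + 1) / (r t)\<^sup>2) * u t + \<mu> * u t = 0" for t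
  proof -
    let ?a = "(real CARD('n) - 1) * (r' t / r t)" and ?b = "1 / (r t)\<^sup>2" and ?c = "W t + \<mu>"
    have pde: "F2 (y, t) * g y + (?a * (F1 (y, t) * g y) + (?b * (D t y * g y) + ?c * (F (y, t) * g y))) = 0" if y: "y \<in> sphere 0 1" for y
    proof -
      have y': "y \<in> unit_sphere" using y by (simp add: unit_sphere_def)
      have "F2 (y, t) + ?a * F1 (y, t) + D t y / (r t)\<^sup>2 + W t * F (y, t) + \<mu> * F (y, t) = 0"
        using eq[OF y', of t] laplacian_rotational[OF fs y', of t, folded F_def] fF[OF y, of t]
        by (simp add: F1_def F2_def D_def)
      then have "(F2 (y, t) + ?a * F1 (y, t) + D t y / (r t)\<^sup>2 + W t * F (y, t) + \<mu> * F (y, t)) * g y = 0" by simp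
      then show ?thesis by (simp add: algebra_simps)
    qed
    have "0 = sphere_mean (\<lambda>y :: real^'n. 0)" by (simp add: sphere_mean_def)
    also have "\<dots> = sphere_mean (\<lambda>y. F2 (y, t) * g y + (?a * (F1 (y, t) * g y) + (?b * (D t y * g y) + ?c * (F (y, t) * g y))))"
      by (rule sphere_mean_cong) (simp only: pde)
    also have "\<dots> = u2 t + (?a * u1 t + (?b * sphere_mean (\<lambda>y. D t y * g y) + ?c * u t))"
      unfolding u_defs
      by (subst sphere_mean_add, (intro continuous_on_add continuous_on_mult_left c cD F F1 F2)+)+
        (simp only: sphere_mean_cmult)
    also have "sphere_mean (\<lambda>y. D t y * g y) = - alpha (CARD('n)) (k + 1) * u t"
      unfolding D_def g_def u_defs by (rule moment_laplacian_first[OF slice_smooth[OF F] hom e low])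
    finally show ?thesis by (simp add: algebra_simps)
  qed
  have "u (t + P) = u t" for t
    unfolding u_defs
  proof (rule sphere_mean_cong)
    fix y :: "real^'n" assume y: "y \<in> sphere 0 1"
    show "F (y, t + P) * g y = F (y, t) * g y" using per[of y t] fF[OF y] y by (simp add: unit_sphere_def)
  qed
  moreover have "u s \<noteq> 0" using ks by (simp add: u_defs g_def)
  ultimately have "\<mu> \<in> periodic_spectrum P (warped_operator (CARD('n)) r (\<lambda>t. W t - alpha (CARD('n)) (k + 1) / (r t)\<^sup>2))"
    unfolding periodic_spectrum_def warped_operator_def
    using du ode du_eq dr by (auto simp: real_differentiable_def intro!: exI[of _ u])
  then show ?thesis by (intro exI[of _ "k + 1"]) simp
qed

text \<open>A periodic solution is smooth because the coefficients are, so its product with a polynomial in a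
  height is an admissible function.\<close>

theorem (in rotational_immersion) moment_eigenfunction:
  assumes n: "CARD('n) \<ge> 2" and r_smooth: "smooth_on_open UNIV r" and dr: "r' = deriv r"
    and W: "smooth_on_open UNIV W" and k: "k \<ge> 1"
    and \<mu>: "\<mu> \<in> periodic_spectrum P (warped_operator (CARD('n)) r (\<lambda>t. W t - alpha (CARD('n)) k / (r t)\<^sup>2))"
  shows "\<exists>f\<in>smooth_functions_M P. (\<exists>p\<in>cylinder. f p \<noteq> 0) \<and>
     (\<forall>y\<in>unit_sphere. \<forall>t. laplacian cylinder Psi f (y, t) + W t * f (y, t) + \<mu> * f (y, t) = 0)"
proof -
  let ?n = "CARD('n)" and ?j = "k - 1"
  obtain z where z: "\<And>t. z differentiable (at t)" "\<And>t. deriv z differentiable (at t)" "\<And>t. z (t + P) = z t" "\<exists>t. z t \<noteq> 0"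
    "\<And>t. warped_operator ?n r (\<lambda>t. W t - alpha ?n k / (r t)\<^sup>2) z t + \<mu> * z t = 0"
    using \<mu> unfolding periodic_spectrum_def by blast
  have zs: "smooth_on_open UNIV z"
  proof (rule linear_ode_smooth[OF z(1,2)])
    show "deriv (deriv z) t = (- (real ?n - 1) * (deriv r t * inverse (r t))) * deriv z t
        + (alpha ?n k * inverse (r t) ^ 2 - W t - \<mu>) * z t" for t
      using z(5)[of t] by (simp add: warped_operator_def divide_inverse power_inverse algebra_simps)
    show "smooth_on_open UNIV (\<lambda>t. - (real ?n - 1) * (deriv r t * inverse (r t)))"
      "smooth_on_open UNIV (\<lambda>t. alpha ?n k * inverse (r t) ^ 2 - W t - \<mu>)"
      by (intro smooth_intros open_UNIV r_smooth smooth_on_deriv W r_pos)+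
  qed
  let ?p = "gegenbauer ?n ?j"
  have geg: "(1 - s\<^sup>2) * poly (pderiv (pderiv ?p)) s - (real ?n - 1) * s * poly (pderiv ?p) s = - alpha ?n k * poly ?p s" for s
    unfolding gegenbauer_equation using k by (simp add: alpha_def of_nat_diff)
  obtain e y where e: "norm e = 1" and y: "y \<in> (unit_sphere :: (real^'n) set)" "poly ?p (y \<bullet> e) \<noteq> 0"
    by (rule gegenbauer_height_nonzero[OF n gegenbauer_nonzero])
  define f where "f = (\<lambda>(y, t). z t * poly ?p (y \<bullet> e))"
  note sep = separated_eigenfunction[OF zs e poly_smooth poly_DERIV poly_DERIV geg, folded f_def]
  have "f \<in> smooth_functions_M P" using sep(1)[OF y(1)] z(3) by (simp add: smooth_functions_M_def f_def)
  moreover have "\<exists>p\<in>cylinder. f p \<noteq> 0"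
  proof -
    obtain t where "z t \<noteq> 0" using z(4) by blast
    then show ?thesis using y by (intro bexI[of _ "(y, t)"]) (auto simp: f_def cylinder_def)
  qed
  moreover have "laplacian cylinder Psi f (x, t) + W t * f (x, t) + \<mu> * f (x, t) = 0" if "x \<in> unit_sphere" for x t
  proof -
    have "laplacian cylinder Psi f (x, t) + W t * f (x, t) + \<mu> * f (x, t)
      = (warped_operator ?n r (\<lambda>t. W t - alpha ?n k / (r t)\<^sup>2) z t + \<mu> * z t) * poly ?p (x \<bullet> e)"
      unfolding sep(2)[OF that] by (simp add: warped_operator_def f_def dr algebra_simps)
    then show ?thesis by (simp add: z(5))
  qed
  ultimately show ?thesis by blast
qed

section \<open>The spectrum of the sphere\<close>

lemma alpha_strict_mono: "n \<ge> 2 \<Longrightarrow> strict_mono_on {1..} (alpha n)"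
proof (rule strict_mono_onI)
  fix j k :: nat assume n: "n \<ge> 2" and jk: "j \<in> {1..}" "k \<in> {1..}" "j < k"
  then have "real j \<ge> 1" "real j + 1 \<le> real k" "real n \<ge> 2" by auto
  then have "(real j - 1) * (real n + real j - 3) \<le> (real j - 1) * (real n + real k - 3)"
    and "(real j - 1) * (real n + real k - 3) < (real k - 1) * (real n + real k - 3)"
    by (intro mult_left_mono mult_strict_right_mono; linarith)+
  then show "alpha n j < alpha n k" unfolding alpha_def by linarith
qed

theorem sphere_spectrum:
  assumes n: "CARD('n::finite) \<ge> 2"
  shows "sphere_laplace_spectrum TYPE('n) = alpha (CARD('n)) ` {1..}"
proof (intro set_eqI iffI)
  let ?S = "unit_sphere :: (real^'n) set"
  fix \<mu> assume "\<mu> \<in> sphere_laplace_spectrum TYPE('n)"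
  then obtain f y0 where f: "smooth_along ?S f" and y0: "y0 \<in> ?S" "f y0 \<noteq> 0"
    and eq: "\<And>y. y \<in> ?S \<Longrightarrow> laplacian ?S (\<lambda>y. y) f y + \<mu> * f y = 0"
    unfolding sphere_laplace_spectrum_def laplace_spectrum_def by blast
  define F where "F = (\<lambda>x. f (sgn x))"
  have F: "smooth_on_open (- {0}) F"
    unfolding F_def
  proof (rule smooth_along_extension[OF f _ smooth_sgn])
    show "sgn ` (- {0}) \<subseteq> ?S" unfolding unit_sphere_def using sgn_in_sphere by blast
  qed auto
  have hom: "F (s *\<^sub>R x) = F x" if "s > 0" for x s using that by (simp add: F_def sgn_scaleR)
  have fF: "F y = f y" if "y \<in> ?S" for y using that by (simp add: F_def unit_sphere_def sgn_div_norm)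
  \<comment> \<open>regarded as a function on the cylinder that does not depend on \<open>t\<close>\<close>
  define F0 where "F0 = (\<lambda>p :: (real^'n) \<times> real. F (fst p))"
  have F0: "smooth_on_open punctured F0"
    unfolding F0_def
    by (rule smooth_compose[OF open_punctured _ _ _ F]) (auto intro: smooth_fst[OF open_punctured smooth_id[OF open_punctured]])
  have nz0: "F0 (y0, 0) \<noteq> 0" using y0 fF by (simp add: F0_def)
  obtain e k s where e: "norm e = 1" and ks: "sphere_mean (\<lambda>y. F0 (y, s) * (y \<bullet> e) ^ k) \<noteq> 0"
    and low: "\<And>s j. j < k \<Longrightarrow> sphere_mean (\<lambda>y. F0 (y, s) * (y \<bullet> e) ^ j) = 0"
    by (rule first_nonzero_moment[OF F0 nz0 y0(1)]) (rule that)
  have low': "sphere_mean (\<lambda>y. F y * (y \<bullet> e) ^ j) = 0" if "j < k" for j using low[OF that, of 0] by (simp add: F0_def)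
  have "sphere_mean (\<lambda>y. flat_laplacian F y * (y \<bullet> e) ^ k) = sphere_mean (\<lambda>y. (- \<mu>) * (F y * (y \<bullet> e) ^ k))"
  proof (rule sphere_mean_cong)
    fix y :: "real^'n" assume "y \<in> sphere 0 1"
    then have y: "y \<in> ?S" by (simp add: unit_sphere_def)
    have "flat_laplacian F y = - \<mu> * F y"
      using eq[OF y] laplacian_sphere[OF f y] fF[OF y] by (simp add: F_def)
    then show "flat_laplacian F y * (y \<bullet> e) ^ k = - \<mu> * (F y * (y \<bullet> e) ^ k)" by simp
  qed
  moreover have "sphere_mean (\<lambda>y. flat_laplacian F y * (y \<bullet> e) ^ k)
      = - alpha (CARD('n)) (k + 1) * sphere_mean (\<lambda>y. F y * (y \<bullet> e) ^ k)"
    by (rule moment_laplacian_first[OF F hom e low'])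
  ultimately have "- alpha (CARD('n)) (k + 1) * sphere_mean (\<lambda>y. F y * (y \<bullet> e) ^ k)
      = - \<mu> * sphere_mean (\<lambda>y. F y * (y \<bullet> e) ^ k)" by (simp only: sphere_mean_cmult)
  then have "alpha (CARD('n)) (k + 1) = \<mu>" using ks by (simp add: F0_def)
  then show "\<mu> \<in> alpha (CARD('n)) ` {1..}" by (intro image_eqI[of _ _ "k + 1"]) auto
next
  let ?S = "unit_sphere :: (real^'n) set"
  fix \<mu> assume "\<mu> \<in> alpha (CARD('n)) ` {1..}"
  then obtain k where k: "k \<ge> 1" "\<mu> = alpha (CARD('n)) k" by auto
  let ?p = "gegenbauer (CARD('n)) (k - 1)"
  obtain e y where e: "norm e = 1" and y: "y \<in> ?S" "poly ?p (y \<bullet> e) \<noteq> 0"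
    by (rule gegenbauer_height_nonzero[OF n gegenbauer_nonzero])
  define f where "f = (\<lambda>y :: real^'n. poly ?p (y \<bullet> e))"
  have "smooth_on_open UNIV f"
    unfolding f_def
    by (rule smooth_compose[OF open_UNIV open_UNIV _ _ poly_smooth]) (auto intro!: smooth_intros)
  then have f: "smooth_along ?S f" by (rule smooth_along_UNIV)
  have "laplacian ?S (\<lambda>y. y) f x + \<mu> * f x = 0" if x: "x \<in> ?S" for x
  proof -
    have "norm x = 1" using x by (simp add: unit_sphere_def)
    then have x': "x \<noteq> 0" "sgn x = x" "x \<bullet> x = 1" by (auto simp: sgn_div_norm simp flip: norm_eq_1)
    have "(x \<bullet> x) * flat_laplacian (\<lambda>x. poly ?p (sgn x \<bullet> e)) x
      = (1 - (sgn x \<bullet> e)\<^sup>2) * poly (pderiv (pderiv ?p)) (sgn x \<bullet> e) - (real DIM(real^'n) - 1) * (sgn x \<bullet> e) * poly (pderiv ?p) (sgn x \<bullet> e)"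
      by (rule flat_laplacian_ridge[OF e x'(1) poly_DERIV poly_DERIV])
    also have "\<dots> = - \<mu> * f x"
      using gegenbauer_equation[of "sgn x \<bullet> e" "CARD('n)" "k - 1"] k by (simp add: x' f_def alpha_def of_nat_diff)
    finally show ?thesis unfolding laplacian_sphere[OF f x] x'(3) by (simp add: f_def)
  qed
  then show "\<mu> \<in> sphere_laplace_spectrum TYPE('n)"
    unfolding sphere_laplace_spectrum_def laplace_spectrum_def using f y by (auto simp: f_def intro!: bexI[of _ f])
qed

section \<open>The spectra of the hypersurface\<close>

text \<open>The Laplacian and the Jacobi operator differ by a potential that depends on \<open>t\<close> only, so both are
  instances of one statement: the moment of an eigenfunction is a periodic solution, and the product
  of a periodic solution with a Gegenbauer polynomial of a height is an eigenfunction.\<close>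

theorem (in cmc_profile) hypersurface_spectrum:
  assumes dim: "CARD('n::finite) = n" and n: "n \<ge> 2" and W: "smooth_on_open UNIV W"
  shows "{\<mu>. \<exists>f\<in>smooth_functions_M P. (\<exists>p\<in>cylinder. f p \<noteq> 0) \<and>
      (\<forall>y\<in>unit_sphere. \<forall>t. laplacian cylinder (phi H c r :: (real^'n) \<times> real \<Rightarrow> _) f (y, t) + W t * f (y, t) + \<mu> * f (y, t) = 0)}
     = (\<Union>k\<in>{1..}. periodic_spectrum P (warped_operator n r (\<lambda>t. W t - alpha n k / (r t)\<^sup>2)))"
proof -
  obtain \<gamma>'' where "rotational_immersion r \<gamma> r' r'' \<gamma>' \<gamma>'' (phi H c r :: (real^'n) \<times> real \<Rightarrow> _)"
    by (rule rotational[OF dim])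
  then interpret rotational_immersion r \<gamma> r' r'' \<gamma>' \<gamma>'' "phi H c r :: (real^'n) \<times> real \<Rightarrow> _" .
  have n': "CARD('n) \<ge> 2" using dim n by simp
  show ?thesis
  proof (intro set_eqI iffI)
    fix \<mu> assume "\<mu> \<in> {\<mu>. \<exists>f\<in>smooth_functions_M P. (\<exists>p\<in>cylinder. f p \<noteq> 0) \<and>
      (\<forall>y\<in>unit_sphere. \<forall>t. laplacian cylinder (phi H c r :: (real^'n) \<times> real \<Rightarrow> _) f (y, t) + W t * f (y, t) + \<mu> * f (y, t) = 0)}"
    then show "\<mu> \<in> (\<Union>k\<in>{1..}. periodic_spectrum P (warped_operator n r (\<lambda>t. W t - alpha n k / (r t)\<^sup>2)))"
      using eigenfunction_moment[OF refl, of _ P W \<mu>] unfolding dim by fastforce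
  next
    fix \<mu> assume "\<mu> \<in> (\<Union>k\<in>{1..}. periodic_spectrum P (warped_operator n r (\<lambda>t. W t - alpha n k / (r t)\<^sup>2)))"
    then obtain k where "k \<ge> 1" "\<mu> \<in> periodic_spectrum P (warped_operator n r (\<lambda>t. W t - alpha n k / (r t)\<^sup>2))" by auto
    then show "\<mu> \<in> {\<mu>. \<exists>f\<in>smooth_functions_M P. (\<exists>p\<in>cylinder. f p \<noteq> 0) \<and>
      (\<forall>y\<in>unit_sphere. \<forall>t. laplacian cylinder (phi H c r :: (real^'n) \<times> real \<Rightarrow> _) f (y, t) + W t * f (y, t) + \<mu> * f (y, t) = 0)}"
      using moment_eigenfunction[OF n' r_smooth refl W, of k \<mu> P] unfolding dim by blast
  qed
qed

theorem theorem3p3: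
  fixes n :: nat and H c T :: real and r :: "real \<Rightarrow> real" and l m :: int
  assumes dim: "CARD('n::finite) = n"
    and data: "rotational_data n H c r T l m"
  shows
    "ordered_listing (alpha n) (sphere_laplace_spectrum TYPE('n))
     \<and> (\<exists>ev :: nat \<Rightarrow> nat \<Rightarrow> real.
          (\<forall>k\<ge>1. ordered_listing (ev k)
                   (periodic_spectrum (real_of_int m * T) (K_Delta n r k))) \<and>
          M_laplace_spectrum TYPE('n) H c r (real_of_int m * T) = (\<Union>k\<in>{1..}. ev k ` {1..}))
     \<and> (\<exists>ev :: nat \<Rightarrow> nat \<Rightarrow> real.
          (\<forall>k\<ge>1. ordered_listing (ev k)
                   (periodic_spectrum (real_of_int m * T) (K_J n H c r k))) \<and>
          M_jacobi_spectrum TYPE('n) H c r (real_of_int m * T) = (\<Union>k\<in>{1..}. ev k ` {1..}))"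
proof -
  have n: "n \<ge> 2" and T: "T > 0" "\<And>t. r (t + T) = r t" and m: "m \<ge> 1"
    using data by (auto simp: rotational_data_def)
  interpret cmc_profile n H c r
    by unfold_locales (use data in \<open>auto simp: rotational_data_def\<close>)
  let ?P = "real_of_int m * T"
  have P: "?P > 0" using T(1) m by simp
  have per: "r (t + ?P) = r t" for t by (rule periodic_int_mult[of r T, OF T(2)])
  define V where "V t = real n + real n * H\<^sup>2 + real n * (real n - 1) * c powr (- real n) * r t powr (- 2 * real n)" for t
  have V: "smooth_on_open UNIV V"
    unfolding V_def by (intro smooth_intros open_UNIV r_smooth r_pos)
  have listing: "\<exists>a. ordered_listing a (periodic_spectrum ?P (warped_operator n r (\<lambda>t. W t - alpha n k / (r t)\<^sup>2)))"
    if W: "smooth_on_open UNIV W" "\<And>t. W (t + ?P) = W t" for W k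
  proof (rule warped_spectrum_listing[OF n P per])
    show "continuous_on UNIV (\<lambda>t. W t - alpha n k / (r t)\<^sup>2)"
      using r_pos by (intro continuous_intros smooth_continuous_on[OF W(1)] smooth_continuous_on[OF r_smooth]) (simp add: order_less_imp_not_eq2)
  qed (simp add: W(2) per)
  have assemble: "\<exists>ev :: nat \<Rightarrow> nat \<Rightarrow> real. (\<forall>k\<ge>1. ordered_listing (ev k) (S k)) \<and> M = (\<Union>k\<in>{1..}. ev k ` {1..})"
    if S: "\<And>k. \<exists>a. ordered_listing a (S k)" and M: "M = (\<Union>k\<in>{1..}. S k)" for S :: "nat \<Rightarrow> real set" and M
  proof -
    obtain ev where ev: "\<And>k. ordered_listing (ev k) (S k)" using S by metis
    then have "ev k ` {1..} = S k" for k by (simp add: ordered_listing_def)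
    then show ?thesis using ev M by (intro exI[of _ ev]) simp
  qed
  have KD: "K_Delta n r k = warped_operator n r (\<lambda>t. 0 - alpha n k / (r t)\<^sup>2)" for k
    by (intro ext) (simp add: K_Delta_def warped_operator_def)
  have KJ: "K_J n H c r k = warped_operator n r (\<lambda>t. V t - alpha n k / (r t)\<^sup>2)" for k
    by (intro ext) (simp add: K_J_def warped_operator_def V_def)
  have "ordered_listing (alpha n) (sphere_laplace_spectrum TYPE('n))"
    unfolding ordered_listing_def using sphere_spectrum[where 'n = 'n] alpha_strict_mono[OF n] n dim by simp
  moreover have "M_laplace_spectrum TYPE('n) H c r ?P = (\<Union>k\<in>{1..}. periodic_spectrum ?P (K_Delta n r k))"
    unfolding KD hypersurface_spectrum[OF dim n smooth_const[OF open_UNIV], symmetric]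
    by (simp add: M_laplace_spectrum_def laplace_spectrum_def cylinder_def)
  moreover have "M_jacobi_spectrum TYPE('n) H c r ?P = (\<Union>k\<in>{1..}. periodic_spectrum ?P (K_J n H c r k))"
  proof -
    have "jacobi_operator (CARD('n)) cylinder (phi H c r :: (real^'n) \<times> real \<Rightarrow> _) f (y, t) = \<mu>' * f (y, t) \<longleftrightarrow>
        laplacian cylinder (phi H c r) f (y, t) + V t * f (y, t) + \<mu>' * f (y, t) = 0" if "y \<in> unit_sphere" for f \<mu>' t and y :: "real^'n"
      unfolding jacobi_operator_def norm_A_squared_eq[OF dim that] principal_curvature_squares
      by (auto simp: V_def dim algebra_simps)
    then show ?thesis
      unfolding KJ hypersurface_spectrum[OF dim n V, symmetric] M_jacobi_spectrum_def jacobi_spectrum_def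
      by (simp add: cylinder_def)
  qed
  moreover have "\<exists>a. ordered_listing a (periodic_spectrum ?P (K_Delta n r k))" for k
    unfolding KD by (rule listing[OF smooth_const[OF open_UNIV]]) (rule refl)
  moreover have "\<exists>a. ordered_listing a (periodic_spectrum ?P (K_J n H c r k))" for k
    unfolding KJ by (rule listing[OF V]) (simp add: V_def per)
  ultimately show ?thesis by (intro conjI assemble)
qed

end
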